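(* Let $V,W$ be 2-term Leibniz infinity algebras, let $f,g,h:V\to W$ be infinity morphisms, and let $\theta_1:f\Rightarrow g$ and $\tau_1:g\Rightarrow h$ be 2-term $\infty$-homotopies. Then the vertical composite $\tau_1\circ_1\theta_1:f\Rightarrow h$, i.e. the projection to 2-term $\infty$-homotopies of a composite, in the simplicial set $\mathrm{MC}_\bullet(\bar L)$, of lifts of $\theta_1$ and $\tau_1$, is (independently of the choices of the lifts and of the composite) given by $$\tau_1\circ_1\theta_1=\tau_1+\theta_1 .$$
   Context: $\mathbb K$ is a field of characteristic $0$; everything is $\mathbb Z$-graded with homological degrees, and the Koszul sign rule is used throughout. **2-term Leibniz infinity algebra.** A graded vector space $V=V_0\oplus V_1$ with linear, bilinear, trilinear maps $l_1,l_2,l_3$ on $V$ of degrees $-1,0,1$ such that, for $w,x,y,z\in V_0$, $h,k\in V_1$: (a) $l_1l_2(x,h)=l_2(x,l_1h)$, $l_1l_2(h,x)=l_2(l_1h,x)$; (b) $l_2(l_1h,k)=l_2(h,l_1k)$; (c) $l_1l_3(x,y,z)=l_2(x,l_2(y,z))-l_2(y,l_2(x,z))-l_2(l_2(x,y),z)$; (d) $l_3(x,y,l_1h)=l_2(x,l_2(y,h))-l_2(y,l_2(x,h))-l_2(l_2(x,y),h)$, $l_3(x,l_1h,y)=l_2(x,l_2(h,y))-l_2(h,l_2(x,y))-l_2(l_2(x,h),y)$, $l_3(l_1h,x,y)=l_2(h,l_2(x,y))-l_2(x,l_2(h,y))-l_2(l_2(h,x),y)$; (e) $l_2(l_3(w,x,y),z)+l_2(w,l_3(x,y,z))-l_2(x,l_3(w,y,z))+l_2(y,l_3(w,x,z))-l_3(l_2(w,x),y,z)+l_3(w,l_2(x,y),z)-l_3(x,l_2(w,y),z)-l_3(w,x,l_2(y,z))+l_3(w,y,l_2(x,z))-l_3(x,y,l_2(w,z))=0$.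 **Infinity morphism** $f=(f_1,f_2):(V,l_i)\to(W,m_i)$: a linear map $f_1:V\to W$ of degree $0$ and a bilinear map $f_2:V\times V\to W$ of degree $1$ such that, for $x,y,z\in V_0$, $h\in V_1$: (a) $m_1f_1h=f_1l_1h$; (b) $m_2(f_1x,f_1y)+m_1f_2(x,y)=f_1l_2(x,y)$; (c) $m_2(f_1x,f_1h)=f_1l_2(x,h)-f_2(x,l_1h)$, $m_2(f_1h,f_1x)=f_1l_2(h,x)-f_2(l_1h,x)$; (d) $m_3(f_1x,f_1y,f_1z)-m_2(f_2(x,y),f_1z)+m_2(f_1x,f_2(y,z))-m_2(f_1y,f_2(x,z))=f_1l_3(x,y,z)+f_2(l_2(x,y),z)-f_2(x,l_2(y,z))+f_2(y,l_2(x,z))$. **2-term $\infty$-homotopy** $\theta_1:f\Rightarrow g$: a linear map $\theta_1:V\to W$ of degree $1$ such that, for $x,y\in V_0$, $h\in V_1$: (a) $g_1x-f_1x=m_1\theta_1x$; (b) $g_1h-f_1h=\theta_1l_1h$; (c) $g_2(x,y)-f_2(x,y)=\theta_1l_2(x,y)-m_2(f_1x,\theta_1y)-m_2(\theta_1x,g_1y)$. The set of these is $\mathcal T(f,g)$. **Convolution Lie infinity algebra.** $s$ denotes suspension, $(sV)_k=V_{k-1}$. Let $\mathrm{Zin}^c(sV)=\bigoplus_{n\ge1}(sV)^{\otimes n}$ with comultiplication $\Delta(v_1\cdots v_p)=\sum_{k=1}^{p-1}\sum_{\sigma\in \mathrm{Sh}(k,p-k-1)}\varepsilon(\sigma)\,(v_{\sigma(1)}\cdots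 v_{\sigma(k)})\otimes(v_{\sigma(k+1)}\cdots v_{\sigma(p-1)}v_p)$, and let $D$ be the unique degree $-1$ coderivation whose corestrictions $D_i:(sV)^{\otimes i}\to sV$ satisfy $l_i=s^{-1}D_i\,s^{\otimes i}$ ($D_i=0$ for $i>3$). The graded space $L=\mathrm{Hom}_{\mathbb K}(\mathrm{Zin}^c(sV),W)$ carries the Lie infinity structure $\mathcal L_1f=m_1\circ f+(-1)^{|f|}f\circ D$ and, for $p\ge2$, $\mathcal L_p(f_1,\dots,f_p)=m_p\circ\big(\sum_{\sigma\in S(p)}\varepsilon(\sigma)\,\mathrm{sign}(\sigma)\,f_{\sigma(1)}\otimes\cdots\otimes f_{\sigma(p)}\big)\circ\Delta^{p-1}$, with $\Delta^{p-1}=(\Delta\otimes\mathrm{id}^{\otimes(p-2)})\cdots(\Delta\otimes\mathrm{id})\Delta$. For degree reasons $L_k=0$ for $k>0$ and $L_0=\mathrm{Hom}(sV_0,W_1)$. An infinity morphism $f=(f_1,f_2)$ is identified with the Maurer–Cartan (MC) element $\alpha=\alpha^1+\alpha^2\in L_{-1}$ given by $f_1=\alpha^1s$, $f_2=\alpha^2s^{\otimes2}$; MC elements are the degree $-1$ solutions of $\sum_{p\ge1}\frac1{p!}(-1)^{p(p-1)/2}\mathcal L_p(\alpha,\dots,\alpha)=0$. **The simplicial set $\mathrm{MC}_\bullet(\bar L)$.** $\Omega^\star_n=\mathbb K[t_0,\dots,t_n,dt_0,\dots,dt_n]/(\sum t_i-1,\sum dt_i)$ is the polynomial de Rham algebra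 of the $n$-simplex, $k$-forms being placed in degree $-k$. $L\otimes\Omega_n^\star$ has the Lie infinity structure $\bar{\mathcal L}_1=\mathcal L_1\otimes\mathrm{id}+\mathrm{id}\otimes d$ (with $(\mathrm{id}\otimes d)(\ell\otimes\omega)=(-1)^{|\ell|}\ell\otimes d\omega$), $\bar{\mathcal L}_p(\ell_1\otimes\omega_1,\dots)=\pm\mathcal L_p(\ell_1,\dots,\ell_p)\otimes\omega_1\cdots\omega_p$ (Koszul sign), and $\mathrm{MC}_n(\bar L)$ is its set of MC elements. The face map $d_i$ is restriction to the face $t_i=0$ (the remaining coordinates being relabelled in order). For $n=1$ put $t=t_1$. An $\infty$-homotopy from $f$ to $g$ is an $\alpha\in\mathrm{MC}_1(\bar L)$ whose evaluation at $t=0$ is $f$ and at $t=1$ is $g$; the set of these is $\mathcal I(f,g)$. **The maps $S_1^i$.** Every $\alpha\in\mathrm{MC}_1(\bar L)$ reads $\alpha=a(t)\otimes1+r(t)\otimes dt$ with $a(t)\in L_{-1}[t]$, $r(t)\in L_0[t]$. Set $(h_1^0\alpha)(t)=\int_0^tr(u)\,du$, $(h_1^1\alpha)(t)=\int_1^tr(u)\,du$, and $S_1^i(\alpha)=\big((h_1^i\alpha)(1)-(h_1^i\alpha)(0)\big)\circ s$, a degree $1$ linear map $V\to W$. The maps $S^i_1$ restrict to surjections $\mathcal I(f,g)\to\mathcal T(f,g)$; a preimage of $\theta_1$ in $\mathcal I(f,g)$ is called a lift of $\theta_1$ by $S_1^i$. **Vertical composite.** Given $\theta_1\in\mathcal T(f,g)$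 and $\tau_1\in\mathcal T(g,h)$, choose a lift $\alpha'\in\mathcal I(f,g)$ of $\theta_1$ by $S_1^1$ and a lift $\alpha''\in\mathcal I(g,h)$ of $\tau_1$ by $S_1^0$. They form an inner horn $\Lambda^1[2]\to\mathrm{MC}_\bullet(\bar L)$ with $\alpha'$ on the edge $01$ and $\alpha''$ on the edge $12$. Choose a filler $\alpha\in\mathrm{MC}_2(\bar L)$ of this horn, i.e. $d_2\alpha=\alpha'$ and $d_0\alpha=\alpha''$. The edge $d_1\alpha\in\mathcal I(f,h)$ (restriction to $02$) is a composite of $\alpha',\alpha''$, and $\tau_1\circ_1\theta_1:=S_1^0(d_1\alpha)$. *)

theory Defs
  imports
    Complex_Main
    "HOL-Library.Poly_Mapping"
    "HOL-Library.Function_Algebras"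
    "HOL-Library.Product_Plus"
    "HOL-Combinatorics.Permutations"
begin

section \<open>2-term Leibniz infinity algebras, infinity morphisms, homotopies\<close>

text \<open>
  A graded vector space concentrated in degrees 0 and 1 is given by its two homogeneous
  components, here the types \<open>'a\<close> (degree 0) and \<open>'b\<close> (degree 1), with scalar multiplications
  \<open>smul0\<close>, \<open>smul1\<close>. A multilinear map of fixed degree is given by its components between
  homogeneous parts, those with a zero target being omitted: \<open>l1\<close> lives on degree 1,
  \<open>l2xx\<close>, \<open>l2xh\<close>, \<open>l2hx\<close> are the components of \<open>l\<^sub>2\<close> on degrees \<open>(0,0)\<close>, \<open>(0,1)\<close>, \<open>(1,0)\<close>, and
  \<open>l3\<close> lives on degrees \<open>(0,0,0)\<close>.
\<close>

record ('k, 'a, 'b) leibniz2 =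
  smul0 :: "'k \<Rightarrow> 'a \<Rightarrow> 'a"
  smul1 :: "'k \<Rightarrow> 'b \<Rightarrow> 'b"
  l1 :: "'b \<Rightarrow> 'a"
  l2xx :: "'a \<Rightarrow> 'a \<Rightarrow> 'a"
  l2xh :: "'a \<Rightarrow> 'b \<Rightarrow> 'b"
  l2hx :: "'b \<Rightarrow> 'a \<Rightarrow> 'b"
  l3 :: "'a \<Rightarrow> 'a \<Rightarrow> 'a \<Rightarrow> 'b"

definition bilinear_map ::
  "('k::field \<Rightarrow> 'a::ab_group_add \<Rightarrow> 'a) \<Rightarrow> ('k \<Rightarrow> 'b::ab_group_add \<Rightarrow> 'b) \<Rightarrow>
   ('k \<Rightarrow> 'c::ab_group_add \<Rightarrow> 'c) \<Rightarrow> ('a \<Rightarrow> 'b \<Rightarrow> 'c) \<Rightarrow> bool" where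
  "bilinear_map s1 s2 s3 f \<longleftrightarrow>
     (\<forall>y. Vector_Spaces.linear s1 s3 (\<lambda>x. f x y)) \<and> (\<forall>x. Vector_Spaces.linear s2 s3 (f x))"

definition trilinear_map ::
  "('k::field \<Rightarrow> 'a::ab_group_add \<Rightarrow> 'a) \<Rightarrow> ('k \<Rightarrow> 'b::ab_group_add \<Rightarrow> 'b) \<Rightarrow>
   ('a \<Rightarrow> 'a \<Rightarrow> 'a \<Rightarrow> 'b) \<Rightarrow> bool" where
  "trilinear_map s1 s2 f \<longleftrightarrow>
     (\<forall>y z. Vector_Spaces.linear s1 s2 (\<lambda>x. f x y z)) \<and>
     (\<forall>x z. Vector_Spaces.linear s1 s2 (\<lambda>y. f x y z)) \<and>
     (\<forall>x y. Vector_Spaces.linear s1 s2 (\<lambda>z. f x y z))"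

definition leibniz2_algebra ::
  "('k::field_char_0, 'a::ab_group_add, 'b::ab_group_add) leibniz2 \<Rightarrow> bool" where
  "leibniz2_algebra V \<longleftrightarrow>
     vector_space (smul0 V) \<and> vector_space (smul1 V) \<and>
     Vector_Spaces.linear (smul1 V) (smul0 V) (l1 V) \<and>
     bilinear_map (smul0 V) (smul0 V) (smul0 V) (l2xx V) \<and>
     bilinear_map (smul0 V) (smul1 V) (smul1 V) (l2xh V) \<and>
     bilinear_map (smul1 V) (smul0 V) (smul1 V) (l2hx V) \<and>
     trilinear_map (smul0 V) (smul1 V) (l3 V) \<and>
     (\<forall>x h. l1 V (l2xh V x h) = l2xx V x (l1 V h)) \<and>
     (\<forall>x h. l1 V (l2hx V h x) = l2xx V (l1 V h) x) \<and>
     (\<forall>h k. l2xh V (l1 V h) k = l2hx V h (l1 V k)) \<and>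
     (\<forall>x y z. l1 V (l3 V x y z) =
        l2xx V x (l2xx V y z) - l2xx V y (l2xx V x z) - l2xx V (l2xx V x y) z) \<and>
     (\<forall>x y h. l3 V x y (l1 V h) =
        l2xh V x (l2xh V y h) - l2xh V y (l2xh V x h) - l2xh V (l2xx V x y) h) \<and>
     (\<forall>x y h. l3 V x (l1 V h) y =
        l2xh V x (l2hx V h y) - l2hx V h (l2xx V x y) - l2hx V (l2xh V x h) y) \<and>
     (\<forall>x y h. l3 V (l1 V h) x y =
        l2hx V h (l2xx V x y) - l2xh V x (l2hx V h y) - l2hx V (l2hx V h x) y) \<and>
     (\<forall>w x y z.
        l2hx V (l3 V w x y) z + l2xh V w (l3 V x y z) - l2xh V x (l3 V w y z)
        + l2xh V y (l3 V w x z) - l3 V (l2xx V w x) y z + l3 V w (l2xx V x y) z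
        - l3 V x (l2xx V w y) z - l3 V w x (l2xx V y z) + l3 V w y (l2xx V x z)
        - l3 V x y (l2xx V w z) = 0)"

text \<open>\<open>f1x\<close> and \<open>f1h\<close> are the components of the degree 0 map \<open>f\<^sub>1\<close> on degrees 0 and 1.\<close>

record ('a, 'b, 'c, 'd) infmap =
  f1x :: "'a \<Rightarrow> 'c"
  f1h :: "'b \<Rightarrow> 'd"
  f2 :: "'a \<Rightarrow> 'a \<Rightarrow> 'd"

definition infinity_morphism ::
  "('k::field_char_0, 'a::ab_group_add, 'b::ab_group_add) leibniz2 \<Rightarrow>
   ('k, 'c::ab_group_add, 'd::ab_group_add) leibniz2 \<Rightarrow> ('a, 'b, 'c, 'd) infmap \<Rightarrow> bool" where
  "infinity_morphism V W f \<longleftrightarrow>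
     Vector_Spaces.linear (smul0 V) (smul0 W) (f1x f) \<and>
     Vector_Spaces.linear (smul1 V) (smul1 W) (f1h f) \<and>
     bilinear_map (smul0 V) (smul0 V) (smul1 W) (f2 f) \<and>
     (\<forall>h. l1 W (f1h f h) = f1x f (l1 V h)) \<and>
     (\<forall>x y. l2xx W (f1x f x) (f1x f y) + l1 W (f2 f x y) = f1x f (l2xx V x y)) \<and>
     (\<forall>x h. l2xh W (f1x f x) (f1h f h) = f1h f (l2xh V x h) - f2 f x (l1 V h)) \<and>
     (\<forall>x h. l2hx W (f1h f h) (f1x f x) = f1h f (l2hx V h x) - f2 f (l1 V h) x) \<and>
     (\<forall>x y z.
        l3 W (f1x f x) (f1x f y) (f1x f z) - l2hx W (f2 f x y) (f1x f z)
        + l2xh W (f1x f x) (f2 f y z) - l2xh W (f1x f y) (f2 f x z)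
        = f1h f (l3 V x y z) + f2 f (l2xx V x y) z - f2 f x (l2xx V y z)
          + f2 f y (l2xx V x z))"

text \<open>The set \<open>\<T>(f, g)\<close>; a degree 1 map \<open>V \<rightarrow> W\<close> is a map from \<open>V\<^sub>0\<close> to \<open>W\<^sub>1\<close>.\<close>

definition homotopies ::
  "('k::field_char_0, 'a::ab_group_add, 'b::ab_group_add) leibniz2 \<Rightarrow>
   ('k, 'c::ab_group_add, 'd::ab_group_add) leibniz2 \<Rightarrow>
   ('a, 'b, 'c, 'd) infmap \<Rightarrow> ('a, 'b, 'c, 'd) infmap \<Rightarrow> ('a \<Rightarrow> 'd) set" where
  "homotopies V W f g = {\<theta>.
     Vector_Spaces.linear (smul0 V) (smul1 W) \<theta> \<and>
     (\<forall>x. f1x g x - f1x f x = l1 W (\<theta> x)) \<and>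
     (\<forall>h. f1h g h - f1h f h = \<theta> (l1 V h)) \<and>
     (\<forall>x y. f2 g x y - f2 f x y =
        \<theta> (l2xx V x y) - l2xh W (f1x f x) (\<theta> y) - l2hx W (\<theta> x) (f1x g y))}"


section \<open>Formal linear combinations and signs\<close>

definition linext ::
  "('k::zero \<Rightarrow> 'v \<Rightarrow> 'v) \<Rightarrow> ('i \<Rightarrow> 'v::comm_monoid_add) \<Rightarrow> ('i \<Rightarrow>\<^sub>0 'k) \<Rightarrow> 'v" where
  "linext s F p = (\<Sum>i\<in>Poly_Mapping.keys p. s (Poly_Mapping.lookup p i) (F i))"

definition fscale :: "'k::semiring_0 \<Rightarrow> ('i \<Rightarrow>\<^sub>0 'k) \<Rightarrow> ('i \<Rightarrow>\<^sub>0 'k)" where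
  "fscale c = Poly_Mapping.map (\<lambda>a. c * a)"

text \<open>Koszul sign \<open>\<epsilon>(\<sigma>)\<close> relating \<open>v\<^sub>0 \<dots> v\<^sub>p\<^sub>-\<^sub>1\<close> to its rearrangement \<open>v\<^bsub>\<sigma>(0)\<^esub> \<dots> v\<^bsub>\<sigma>(p-1)\<^esub>\<close>, where
  \<open>v\<^sub>i\<close> has degree \<open>deg i\<close>. Positions are counted from 0 throughout.\<close>

definition koszul :: "nat \<Rightarrow> (nat \<Rightarrow> int) \<Rightarrow> (nat \<Rightarrow> nat) \<Rightarrow> 'k::field" where
  "koszul p deg \<sigma> =
     (-1) powi (\<Sum>(i, j)\<in>{(i, j). i < j \<and> j < p \<and> \<sigma> j < \<sigma> i}. deg (\<sigma> i) * deg (\<sigma> j))"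

definition shuffles_Sh :: "nat \<Rightarrow> nat \<Rightarrow> (nat \<Rightarrow> nat) set" where
  "shuffles_Sh k l = {\<sigma>. \<sigma> permutes {..<k + l} \<and>
     strict_mono_on {..<k} \<sigma> \<and> strict_mono_on {k..<k + l} \<sigma>}"


section \<open>The Zinbiel coalgebra and the coderivation\<close>

text \<open>
  \<open>(sV)\<^bsup>\<otimes>n\<^esup>\<close> is spanned by the words of length \<open>n\<close> in homogeneous letters: \<open>Inl x\<close> is \<open>sx\<close> (degree 1)
  for \<open>x \<in> V\<^sub>0\<close>, and \<open>Inr h\<close> is \<open>sh\<close> (degree 2) for \<open>h \<in> V\<^sub>1\<close>. It is the free vector space on
  these words modulo linearity in each letter; accordingly
  \<^item> a linear map out of it is a function on words that is linear in each letter,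
  \<^item> an element is represented by a formal combination of words, and equality of elements
    is congruence modulo the subspace \<open>tensor_null\<close> generated by the multilinearity relations.
  The same is done for \<open>Zin\<^sup>c(sV) \<otimes> Zin\<^sup>c(sV)\<close> with pairs of words. A slot is a basis element with
  one letter left open.
\<close>

type_synonym ('a, 'b) word = "('a + 'b) list"

definition word_slots :: "('l \<Rightarrow> 'l list) set" where
  "word_slots = {\<lambda>l. u @ l # v | u v. True}"

definition pair_slots :: "('l \<Rightarrow> 'l list \<times> 'l list) set" where
  "pair_slots = {\<lambda>l. (c l, v) | c v. c \<in> word_slots} \<union> {\<lambda>l. (u, c l) | u c. c \<in> word_slots}"

definition letterwise_linear ::
  "('k, 'a::ab_group_add, 'b::ab_group_add) leibniz2 \<Rightarrow> ('k \<Rightarrow> 'v \<Rightarrow> 'v) \<Rightarrow>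
   ('a + 'b \<Rightarrow> 'i) set \<Rightarrow> ('i \<Rightarrow> 'v::ab_group_add) \<Rightarrow> bool" where
  "letterwise_linear V s C F \<longleftrightarrow> (\<forall>c\<in>C. \<forall>a.
     (\<forall>x y. F (c (Inl (smul0 V a x + y))) = s a (F (c (Inl x))) + F (c (Inl y))) \<and>
     (\<forall>h k. F (c (Inr (smul1 V a h + k))) = s a (F (c (Inr h))) + F (c (Inr k))))"

definition tensor_null ::
  "('k::field, 'a::ab_group_add, 'b::ab_group_add) leibniz2 \<Rightarrow>
   ('a + 'b \<Rightarrow> 'i) set \<Rightarrow> ('i \<Rightarrow>\<^sub>0 'k) set" where
  "tensor_null V C = module.span fscale
     ({Poly_Mapping.single (c (Inl (smul0 V a x + y))) 1
        - fscale a (Poly_Mapping.single (c (Inl x)) 1) - Poly_Mapping.single (c (Inl y)) 1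
        | c a x y. c \<in> C} \<union>
      {Poly_Mapping.single (c (Inr (smul1 V a h + k))) 1
        - fscale a (Poly_Mapping.single (c (Inr h)) 1) - Poly_Mapping.single (c (Inr k)) 1
        | c a h k. c \<in> C})"

fun letter_deg :: "'a + 'b \<Rightarrow> int" where
  "letter_deg (Inl x) = 1"
| "letter_deg (Inr h) = 2"

definition word_deg :: "('a, 'b) word \<Rightarrow> int" where
  "word_deg w = (\<Sum>l\<leftarrow>w. letter_deg l)"

definition comult :: "('a, 'b) word \<Rightarrow> (('a, 'b) word \<times> ('a, 'b) word) \<Rightarrow>\<^sub>0 'k::field" where
  "comult w = (let p = length w in
     \<Sum>k\<in>{1..<p}. \<Sum>\<sigma>\<in>shuffles_Sh k (p - k - 1).
       Poly_Mapping.single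
         (map (\<lambda>i. w ! \<sigma> i) [0..<k], map (\<lambda>i. w ! \<sigma> i) [k..<p - 1] @ [last w])
         (koszul (p - 1) (\<lambda>i. letter_deg (w ! i)) \<sigma>))"

text \<open>\<open>comult_iter n\<close> is \<open>\<Delta>\<^sup>n : Zin\<^sup>c(sV) \<rightarrow> Zin\<^sup>c(sV)\<^bsup>\<otimes>(n+1)\<^esup>\<close>, always comultiplying the first factor.\<close>

primrec comult_iter :: "nat \<Rightarrow> ('a, 'b) word \<Rightarrow> ('a, 'b) word list \<Rightarrow>\<^sub>0 'k::field" where
  "comult_iter 0 w = Poly_Mapping.single [w] 1"
| "comult_iter (Suc n) w =
     linext fscale
       (\<lambda>ws. linext fscale (\<lambda>(u, v). Poly_Mapping.single (u # v # tl ws) 1) (comult (hd ws)))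
       (comult_iter n w)"

text \<open>
  The corestrictions \<open>D\<^sub>i\<close> on words of length \<open>i\<close>, with \<open>sV\<close> written as \<open>V\<^sub>0 \<times> V\<^sub>1\<close>. They are
  determined by \<open>l\<^sub>i = s\<^sup>-\<^sup>1 D\<^sub>i s\<^bsup>\<otimes>i\<^esup>\<close>; since
  \<open>s\<^bsup>\<otimes>2\<^esup>(h \<otimes> x) = (-1)\<^bsup>|h|\<^esup> sh \<otimes> sx = - sh \<otimes> sx\<close>, one has \<open>D\<^sub>2(sh, sx) = - s l\<^sub>2(h, x)\<close>; in the other
  cases below no sign arises. All other values vanish for degree reasons or because \<open>D\<^sub>i = 0\<close>
  for \<open>i > 3\<close>.
\<close>

fun corestr :: "('k, 'a::ab_group_add, 'b::ab_group_add) leibniz2 \<Rightarrow> ('a, 'b) word \<Rightarrow> 'a \<times> 'b" where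
  "corestr V [Inr h] = (l1 V h, 0)"
| "corestr V [Inl x, Inl y] = (l2xx V x y, 0)"
| "corestr V [Inl x, Inr h] = (0, l2xh V x h)"
| "corestr V [Inr h, Inl x] = (0, - l2hx V h x)"
| "corestr V [Inl x, Inl y, Inl z] = (0, l3 V x y z)"
| "corestr V w = 0"

definition smul :: "('k, 'a, 'b) leibniz2 \<Rightarrow> 'k \<Rightarrow> 'a \<times> 'b \<Rightarrow> 'a \<times> 'b" where
  "smul V c v = (smul0 V c (fst v), smul1 V c (snd v))"

fun word_proj :: "('a::zero, 'b::zero) word \<Rightarrow> 'a \<times> 'b" where
  "word_proj [Inl x] = (x, 0)"
| "word_proj [Inr h] = (0, h)"
| "word_proj w = 0"

text \<open>
  \<open>D w\<close> is a (homogeneous) representative of the value on the word \<open>w\<close> of a linear endomorphism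
  of \<open>Zin\<^sup>c(sV)\<close>. The predicate says that this endomorphism is well defined, of degree -1, a
  coderivation (\<open>\<Delta> D = (D \<otimes> id + id \<otimes> D) \<Delta>\<close>, where \<open>(id \<otimes> D)(u \<otimes> v) = (-1)\<^bsup>|u|\<^esup> u \<otimes> D v\<close>), and has
  the corestrictions prescribed above.
\<close>

definition zinbiel_coderivation ::
  "('k::field_char_0, 'a::ab_group_add, 'b::ab_group_add) leibniz2 \<Rightarrow>
   (('a, 'b) word \<Rightarrow> ('a, 'b) word \<Rightarrow>\<^sub>0 'k) \<Rightarrow> bool" where
  "zinbiel_coderivation V D \<longleftrightarrow>
     (\<forall>w. Poly_Mapping.keys (D w) \<subseteq> {u. u \<noteq> [] \<and> word_deg u = word_deg w - 1}) \<and>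
     (\<forall>c\<in>word_slots. \<forall>a.
        (\<forall>x y. D (c (Inl (smul0 V a x + y))) - fscale a (D (c (Inl x))) - D (c (Inl y))
           \<in> tensor_null V word_slots) \<and>
        (\<forall>h k. D (c (Inr (smul1 V a h + k))) - fscale a (D (c (Inr h))) - D (c (Inr k))
           \<in> tensor_null V word_slots)) \<and>
     (\<forall>w. w \<noteq> [] \<longrightarrow>
        linext fscale comult (D w)
        - linext fscale (\<lambda>(u, v).
            linext fscale (\<lambda>u'. Poly_Mapping.single (u', v) 1) (D u)
            + linext fscale (\<lambda>v'. Poly_Mapping.single (u, v') ((-1) powi word_deg u)) (D v))
          (comult w)
        \<in> tensor_null V pair_slots) \<and>
     (\<forall>w. w \<noteq> [] \<longrightarrow> linext (smul V) word_proj (D w) = corestr V w)"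


section \<open>The convolution Lie infinity algebra\<close>

definition graded_part :: "int \<Rightarrow> ('c::zero \<times> 'd::zero) set" where
  "graded_part k = {w. (k \<noteq> 0 \<longrightarrow> fst w = 0) \<and> (k \<noteq> 1 \<longrightarrow> snd w = 0)}"

text \<open>The degree \<open>k\<close> part of \<open>L = Hom(Zin\<^sup>c(sV), W)\<close>. The empty word is not part of \<open>Zin\<^sup>c(sV)\<close>, so
  functions are normalised to vanish on it.\<close>

definition conv ::
  "('k::field_char_0, 'a::ab_group_add, 'b::ab_group_add) leibniz2 \<Rightarrow>
   ('k, 'c::ab_group_add, 'd::ab_group_add) leibniz2 \<Rightarrow> int \<Rightarrow>
   (('a, 'b) word \<Rightarrow> 'c \<times> 'd) set" where
  "conv V W k = {F. letterwise_linear V (smul W) word_slots F \<and> F [] = 0 \<and>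
     (\<forall>w. w \<noteq> [] \<longrightarrow> F w \<in> graded_part (word_deg w + k))}"

fun struct_op :: "('k, 'c::ab_group_add, 'd::ab_group_add) leibniz2 \<Rightarrow> ('c \<times> 'd) list \<Rightarrow> 'c \<times> 'd" where
  "struct_op W [u] = (l1 W (snd u), 0)"
| "struct_op W [u, v] =
     (l2xx W (fst u) (fst v), l2xh W (fst u) (snd v) + l2hx W (snd u) (fst v))"
| "struct_op W [u, v, w] = (0, l3 W (fst u) (fst v) (fst w))"
| "struct_op W us = 0"

text \<open>Elements of \<open>L\<close> enter the brackets paired with their degree.
  \<open>conv_tensor W fs ws\<close> is \<open>m\<^sub>p((f\<^sub>1 \<otimes> \<dots> \<otimes> f\<^sub>p)(w\<^sub>1 \<otimes> \<dots> \<otimes> w\<^sub>p))\<close>; the sign comes from moving each \<open>f\<^sub>j\<close> past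
  the \<open>w\<^sub>i\<close> with \<open>i < j\<close>.\<close>

definition conv_tensor ::
  "('k::field, 'c::ab_group_add, 'd::ab_group_add) leibniz2 \<Rightarrow>
   (int \<times> (('a, 'b) word \<Rightarrow> 'c \<times> 'd)) list \<Rightarrow> ('a, 'b) word list \<Rightarrow> 'c \<times> 'd" where
  "conv_tensor W fs ws =
     smul W ((-1) powi (\<Sum>j<length fs. \<Sum>i<j. fst (fs ! j) * word_deg (ws ! i)))
       (struct_op W (map2 (\<lambda>f w. snd f w) fs ws))"

definition conv_bracket1 ::
  "('k::field, 'c::ab_group_add, 'd::ab_group_add) leibniz2 \<Rightarrow>
   (('a, 'b) word \<Rightarrow> ('a, 'b) word \<Rightarrow>\<^sub>0 'k) \<Rightarrow>
   int \<times> (('a, 'b) word \<Rightarrow> 'c \<times> 'd) \<Rightarrow> ('a, 'b) word \<Rightarrow> 'c \<times> 'd" where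
  "conv_bracket1 W D f w =
     struct_op W [snd f w] + smul W ((-1) powi fst f) (linext (smul W) (snd f) (D w))"

text \<open>The bracket \<open>\<L>\<^sub>p\<close> for \<open>p = length fs \<ge> 2\<close>.\<close>

definition conv_bracket ::
  "('k::field, 'c::ab_group_add, 'd::ab_group_add) leibniz2 \<Rightarrow>
   (int \<times> (('a, 'b) word \<Rightarrow> 'c \<times> 'd)) list \<Rightarrow> ('a, 'b) word \<Rightarrow> 'c \<times> 'd" where
  "conv_bracket W fs w = (let p = length fs in
     linext (smul W)
       (\<lambda>ws. \<Sum>\<sigma> | \<sigma> permutes {..<p}.
          smul W (koszul p (\<lambda>i. fst (fs ! i)) \<sigma> * of_int (sign \<sigma>))
            (conv_tensor W (map (\<lambda>i. fs ! \<sigma> i) [0..<p]) ws))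
       (comult_iter (p - 1) w))"

text \<open>The degree -1 element of \<open>L\<close> identified with an infinity morphism via \<open>f\<^sub>1 = \<alpha>\<^sup>1 s\<close>,
  \<open>f\<^sub>2 = \<alpha>\<^sup>2 s\<^bsup>\<otimes>2\<^esup>\<close>.\<close>

fun conv_of_morphism ::
  "('a, 'b, 'c::zero, 'd::zero) infmap \<Rightarrow> ('a, 'b) word \<Rightarrow> 'c \<times> 'd" where
  "conv_of_morphism f [Inl x] = (f1x f x, 0)"
| "conv_of_morphism f [Inr h] = (0, f1h f h)"
| "conv_of_morphism f [Inl x, Inl y] = (0, f2 f x y)"
| "conv_of_morphism f w = 0"


section \<open>Polynomial differential forms on simplices\<close>

text \<open>
  Eliminating \<open>t\<^sub>0 = 1 - t\<^sub>1 - \<dots> - t\<^sub>n\<close> and \<open>dt\<^sub>0 = - dt\<^sub>1 - \<dots> - dt\<^sub>n\<close>, the algebra \<open>\<Omega>\<^sub>n\<close> is the free graded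
  commutative algebra on \<open>t\<^sub>1, \<dots>, t\<^sub>n, dt\<^sub>1, \<dots>, dt\<^sub>n\<close>. The pair \<open>(a, I)\<close> stands for the basis element
  \<open>t\<^sup>a dt\<^sub>I\<close>, the factors \<open>dt\<^sub>i\<close> (\<open>i \<in> I\<close>) being in increasing order; its homological degree is
  \<open>- card I\<close>.
\<close>

type_synonym form_basis = "(nat \<Rightarrow>\<^sub>0 nat) \<times> nat set"

definition forms_on :: "nat \<Rightarrow> form_basis set" where
  "forms_on n = {(a, I). Poly_Mapping.keys a \<subseteq> {1..n} \<and> I \<subseteq> {1..n}}"

definition form_one :: "form_basis \<Rightarrow>\<^sub>0 'k::field" where
  "form_one = Poly_Mapping.single (0, {}) 1"

fun wedge_basis :: "form_basis \<Rightarrow> form_basis \<Rightarrow> form_basis \<Rightarrow>\<^sub>0 'k::field" where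
  "wedge_basis (a, I) (b, J) = (if I \<inter> J = {}
     then Poly_Mapping.single (a + b, I \<union> J) ((-1) ^ card {(i, j). i \<in> I \<and> j \<in> J \<and> j < i})
     else 0)"

definition wedge ::
  "(form_basis \<Rightarrow>\<^sub>0 'k::field) \<Rightarrow> (form_basis \<Rightarrow>\<^sub>0 'k) \<Rightarrow> (form_basis \<Rightarrow>\<^sub>0 'k)" where
  "wedge p q = linext fscale (\<lambda>b. linext fscale (wedge_basis b) q) p"

definition wedge_list :: "(form_basis \<Rightarrow>\<^sub>0 'k::field) list \<Rightarrow> (form_basis \<Rightarrow>\<^sub>0 'k)" where
  "wedge_list ps = foldr wedge ps form_one"

definition deRham :: "(form_basis \<Rightarrow>\<^sub>0 'k::field) \<Rightarrow> (form_basis \<Rightarrow>\<^sub>0 'k)" where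
  "deRham = linext fscale (\<lambda>(a, I). \<Sum>i\<in>Poly_Mapping.keys a.
     wedge (Poly_Mapping.single (a - Poly_Mapping.single i 1, {i}) (of_nat (Poly_Mapping.lookup a i)))
           (Poly_Mapping.single (0, I) 1))"

definition bary :: "nat \<Rightarrow> nat \<Rightarrow> form_basis \<Rightarrow>\<^sub>0 'k::field" where
  "bary n i = (if i = 0
     then form_one - (\<Sum>j\<in>{1..n}. Poly_Mapping.single (Poly_Mapping.single j 1, {}) 1)
     else Poly_Mapping.single (Poly_Mapping.single i 1, {}) 1)"

text \<open>Restriction of \<open>t\<^sub>j\<close> (\<open>j \<ge> 1\<close>) from the \<open>n\<close>-simplex to its face \<open>t\<^sub>i = 0\<close>, expressed in the
  coordinates of the \<open>(n-1)\<close>-simplex, and the induced map on basis forms.\<close>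

definition face_coord :: "nat \<Rightarrow> nat \<Rightarrow> nat \<Rightarrow> form_basis \<Rightarrow>\<^sub>0 'k::field" where
  "face_coord n i j =
     (if j < i then bary (n - 1) j else if j = i then 0 else bary (n - 1) (j - 1))"

fun form_face :: "nat \<Rightarrow> nat \<Rightarrow> form_basis \<Rightarrow> form_basis \<Rightarrow>\<^sub>0 'k::field" where
  "form_face n i (a, I) = wedge_list
     (map (\<lambda>j. wedge_list (replicate (Poly_Mapping.lookup a j) (face_coord n i j)))
        (sorted_list_of_set (Poly_Mapping.keys a))
      @ map (\<lambda>j. deRham (face_coord n i j)) (sorted_list_of_set I))"


section \<open>The simplicial set of Maurer-Cartan elements\<close>

text \<open>An element of \<open>L \<otimes> \<Omega>\<^sub>n\<close> is a finitely supported family of elements of \<open>L\<close>, indexed by the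
  basis of \<open>\<Omega>\<^sub>n\<close>.\<close>

type_synonym ('a, 'b, 'c, 'd) conv_forms = "form_basis \<Rightarrow>\<^sub>0 (('a, 'b) word \<Rightarrow> 'c \<times> 'd)"

definition conv_smul ::
  "('k, 'c, 'd) leibniz2 \<Rightarrow> 'k \<Rightarrow> ('w \<Rightarrow> 'c \<times> 'd) \<Rightarrow> ('w \<Rightarrow> 'c \<times> 'd)" where
  "conv_smul W c F = (\<lambda>w. smul W c (F w))"

definition otimes ::
  "('k::field, 'c::ab_group_add, 'd::ab_group_add) leibniz2 \<Rightarrow> (('a, 'b) word \<Rightarrow> 'c \<times> 'd) \<Rightarrow>
   (form_basis \<Rightarrow>\<^sub>0 'k) \<Rightarrow> ('a, 'b, 'c, 'd) conv_forms" where
  "otimes W F \<omega> = Poly_Mapping.map (\<lambda>c. conv_smul W c F) \<omega>"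

text \<open>The brackets of \<open>L \<otimes> \<Omega>\<^sub>n\<close> take elements paired with their total degree \<open>e\<close>; then the
  coefficient of \<open>t\<^sup>a dt\<^sub>I\<close> has degree \<open>e + card I\<close>. The sign in \<open>tensor_bracket\<close> comes from
  moving each \<open>\<omega>\<^sub>i\<close> past the \<open>\<ell>\<^sub>j\<close> with \<open>j > i\<close>.\<close>

definition coeff_at ::
  "int \<times> ('a, 'b, 'c::zero, 'd::zero) conv_forms \<Rightarrow> form_basis \<Rightarrow>
   int \<times> (('a, 'b) word \<Rightarrow> 'c \<times> 'd)" where
  "coeff_at A b = (fst A + int (card (snd b)), Poly_Mapping.lookup (snd A) b)"

definition tensor_bracket1 ::
  "('k::field, 'c::ab_group_add, 'd::ab_group_add) leibniz2 \<Rightarrow>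
   (('a, 'b) word \<Rightarrow> ('a, 'b) word \<Rightarrow>\<^sub>0 'k) \<Rightarrow>
   int \<times> ('a, 'b, 'c, 'd) conv_forms \<Rightarrow> ('a, 'b, 'c, 'd) conv_forms" where
  "tensor_bracket1 W D A = (\<Sum>b\<in>Poly_Mapping.keys (snd A).
     otimes W (conv_bracket1 W D (coeff_at A b)) (Poly_Mapping.single b 1)
     + otimes W (conv_smul W ((-1) powi fst (coeff_at A b)) (snd (coeff_at A b)))
         (deRham (Poly_Mapping.single b 1)))"

definition tensor_bracket ::
  "('k::field, 'c::ab_group_add, 'd::ab_group_add) leibniz2 \<Rightarrow>
   (int \<times> ('a, 'b, 'c, 'd) conv_forms) list \<Rightarrow> ('a, 'b, 'c, 'd) conv_forms" where
  "tensor_bracket W As = (\<Sum>bs\<in>listset (map (\<lambda>A. Poly_Mapping.keys (snd A)) As).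
     let ls = map2 coeff_at As bs in
     otimes W
       (conv_smul W
          ((-1) powi (\<Sum>j<length As. \<Sum>i<j. (- int (card (snd (bs ! i)))) * fst (ls ! j)))
          (conv_bracket W ls))
       (wedge_list (map (\<lambda>b. Poly_Mapping.single b 1) bs)))"

definition total_bracket ::
  "('k::field, 'c::ab_group_add, 'd::ab_group_add) leibniz2 \<Rightarrow>
   (('a, 'b) word \<Rightarrow> ('a, 'b) word \<Rightarrow>\<^sub>0 'k) \<Rightarrow>
   (int \<times> ('a, 'b, 'c, 'd) conv_forms) list \<Rightarrow> ('a, 'b, 'c, 'd) conv_forms" where
  "total_bracket W D As =
     (if length As = 1 then tensor_bracket1 W D (hd As) else tensor_bracket W As)"

text \<open>The Maurer-Cartan series stops at \<open>p = 3\<close> because \<open>m\<^sub>p = 0\<close> for \<open>p > 3\<close>.\<close>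

definition MC ::
  "('k::field_char_0, 'a::ab_group_add, 'b::ab_group_add) leibniz2 \<Rightarrow>
   ('k, 'c::ab_group_add, 'd::ab_group_add) leibniz2 \<Rightarrow>
   (('a, 'b) word \<Rightarrow> ('a, 'b) word \<Rightarrow>\<^sub>0 'k) \<Rightarrow> nat \<Rightarrow> ('a, 'b, 'c, 'd) conv_forms set" where
  "MC V W D n = {\<alpha>.
     Poly_Mapping.keys \<alpha> \<subseteq> forms_on n \<and>
     (\<forall>b\<in>Poly_Mapping.keys \<alpha>. Poly_Mapping.lookup \<alpha> b \<in> conv V W (int (card (snd b)) - 1)) \<and>
     (\<Sum>p\<in>{1..3}. Poly_Mapping.map (conv_smul W ((-1) ^ (p * (p - 1) div 2) / fact p))
        (total_bracket W D (replicate p (-1, \<alpha>)))) = 0}"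

definition face ::
  "('k::field, 'c::ab_group_add, 'd::ab_group_add) leibniz2 \<Rightarrow> nat \<Rightarrow> nat \<Rightarrow>
   ('a, 'b, 'c, 'd) conv_forms \<Rightarrow> ('a, 'b, 'c, 'd) conv_forms" where
  "face W n i \<alpha> = (\<Sum>b\<in>Poly_Mapping.keys \<alpha>. otimes W (Poly_Mapping.lookup \<alpha> b) (form_face n i b))"


section \<open>Homotopies as 1-simplices, and the vertical composite\<close>

text \<open>A 1-simplex is \<open>a(t) \<otimes> 1 + r(t) \<otimes> dt\<close> with \<open>t = t\<^sub>1\<close>; \<open>eval1\<close> is the value \<open>a(c)\<close>.\<close>

definition t_pow :: "nat \<Rightarrow> nat \<Rightarrow>\<^sub>0 nat" where
  "t_pow k = Poly_Mapping.single 1 k"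

definition eval1 ::
  "('k::field, 'c::ab_group_add, 'd::ab_group_add) leibniz2 \<Rightarrow> 'k \<Rightarrow>
   ('a, 'b, 'c, 'd) conv_forms \<Rightarrow> ('a, 'b) word \<Rightarrow> 'c \<times> 'd" where
  "eval1 W c \<alpha> =
     (\<Sum>k | (t_pow k, {}) \<in> Poly_Mapping.keys \<alpha>. conv_smul W (c ^ k) (Poly_Mapping.lookup \<alpha> (t_pow k, {})))"

definition inf_homotopies ::
  "('k::field_char_0, 'a::ab_group_add, 'b::ab_group_add) leibniz2 \<Rightarrow>
   ('k, 'c::ab_group_add, 'd::ab_group_add) leibniz2 \<Rightarrow>
   (('a, 'b) word \<Rightarrow> ('a, 'b) word \<Rightarrow>\<^sub>0 'k) \<Rightarrow>
   ('a, 'b, 'c, 'd) infmap \<Rightarrow> ('a, 'b, 'c, 'd) infmap \<Rightarrow> ('a, 'b, 'c, 'd) conv_forms set" where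
  "inf_homotopies V W D f g = {\<alpha>\<in>MC V W D 1.
     eval1 W 0 \<alpha> = conv_of_morphism f \<and> eval1 W 1 \<alpha> = conv_of_morphism g}"

text \<open>\<open>integral_form W c \<alpha> u\<close> is the integral of \<open>r\<close> from \<open>c\<close> to \<open>u\<close>, so that \<open>h\<^sub>1\<^sup>i \<alpha>\<close> is
  \<open>integral_form W i \<alpha>\<close> for \<open>i = 0, 1\<close>.\<close>

definition integral_form ::
  "('k::field_char_0, 'c::ab_group_add, 'd::ab_group_add) leibniz2 \<Rightarrow> 'k \<Rightarrow>
   ('a, 'b, 'c, 'd) conv_forms \<Rightarrow> 'k \<Rightarrow> ('a, 'b) word \<Rightarrow> 'c \<times> 'd" where
  "integral_form W c \<alpha> u =
     (\<Sum>k | (t_pow k, {1}) \<in> Poly_Mapping.keys \<alpha>.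
        conv_smul W ((u ^ (k + 1) - c ^ (k + 1)) / of_nat (k + 1)) (Poly_Mapping.lookup \<alpha> (t_pow k, {1})))"

definition S1 ::
  "('k::field_char_0, 'c::ab_group_add, 'd::ab_group_add) leibniz2 \<Rightarrow> nat \<Rightarrow>
   ('a, 'b, 'c, 'd) conv_forms \<Rightarrow> 'a \<Rightarrow> 'd" where
  "S1 W i \<alpha> = (\<lambda>x. snd ((integral_form W (of_nat i) \<alpha> 1 - integral_form W (of_nat i) \<alpha> 0) [Inl x]))"

text \<open>All values \<open>S\<^sub>1\<^sup>0(d\<^sub>1 \<alpha>)\<close> obtainable by choosing lifts of \<open>\<theta>\<close> and \<open>\<tau>\<close> and a filler \<open>\<alpha>\<close> of the resulting
  inner horn.\<close>

definition vertical_composites ::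
  "('k::field_char_0, 'a::ab_group_add, 'b::ab_group_add) leibniz2 \<Rightarrow>
   ('k, 'c::ab_group_add, 'd::ab_group_add) leibniz2 \<Rightarrow>
   (('a, 'b) word \<Rightarrow> ('a, 'b) word \<Rightarrow>\<^sub>0 'k) \<Rightarrow>
   ('a, 'b, 'c, 'd) infmap \<Rightarrow> ('a, 'b, 'c, 'd) infmap \<Rightarrow> ('a, 'b, 'c, 'd) infmap \<Rightarrow>
   ('a \<Rightarrow> 'd) \<Rightarrow> ('a \<Rightarrow> 'd) \<Rightarrow> ('a \<Rightarrow> 'd) set" where
  "vertical_composites V W D f g h \<theta> \<tau> = {S1 W 0 (face W 2 1 \<alpha>) | \<alpha> \<alpha>' \<alpha>''.
     \<alpha>' \<in> inf_homotopies V W D f g \<and> S1 W 1 \<alpha>' = \<theta> \<and>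
     \<alpha>'' \<in> inf_homotopies V W D g h \<and> S1 W 0 \<alpha>'' = \<tau> \<and>
     \<alpha> \<in> MC V W D 2 \<and> face W 2 2 \<alpha> = \<alpha>' \<and> face W 2 0 \<alpha> = \<alpha>''}"

end

theory Submission
  imports Defs "HOL-Computational_Algebra.Polynomial"
begin

text \<open>
  For degree reasons a 2-simplex of Maurer-Cartan elements has the form
  \<open>a(t) \<otimes> 1 + r\<^sub>1(t) dt\<^sub>1 + r\<^sub>2(t) dt\<^sub>2\<close> with \<open>a(t) \<in> L\<^sub>-\<^sub>1\<close> and \<open>r\<^sub>i(t) \<in> L\<^sub>0 = Hom(sV\<^sub>0, W\<^sub>1)\<close>. At a
  one-letter word \<open>sx\<close> the \<open>dt\<^sub>1 dt\<^sub>2\<close> component of the Maurer-Cartan equation reduces to the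
  statement that the 1-form \<open>r\<close> is closed. As \<open>S\<^sub>1\<close> integrates \<open>r\<close> along an edge, Stokes' formula shows
  that its value on the edge \<open>02\<close> is the sum of its values on \<open>01\<close> and \<open>12\<close>, whatever lifts and filler
  have been chosen (\<open>S1_face_boundary\<close>, resting on \<open>stokes_basis\<close>).

  It remains to see that lifts and a filler exist. A degree 1 map \<open>\<rho>\<close> is a homotopy from \<open>f\<close> to exactly one
  infinity morphism, written \<open>transport f \<rho>\<close> (\<open>transport_infinity_morphism\<close>,
  \<open>homotopy_imp_transport\<close>), and transporting twice is transporting along the sum
  (\<open>transport_transport\<close>); this also makes \<open>\<tau> + \<theta>\<close> a homotopy from \<open>f\<close> to \<open>h\<close>. The morphism
  \<open>transport f (t\<^sub>1 \<rho> + t\<^sub>2 \<sigma>)\<close> depends on \<open>t\<close> quadratically, and together with the constant 1-form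
  \<open>\<rho> dt\<^sub>1 + \<sigma> dt\<^sub>2\<close> it is a 2-simplex (\<open>simplex\<close>). The filler is the case \<open>\<rho> = \<theta>\<close>,
  \<open>\<sigma> = \<theta> + \<tau>\<close>; its edges \<open>01\<close> and \<open>12\<close> are lifts of \<open>\<theta>\<close> and \<open>\<tau>\<close>.

  The Maurer-Cartan equation for this simplex is verified pointwise: polynomial forms are determined by their
  values (\<open>monomials_independent\<close>), so multilinearity of the brackets replaces \<open>\<L>\<^sub>p\<close> on
  \<open>L \<otimes> \<Omega>\<^sub>2\<close> by \<open>\<L>\<^sub>p\<close> on \<open>L\<close> at each point \<open>t\<close> (\<open>curvature_zero\<close>). The equation then splits
  into the equations of an infinity morphism (\<open>morphism_curvature_zero\<close>) and the flow equation
  (\<open>homotopy_flow\<close>), tested on words of degree at most 3. On these the coderivation \<open>D\<close> is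
  determined by its corestrictions (\<open>D_degree_2\<close>, \<open>D_degree_3\<close>).
\<close>

section \<open>Linear functionals on formal combinations\<close>

lemma lookup_fscale [simp]: "Poly_Mapping.lookup (fscale c p) i = c * Poly_Mapping.lookup p i"
  by (simp add: fscale_def map.rep_eq when_def)

lemma fscale_one [simp]: "fscale (1::'k::field) p = p"
  by (rule poly_mapping_eqI) simp

lemma vector_space_fscale: "vector_space (fscale :: 'k::field \<Rightarrow> ('i \<Rightarrow>\<^sub>0 'k) \<Rightarrow> _)"
  by unfold_locales (auto intro!: poly_mapping_eqI simp: lookup_add algebra_simps)

lemma vector_space_times: "vector_space ((*) :: 'k::field \<Rightarrow> 'k \<Rightarrow> 'k)"
  by unfold_locales (auto simp: algebra_simps)

lemma linear_sum:
  assumes "Vector_Spaces.linear s1 s2 T" shows "T (sum F X) = (\<Sum>a\<in>X. T (F a))"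
proof -
  interpret Vector_Spaces.linear s1 s2 T by fact
  show ?thesis by (rule sum)
qed

lemma linext_superset:
  assumes "vector_space s" "finite S" "Poly_Mapping.keys p \<subseteq> S"
  shows "linext s F p = (\<Sum>i\<in>S. s (Poly_Mapping.lookup p i) (F i))"
proof -
  interpret vector_space s by fact
  show ?thesis unfolding linext_def
    by (rule sum.mono_neutral_left) (use assms in \<open>auto simp: in_keys_iff\<close>)
qed

lemma linext_cong:
  "(\<And>i. i \<in> Poly_Mapping.keys p \<Longrightarrow> F i = G i) \<Longrightarrow> linext s F p = linext s G p"
  unfolding linext_def by (rule sum.cong) auto

lemma linear_linext:
  assumes "vector_space s" shows "Vector_Spaces.linear fscale s (linext s F)"
proof -
  interpret vector_space s by fact
  have "linext s F (p + q) = linext s F p + linext s F q" for p q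
  proof -
    let ?S = "Poly_Mapping.keys p \<union> Poly_Mapping.keys q"
    have "Poly_Mapping.keys (p + q) \<subseteq> ?S" by (rule keys_add)
    then show ?thesis
      by (simp add: linext_superset[OF assms, of ?S] lookup_add scale_left_distrib sum.distrib)
  qed
  moreover have "linext s F (fscale c p) = s c (linext s F p)" for c p
  proof -
    have "Poly_Mapping.keys (fscale c p) \<subseteq> Poly_Mapping.keys p" by (auto simp: in_keys_iff)
    then show ?thesis
      by (simp add: linext_superset[OF assms, of "Poly_Mapping.keys p"] scale_sum_right)
  qed
  ultimately show ?thesis
    using assms vector_space_fscale by (simp add: Vector_Spaces.linear_iff)
qed

lemma linext_single:
  assumes "vector_space s" shows "linext s F (Poly_Mapping.single i c) = s c (F i)"
proof -
  interpret vector_space s by fact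
  show ?thesis by (simp add: linext_def)
qed

lemma linext_zero [simp]: "linext s F 0 = 0"
  by (simp add: linext_def)

lemmas linext_add = module_hom.add[OF linear_linext[THEN module_hom_linearI]]
lemmas linext_diff = module_hom.diff[OF linear_linext[THEN module_hom_linearI]]
lemmas linext_fscale = module_hom.scale[OF linear_linext[THEN module_hom_linearI]]
lemmas linext_sum = linear_sum[OF linear_linext]

lemma linext_linext:
  assumes "vector_space s"
  shows "linext s G (linext fscale F p) = linext s (\<lambda>i. linext s G (F i)) p"
  by (simp add: linext_def[of fscale] linext_def[of s "\<lambda>i. linext s G (F i)"]
      linext_sum[OF assms] linext_fscale[OF assms])

lemma linear_linext_comp:
  assumes "Vector_Spaces.linear s1 s2 T"
  shows "linext s2 (\<lambda>i. T (F i)) p = T (linext s1 F p)"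
proof -
  interpret Vector_Spaces.linear s1 s2 T by fact
  show ?thesis by (simp add: linext_def sum scale)
qed

text \<open>For a linear functional \<open>\<phi>\<close> on forms, given by its values on the basis, \<open>pairing\<close> is
  \<open>id \<otimes> \<phi>\<close> on \<open>X \<otimes> \<Omega>\<close>. Values at points, integrals and restrictions to faces
  are all of this shape.\<close>

definition pairing :: "('k \<Rightarrow> 'v \<Rightarrow> 'v) \<Rightarrow> ('i \<Rightarrow> 'k) \<Rightarrow> ('i \<Rightarrow>\<^sub>0 'v::comm_monoid_add) \<Rightarrow> 'v" where
  "pairing s \<phi> p = (\<Sum>i\<in>Poly_Mapping.keys p. s (\<phi> i) (Poly_Mapping.lookup p i))"

lemma pairing_zero [simp]: "pairing s \<phi> 0 = 0"
  by (simp add: pairing_def)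

lemma pairing_superset:
  assumes "vector_space s" "finite S" "Poly_Mapping.keys p \<subseteq> S"
  shows "pairing s \<phi> p = (\<Sum>i\<in>S. s (\<phi> i) (Poly_Mapping.lookup p i))"
proof -
  interpret vector_space s by fact
  show ?thesis unfolding pairing_def
    by (rule sum.mono_neutral_left) (use assms in \<open>auto simp: in_keys_iff\<close>)
qed

lemma pairing_add:
  assumes "vector_space s" shows "pairing s \<phi> (p + q) = pairing s \<phi> p + pairing s \<phi> q"
proof -
  interpret vector_space s by fact
  let ?S = "Poly_Mapping.keys p \<union> Poly_Mapping.keys q"
  have "Poly_Mapping.keys (p + q) \<subseteq> ?S" by (rule keys_add)
  then show ?thesis
    by (simp add: pairing_superset[OF assms, of ?S] lookup_add scale_right_distrib sum.distrib)
qed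

lemma pairing_sum:
  assumes "vector_space s" shows "pairing s \<phi> (sum F X) = (\<Sum>a\<in>X. pairing s \<phi> (F a))"
  by (induction X rule: infinite_finite_induct) (simp_all add: pairing_add[OF assms])

lemma pairing_cong:
  "(\<And>i. i \<in> Poly_Mapping.keys p \<Longrightarrow> \<phi> i = \<psi> i) \<Longrightarrow> pairing s \<phi> p = pairing s \<psi> p"
  unfolding pairing_def by (rule sum.cong) auto

lemma pairing_map:
  assumes "vector_space s"
  shows "pairing s \<phi> (Poly_Mapping.map (s c) p) = s c (pairing s \<phi> p)"
proof -
  interpret vector_space s by fact
  have "Poly_Mapping.keys (Poly_Mapping.map (s c) p) \<subseteq> Poly_Mapping.keys p"
    by (auto simp: in_keys_iff map.rep_eq when_def)
  moreover have "Poly_Mapping.lookup (Poly_Mapping.map (s c) p) i = s c (Poly_Mapping.lookup p i)" for i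
    by (simp add: map.rep_eq when_def)
  ultimately show ?thesis
    by (simp add: pairing_superset[OF assms, of "Poly_Mapping.keys p"] scale_sum_right mult.commute)
qed

lemma pairing_linear:
  assumes "Vector_Spaces.linear s1 s2 T"
  shows "(\<Sum>i\<in>Poly_Mapping.keys p. s2 (\<phi> i) (T (Poly_Mapping.lookup p i))) = T (pairing s1 \<phi> p)"
proof -
  interpret Vector_Spaces.linear s1 s2 T by fact
  show ?thesis by (simp add: pairing_def sum scale)
qed

lemma pairing_scalar: "pairing (*) \<phi> p = linext (*) \<phi> (p :: _ \<Rightarrow>\<^sub>0 'k::field)"
  unfolding pairing_def linext_def by (intro sum.cong refl mult.commute)

section \<open>Polynomial forms are determined by their values\<close>

definition monom_val :: "(nat \<Rightarrow> 'k::comm_semiring_1) \<Rightarrow> (nat \<Rightarrow>\<^sub>0 nat) \<Rightarrow> 'k" where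
  "monom_val s m = (\<Prod>i\<in>Poly_Mapping.keys m. s i ^ Poly_Mapping.lookup m i)"

text \<open>The functional extracting the value at the point \<open>s\<close> of the coefficient of \<open>dt\<^sub>I\<close>.\<close>

definition value_at :: "(nat \<Rightarrow> 'k::comm_semiring_1) \<Rightarrow> nat set \<Rightarrow> form_basis \<Rightarrow> 'k" where
  "value_at s I = (\<lambda>(m, J). if J = I then monom_val s m else 0)"

lemma monom_val_superset:
  assumes "finite S" "Poly_Mapping.keys m \<subseteq> S"
  shows "monom_val s m = (\<Prod>i\<in>S. s i ^ Poly_Mapping.lookup m i)"
  unfolding monom_val_def
  by (rule prod.mono_neutral_left) (use assms in \<open>auto simp: in_keys_iff\<close>)

lemma monom_val_zero [simp]: "monom_val s 0 = 1"
  by (simp add: monom_val_def)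

lemma monom_val_add: "monom_val s (m + m') = monom_val s m * monom_val s m'"
proof -
  let ?S = "Poly_Mapping.keys m \<union> Poly_Mapping.keys m'"
  have "Poly_Mapping.keys (m + m') \<subseteq> ?S" by (rule keys_add)
  then show ?thesis
    by (simp add: monom_val_superset[of ?S] lookup_add power_add prod.distrib)
qed

lemma monom_val_single [simp]: "monom_val s (Poly_Mapping.single i k) = s i ^ k"
  by (simp add: monom_val_def)

lemma monom_val_mult_point: "monom_val (\<lambda>i. s i * s' i) m = monom_val s m * monom_val s' m"
  by (simp add: monom_val_def power_mult_distrib prod.distrib)

text \<open>Dedekind's argument for the independence of characters: the monomials are
  multiplicative functions of the point \<open>s\<close>, and they are separated by the points with all
  coordinates 1 except for one coordinate 2.\<close>

lemma monomials_independent: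
  fixes sc :: "'k::field_char_0 \<Rightarrow> 'v::ab_group_add \<Rightarrow> 'v"
  assumes "vector_space sc" "finite M" "\<And>s. (\<Sum>m\<in>M. sc (monom_val s m) (v m)) = 0" "m \<in> M"
  shows "v m = 0"
proof -
  interpret vector_space sc by fact
  have one: "monom_val (\<lambda>_. 1::'k) m = 1" for m by (simp add: monom_val_def)
  have "\<forall>v. (\<forall>s. (\<Sum>m\<in>M. sc (monom_val s m) (v m)) = 0) \<longrightarrow> (\<forall>m\<in>M. v m = 0)"
    using \<open>finite M\<close>
  proof (induction M)
    case (insert m0 M)
    show ?case
    proof (intro allI impI)
      fix v assume v: "\<forall>s. (\<Sum>m\<in>insert m0 M. sc (monom_val s m) (v m)) = 0"
      have vM: "v m = 0" if m: "m \<in> M" for m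
      proof -
        from m insert.hyps have "m \<noteq> m0" by auto
        then obtain i where i: "Poly_Mapping.lookup m i \<noteq> Poly_Mapping.lookup m0 i"
          by (meson poly_mapping_eqI)
        define z :: "nat \<Rightarrow> 'k" where "z = (\<lambda>_. 1)(i := 2)"
        have z: "monom_val z n = 2 ^ Poly_Mapping.lookup n i" for n
        proof -
          have "monom_val z n = (\<Prod>j\<in>insert i (Poly_Mapping.keys n). z j ^ Poly_Mapping.lookup n j)"
            by (rule monom_val_superset) auto
          also have "\<dots> = z i ^ Poly_Mapping.lookup n i"
            by (subst prod.remove[of _ i]) (auto simp: z_def intro!: prod.neutral)
          finally show ?thesis by (simp add: z_def)
        qed
        define w where "w n = sc (monom_val z n - monom_val z m0) (v n)" for n
        have "(\<Sum>n\<in>M. sc (monom_val s n) (w n)) = 0" for s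
        proof -
          have a: "sc (monom_val z m0) (\<Sum>n\<in>insert m0 M. sc (monom_val s n) (v n)) = 0"
            using v by simp
          have b: "(\<Sum>n\<in>insert m0 M. sc (monom_val (\<lambda>j. z j * s j) n) (v n)) = 0"
            using v by blast
          have "(\<Sum>n\<in>M. sc (monom_val s n) (w n)) = (\<Sum>n\<in>insert m0 M. sc (monom_val s n) (w n))"
            using insert.hyps by (simp add: w_def)
          also have "\<dots> = (\<Sum>n\<in>insert m0 M. sc (monom_val (\<lambda>j. z j * s j) n) (v n))
              - sc (monom_val z m0) (\<Sum>n\<in>insert m0 M. sc (monom_val s n) (v n))"
            unfolding scale_sum_right sum_subtractf[symmetric]
            by (intro sum.cong refl)
              (simp add: w_def monom_val_mult_point scale_left_diff_distrib scale_right_diff_distrib mult.commute)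
          also have "\<dots> = 0" by (simp only: a b) simp
          finally show ?thesis .
        qed
        then have "w m = 0" using insert.IH m by blast
        moreover have "monom_val z m \<noteq> monom_val z m0"
        proof -
          have "(2::'k) ^ a = 2 ^ b \<longleftrightarrow> a = b" for a b :: nat
          proof -
            have "(2::'k) ^ a = of_nat (2 ^ a)" "(2::'k) ^ b = of_nat (2 ^ b)" by simp_all
            then have "(2::'k) ^ a = 2 ^ b \<longleftrightarrow> (2::nat) ^ a = 2 ^ b" by (simp only: of_nat_eq_iff)
            then show ?thesis by simp
          qed
          then show ?thesis using i z by auto
        qed
        ultimately show "v m = 0" by (simp add: w_def)
      qed
      have "(\<Sum>m\<in>insert m0 M. sc (monom_val (\<lambda>_. 1) m) (v m)) = 0" using v by blast
      moreover have "(\<Sum>m\<in>M. sc (monom_val (\<lambda>_. 1) m) (v m)) = 0" using vM by simp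
      ultimately have "v m0 = 0" using insert.hyps by (simp add: one)
      with vM show "\<forall>m\<in>insert m0 M. v m = 0" by blast
    qed
  qed simp
  with assms show ?thesis by blast
qed

lemma pairing_value_at:
  assumes "vector_space sc"
  shows "pairing sc (value_at s I) p =
    (\<Sum>m | (m, I) \<in> Poly_Mapping.keys p. sc (monom_val s m) (Poly_Mapping.lookup p (m, I)))"
proof -
  interpret vector_space sc by fact
  let ?M = "{m. (m, I) \<in> Poly_Mapping.keys p}"
  have inj: "inj_on (\<lambda>m. (m, I)) ?M" by (auto simp: inj_on_def)
  have "pairing sc (value_at s I) p
      = (\<Sum>b\<in>(\<lambda>m. (m, I)) ` ?M. sc (value_at s I b) (Poly_Mapping.lookup p b))"
    unfolding pairing_def by (rule sum.mono_neutral_right) (auto simp: value_at_def split: if_splits)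
  also have "\<dots> = (\<Sum>m\<in>?M. sc (monom_val s m) (Poly_Mapping.lookup p (m, I)))"
    by (simp add: sum.reindex[OF inj] value_at_def)
  finally show ?thesis .
qed

text \<open>Pairing with \<open>value_at s I\<close> for all points \<open>s\<close> thus tests equality of forms with coefficients in
  a vector space. This is what allows the Maurer-Cartan equation, and the identification of the
  faces of a simplex, to be checked one point at a time.\<close>

lemma lookup_eqI_values:
  fixes sc :: "'k::field_char_0 \<Rightarrow> 'v::ab_group_add \<Rightarrow> 'v"
  assumes vs: "vector_space sc"
    and eq: "\<And>s. pairing sc (value_at s I) p = pairing sc (value_at s I) q"
  shows "Poly_Mapping.lookup p (m, I) = Poly_Mapping.lookup q (m, I)"
proof -
  interpret vector_space sc by fact
  define M where "M = fst ` (Poly_Mapping.keys p \<union> Poly_Mapping.keys q)"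
  have fin: "finite M" by (simp add: M_def)
  have in_M: "m \<in> M" if "(m, I) \<in> Poly_Mapping.keys p \<union> Poly_Mapping.keys q" for m
    using imageI[OF that, of fst] by (simp add: M_def)
  have *: "pairing sc (value_at s I) r = (\<Sum>m\<in>M. sc (monom_val s m) (Poly_Mapping.lookup r (m, I)))"
    if "r = p \<or> r = q" for r s
  proof -
    have "{m. (m, I) \<in> Poly_Mapping.keys r} \<subseteq> M"
      using that in_M by auto
    then show ?thesis
      unfolding pairing_value_at[OF vs]
      by (intro sum.mono_neutral_left[OF fin]) (auto simp: in_keys_iff)
  qed
  show ?thesis
  proof (cases "m \<in> M")
    case True
    have "Poly_Mapping.lookup p (m, I) - Poly_Mapping.lookup q (m, I) = 0"
      by (rule monomials_independent[OF vs fin _ True])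
        (use eq in \<open>simp add: * scale_right_diff_distrib sum_subtractf\<close>)
    then show ?thesis by simp
  next
    case False
    then have "Poly_Mapping.lookup p (m, I) = 0 \<and> Poly_Mapping.lookup q (m, I) = 0"
      using in_M[of m] by (auto simp: in_keys_iff)
    then show ?thesis by simp
  qed
qed

lemma eqI_values:
  fixes sc :: "'k::field_char_0 \<Rightarrow> 'v::ab_group_add \<Rightarrow> 'v"
  assumes "vector_space sc"
    and "\<And>s I. pairing sc (value_at s I) p = pairing sc (value_at s I) q"
  shows "p = q"
  using lookup_eqI_values[OF assms] by (auto intro!: poly_mapping_eqI)

section \<open>Values of products, differentials and restrictions of forms\<close>

abbreviation scalar_pairing :: "(form_basis \<Rightarrow> 'k::field) \<Rightarrow> (form_basis \<Rightarrow>\<^sub>0 'k) \<Rightarrow> 'k" where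
  "scalar_pairing \<equiv> linext (*)"

lemmas scalar_pairing_simps [simp] =
  linext_add[OF vector_space_times] linext_diff[OF vector_space_times]
  linext_sum[OF vector_space_times] linext_single[OF vector_space_times]
  linext_fscale[OF vector_space_times]

lemma linext_product:
  "linext (*) (\<lambda>b. linext (*) (\<lambda>b'. f b * g b') q) p
    = linext (*) f p * linext (*) g (q :: _ \<Rightarrow>\<^sub>0 'k::field)"
  unfolding linext_def sum_product by (simp add: sum_distrib_left mult_ac)

lemma scalar_pairing_wedge:
  "scalar_pairing \<phi> (wedge p q)
    = scalar_pairing (\<lambda>b. scalar_pairing (\<lambda>b'. scalar_pairing \<phi> (wedge_basis b b')) q) p"
  by (simp add: wedge_def linext_linext[OF vector_space_times])

lemma value_at_apply: "value_at s I (m, J) = (if J = I then monom_val s m else 0)"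
  by (simp add: value_at_def)

lemma value_at_wedge_basis_function:
  "scalar_pairing (value_at s {}) (wedge_basis b b') = value_at s {} b * value_at s {} b'"
  by (cases b; cases b') (auto simp: value_at_apply monom_val_add)

text \<open>The coefficient of \<open>dt\<^sub>i\<close> is a derivation over the function part, since one of the two factors must
  contribute a function.\<close>

lemma value_at_wedge_basis_one_form:
  "scalar_pairing (value_at s {i}) (wedge_basis b b')
    = value_at s {} b * value_at s {i} b' + value_at s {i} b * value_at s {} b'"
proof -
  obtain m I m' J where b: "b = (m, I)" "b' = (m', J)" by (cases b; cases b')
  show ?thesis
  proof (cases "I \<inter> J = {} \<and> I \<union> J = {i}")
    case True
    then have "I = {} \<and> J = {i} \<or> I = {i} \<and> J = {}"
      by (auto simp: Un_singleton_iff)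
    then show ?thesis
      unfolding b by (elim disjE conjE) (simp_all add: value_at_apply monom_val_add)
  next
    case False
    then have "value_at s {} b * value_at s {i} b' = 0" "value_at s {i} b * value_at s {} b' = 0"
      by (auto simp: b value_at_apply)
    moreover have "scalar_pairing (value_at s {i}) (wedge_basis b b') = 0"
      using False by (cases "I \<inter> J = {}") (simp_all add: b value_at_apply)
    ultimately show ?thesis by (simp only: add_0)
  qed
qed

lemma wedge_list_simps [simp]:
  "wedge_list [] = form_one" "wedge_list (p # ps) = wedge p (wedge_list ps)"
  by (simp_all add: wedge_list_def)

lemma value_at_form_one [simp]:
  "scalar_pairing (value_at s I) form_one = (if I = {} then 1 else 0)"
  by (simp add: form_one_def value_at_apply)

text \<open>Forms of degree 0. Multiplication by them does not mix the components of a form, which is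
  why the pullback of \<open>t\<^sup>m dt\<^sub>j\<close> to a face can be evaluated factor by factor.\<close>

definition is_function :: "(form_basis \<Rightarrow>\<^sub>0 'k::field) \<Rightarrow> bool" where
  "is_function p \<longleftrightarrow> Poly_Mapping.keys p \<subseteq> UNIV \<times> {{}}"

lemma value_at_wedge_left:
  assumes "is_function p"
  shows "scalar_pairing (value_at s I) (wedge p q)
    = scalar_pairing (value_at s {}) p * scalar_pairing (value_at s I) q"
proof -
  have "scalar_pairing (value_at s I) (wedge_basis b b') = value_at s {} b * value_at s I b'"
    if "b \<in> Poly_Mapping.keys p" for b b'
    using assms that by (cases b; cases b') (auto simp: is_function_def value_at_apply monom_val_add)
  then show ?thesis
    unfolding scalar_pairing_wedge linext_product[symmetric]
    by (intro linext_cong) simp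
qed

lemma is_function_wedge:
  fixes p q :: "form_basis \<Rightarrow>\<^sub>0 'k::field"
  assumes "is_function p" "is_function q" shows "is_function (wedge p q)"
proof -
  have fscale: "Poly_Mapping.keys (fscale c r) \<subseteq> Poly_Mapping.keys r" for c and r :: "form_basis \<Rightarrow>\<^sub>0 'k"
    by (auto simp: in_keys_iff)
  have "is_function (wedge_basis b b' :: _ \<Rightarrow>\<^sub>0 'k)" if "b \<in> Poly_Mapping.keys p" "b' \<in> Poly_Mapping.keys q" for b b'
    using assms that by (cases b; cases b') (auto simp: is_function_def)
  then show ?thesis
    unfolding wedge_def linext_def is_function_def
    by (intro order.trans[OF keys_sum] UN_least order.trans[OF fscale])
qed

lemma is_function_wedge_list:
  "(\<And>p. p \<in> set ps \<Longrightarrow> is_function p) \<Longrightarrow> is_function (wedge_list ps)"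
  by (induction ps) (auto simp: form_one_def is_function_def[of "Poly_Mapping.single _ _"] intro!: is_function_wedge)

lemma value_at_wedge_list:
  assumes "\<And>p. p \<in> set ps \<Longrightarrow> is_function p"
  shows "scalar_pairing (value_at s I) (wedge_list (ps @ qs))
    = prod_list (map (scalar_pairing (value_at s {})) ps) * scalar_pairing (value_at s I) (wedge_list qs)"
  using assms by (induction ps) (simp_all add: value_at_wedge_left)

lemma scalar_pairing_deRham:
  "scalar_pairing \<phi> (deRham \<omega>)
    = scalar_pairing (\<lambda>b. scalar_pairing \<phi> (deRham (Poly_Mapping.single b 1))) \<omega>"
  by (simp add: deRham_def linext_linext[OF vector_space_times] linext_single[OF vector_space_fscale])

lemma deRham_single:
  "deRham (Poly_Mapping.single (m, I) (1::'k::field)) = (\<Sum>i\<in>Poly_Mapping.keys m.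
     wedge (Poly_Mapping.single (m - Poly_Mapping.single i 1, {i}) (of_nat (Poly_Mapping.lookup m i)))
           (Poly_Mapping.single (0, I) 1))"
  by (simp add: deRham_def linext_single[OF vector_space_fscale] poly_mapping_eq_iff fun_eq_iff)

lemma wedge_single:
  "wedge (Poly_Mapping.single b c) (Poly_Mapping.single b' c') = fscale (c * c') (wedge_basis b b')"
  by (simp add: wedge_def linext_single[OF vector_space_fscale] poly_mapping_eq_iff fun_eq_iff)

lemma deRham_single_function:
  "deRham (Poly_Mapping.single (m, {}) (1::'k::field)) = (\<Sum>i\<in>Poly_Mapping.keys m.
     Poly_Mapping.single (m - Poly_Mapping.single i 1, {i}) (of_nat (Poly_Mapping.lookup m i)))"
  unfolding deRham_single
  by (intro sum.cong refl poly_mapping_eqI) (simp add: wedge_single lookup_single when_def)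

lemma deRham_constant: "deRham (Poly_Mapping.single (0, I) (1::'k::field)) = 0"
  by (simp add: deRham_single)

lemma value_at_deRham_single:
  "scalar_pairing (value_at s I) (deRham (Poly_Mapping.single (m, {}) 1)) =
    (\<Sum>i\<in>Poly_Mapping.keys m. if I = {i} then
        of_nat (Poly_Mapping.lookup m i) * monom_val s (m - Poly_Mapping.single i 1) else 0)"
  unfolding deRham_single_function scalar_pairing_simps
  by (intro sum.cong) (auto simp: value_at_apply)

lemma value_at_bary [simp]:
  "scalar_pairing (value_at s {}) (bary n i) = (if i = 0 then 1 - (\<Sum>j\<in>{1..n}. s j) else s i)"
  by (simp add: bary_def value_at_apply)

lemma is_function_face_coord: "is_function (face_coord n i j :: _ \<Rightarrow>\<^sub>0 'k::field)"
proof -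
  have "Poly_Mapping.keys (form_one - (\<Sum>j\<in>J. Poly_Mapping.single (Poly_Mapping.single j 1, {}) (1::'k)))
      \<subseteq> UNIV \<times> {{}}" for J :: "nat set"
    by (intro order.trans[OF keys_diff] Un_least order.trans[OF keys_sum] UN_least)
      (auto simp: form_one_def)
  then show ?thesis by (auto simp: is_function_def face_coord_def bary_def)
qed

text \<open>The image of the point \<open>s\<close> under the inclusion of the \<open>i\<close>-th face.\<close>

definition face_point :: "nat \<Rightarrow> nat \<Rightarrow> (nat \<Rightarrow> 'k::field) \<Rightarrow> nat \<Rightarrow> 'k" where
  "face_point n i s j = scalar_pairing (value_at s {}) (face_coord n i j)"

text \<open>Restriction to a face is evaluation at the included point; on \<open>dt\<^sub>j\<close> it is in addition the differential
  of the \<open>j\<close>-th coordinate of the inclusion.\<close>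

lemma value_at_form_face:
  "scalar_pairing (value_at s I) (form_face n i (m, {}))
    = (if I = {} then monom_val (face_point n i s) m else 0)"
  "scalar_pairing (value_at s I) (form_face n i (m, {j}))
    = monom_val (face_point n i s) m * scalar_pairing (value_at s I) (deRham (face_coord n i j))"
proof -
  let ?ps = "map (\<lambda>j. wedge_list (replicate (Poly_Mapping.lookup m j) (face_coord n i j)))
        (sorted_list_of_set (Poly_Mapping.keys m))"
  have power: "scalar_pairing (value_at s {}) (wedge_list (replicate k (face_coord n i j)))
      = face_point n i s j ^ k" for j k
    using value_at_wedge_list[of "replicate k (face_coord n i j)" s "{}" "[]"]
    by (simp add: is_function_face_coord prod_list_replicate face_point_def split: if_splits)
  have monomial: "prod_list (map (scalar_pairing (value_at s {})) ?ps) = monom_val (face_point n i s) m"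
    by (simp add: power monom_val_def prod.distinct_set_conv_list[symmetric])
  have ps: "is_function p" if "p \<in> set ?ps" for p
    using that by (auto intro!: is_function_wedge_list is_function_face_coord split: if_splits)
  show "scalar_pairing (value_at s I) (form_face n i (m, {}))
    = (if I = {} then monom_val (face_point n i s) m else 0)"
    using value_at_wedge_list[of ?ps s I "[]", OF ps] unfolding monomial by simp
  have "scalar_pairing (value_at s I) (wedge q form_one) = scalar_pairing (value_at s I) q" for q
  proof -
    have "scalar_pairing (value_at s I) (wedge_basis b (0, {})) = value_at s I b" for b
      by (cases b) (simp add: value_at_apply)
    then show ?thesis by (simp add: scalar_pairing_wedge form_one_def)
  qed
  then show "scalar_pairing (value_at s I) (form_face n i (m, {j}))
    = monom_val (face_point n i s) m * scalar_pairing (value_at s I) (deRham (face_coord n i j))"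
    using value_at_wedge_list[of ?ps s I "[deRham (face_coord n i j)]", OF ps] unfolding monomial by simp
qed

lemma face_point_2:
  "face_point 2 0 s (Suc 0) = 1 - s 1" "face_point 2 0 s 2 = s 1"
  "face_point 2 (Suc 0) s (Suc 0) = 0" "face_point 2 (Suc 0) s 2 = s 1"
  "face_point 2 2 s (Suc 0) = s 1" "face_point 2 2 s 2 = 0"
  by (simp_all add: face_point_def face_coord_def)

lemma value_at_deRham_bary:
  "scalar_pairing (value_at s I) (deRham (bary 1 0)) = (if I = {1} then -1 else 0)"
  "scalar_pairing (value_at s I) (deRham (bary 1 1)) = (if I = {1} then 1 else 0)"
  by (subst scalar_pairing_deRham, simp add: bary_def form_one_def value_at_deRham_single deRham_constant)+

lemma deRham_zero [simp]: "deRham 0 = 0"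
  by (simp add: deRham_def)

lemma face_differential_2:
  fixes s :: "nat \<Rightarrow> 'k::field"
  defines "d i j I \<equiv> scalar_pairing (value_at s I) (deRham (face_coord 2 i j))"
  shows "d 0 (Suc 0) I = (if I = {Suc 0} then -1 else 0)" "d 0 2 I = (if I = {Suc 0} then 1 else 0)"
    "d (Suc 0) (Suc 0) I = 0" "d (Suc 0) 2 I = (if I = {Suc 0} then 1 else 0)"
    "d 2 (Suc 0) I = (if I = {Suc 0} then 1 else 0)" "d 2 2 I = 0"
  using value_at_deRham_bary[where s = s] by (simp_all add: d_def face_coord_def)

section \<open>Stokes' formula on the triangle\<close>

text \<open>The functional \<open>\<omega> \<mapsto> \<integral>\<^bsub>[0,1]\<^esub> \<omega>\<close> on forms of the 1-simplex.\<close>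

definition edge_integral :: "form_basis \<Rightarrow> 'k::field_char_0" where
  "edge_integral = (\<lambda>(m, J). if J = {1} \<and> m \<in> range t_pow then 1 / of_nat (Poly_Mapping.lookup m 1 + 1) else 0)"

text \<open>The integral of \<open>p\<close> from 0 to 1, computed on coefficients since the field is arbitrary.\<close>

definition poly_integral :: "'k::field_char_0 poly \<Rightarrow> 'k" where
  "poly_integral p = (\<Sum>k\<le>degree p. coeff p k / of_nat (k + 1))"

lemma poly_integral_superset:
  "degree p \<le> N \<Longrightarrow> poly_integral p = (\<Sum>k\<le>N. coeff p k / of_nat (k + 1))"
  unfolding poly_integral_def by (rule sum.mono_neutral_left) (auto simp: coeff_eq_0)

lemma poly_integral_add: "poly_integral (p + q) = poly_integral p + poly_integral q"
proof -
  let ?N = "max (degree p) (degree q)"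
  have "degree (p + q) \<le> ?N" by (rule degree_add_le_max)
  then show ?thesis
    by (simp add: poly_integral_superset[of _ ?N] sum.distrib add_divide_distrib del: of_nat_add of_nat_Suc)
qed

lemma poly_integral_smult: "poly_integral (smult c p) = c * poly_integral p"
  by (simp add: poly_integral_superset[of "smult c p" "degree p"] poly_integral_superset[of p "degree p"]
      sum_distrib_left del: of_nat_add of_nat_Suc)

lemma poly_integral_minus: "poly_integral (- p) = - poly_integral p"
  using poly_integral_smult[of "-1" p] by simp

lemma poly_integral_diff: "poly_integral (p - q) = poly_integral p - poly_integral q"
  using poly_integral_add[of p "- q"] by (simp add: poly_integral_minus)

lemma poly_integral_pderiv: "poly_integral (pderiv p) = poly p 1 - poly p 0"
proof -
  have "poly_integral (pderiv p) = (\<Sum>k\<le>degree p. coeff (pderiv p) k / of_nat (k + 1))"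
    by (rule poly_integral_superset) (simp add: degree_pderiv)
  also have "\<dots> = (\<Sum>k\<le>degree p. coeff p (Suc k))"
    by (intro sum.cong refl) (simp add: coeff_pderiv del: of_nat_Suc)
  also have "\<dots> = (\<Sum>k\<le>Suc (degree p). coeff p k) - coeff p 0"
    by (subst sum.atMost_Suc_shift) simp
  also have "(\<Sum>k\<le>Suc (degree p). coeff p k) = poly p 1"
    by (simp add: poly_altdef coeff_eq_0)
  finally show ?thesis by (simp add: poly_0_coeff_0)
qed

lemma t_pow_inject [simp]: "t_pow k = t_pow l \<longleftrightarrow> k = l"
  by (metis lookup_single_eq t_pow_def)

lemma lookup_t_pow [simp]: "Poly_Mapping.lookup (t_pow k) (Suc 0) = k"
  by (simp add: t_pow_def)

text \<open>A 1-form on the edge is known once the values of its coefficient are, so its integral can be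
  computed from any polynomial having these values.\<close>

lemma edge_integral_eq_poly_integral:
  fixes \<omega> :: "form_basis \<Rightarrow>\<^sub>0 'k::field_char_0"
  assumes "\<And>s. scalar_pairing (value_at s {1}) \<omega> = poly p (s 1)"
  shows "scalar_pairing edge_integral \<omega> = poly_integral p"
proof -
  define \<omega>' where "\<omega>' = (\<Sum>k\<le>degree p. Poly_Mapping.single (t_pow k, {1::nat}) (coeff p k))"
  have "scalar_pairing (value_at s {1}) \<omega>' = poly p (s 1)" for s
    by (simp add: \<omega>'_def value_at_apply t_pow_def poly_altdef)
  then have eq: "Poly_Mapping.lookup \<omega> (m, {1}) = Poly_Mapping.lookup \<omega>' (m, {1})" for m
    by (intro lookup_eqI_values[OF vector_space_times]) (simp only: pairing_scalar assms)
  let ?S = "Poly_Mapping.keys \<omega> \<union> Poly_Mapping.keys \<omega>'"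
  have "scalar_pairing edge_integral \<omega> = (\<Sum>b\<in>?S. Poly_Mapping.lookup \<omega> b * edge_integral b)"
    by (rule linext_superset[OF vector_space_times]) auto
  also have "\<dots> = (\<Sum>b\<in>?S. Poly_Mapping.lookup \<omega>' b * edge_integral b)"
    by (intro sum.cong refl) (auto simp: edge_integral_def eq[simplified])
  also have "\<dots> = scalar_pairing edge_integral \<omega>'"
    by (rule linext_superset[OF vector_space_times, symmetric]) auto
  also have "\<dots> = poly_integral p"
    by (simp add: \<omega>'_def edge_integral_def poly_integral_def)
  finally show ?thesis .
qed

text \<open>\<open>beta i j\<close> is Euler's \<open>\<integral>\<^sub>0\<^sup>1 (1 - t)\<^sup>i t\<^sup>j dt\<close>.\<close>

definition beta :: "nat \<Rightarrow> nat \<Rightarrow> 'k::field_char_0" where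
  "beta i j = poly_integral ([:1, -1:] ^ i * [:0, 1:] ^ j)"

lemma pderiv_power_product:
  fixes p q :: "'a::idom poly"
  assumes "pderiv p = -1" "pderiv q = 1"
  shows "pderiv (p ^ Suc i * q ^ Suc j)
    = smult (of_nat (Suc j)) (p ^ Suc i * q ^ j) + smult (- of_nat (Suc i)) (p ^ i * q ^ Suc j)"
  by (simp add: pderiv_mult pderiv_power_Suc assms del: power_Suc of_nat_Suc)
    (simp add: mult.commute del: power_Suc of_nat_Suc)

lemma pderiv_linear_factors: "pderiv [:1, -1:] = -1" "pderiv [:0, 1:] = 1"
  by (simp_all add: pderiv_pCons one_pCons)

text \<open>The product rule for \<open>(1 - t)\<^bsup>i+1\<^esup> t\<^bsup>j+1\<^esup>\<close>, a polynomial that vanishes at both end points.\<close>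

lemma beta_by_parts:
  "of_nat (j + 1) * beta (i + 1) j = of_nat (i + 1) * (beta i (j + 1) :: 'k::field_char_0)"
proof -
  let ?p = "[:1, -1::'k:]" and ?q = "[:0, 1::'k:]"
  have "pderiv (?p ^ Suc i * ?q ^ Suc j)
      = smult (of_nat (Suc j)) (?p ^ Suc i * ?q ^ j) + smult (- of_nat (Suc i)) (?p ^ i * ?q ^ Suc j)"
    by (rule pderiv_power_product[OF pderiv_linear_factors])
  then have "of_nat (j + 1) * beta (i + 1) j - of_nat (i + 1) * (beta i (j + 1) :: 'k)
      = poly_integral (pderiv (?p ^ Suc i * ?q ^ Suc j))"
    by (simp add: beta_def Suc_eq_plus1[symmetric] poly_integral_diff poly_integral_smult
        del: power_Suc of_nat_Suc of_nat_add Suc_eq_plus1)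
  also have "\<dots> = 0" by (simp add: poly_integral_pderiv)
  finally show ?thesis by simp
qed

lemma beta_zero_right: "beta i 0 = (poly_integral ([:0, 1:] ^ i) :: 'k::field_char_0)"
proof -
  let ?p = "[:1, -1::'k:]" and ?q = "[:0, 1::'k:]"
  have "pderiv (?p ^ Suc i) = smult (- of_nat (Suc i)) (?p ^ i)"
    "pderiv (?q ^ Suc i) = smult (of_nat (Suc i)) (?q ^ i)"
    by (simp_all add: pderiv_power_Suc pderiv_linear_factors del: of_nat_Suc power_Suc)
  then have "- of_nat (Suc i) * poly_integral (?p ^ i) = (- 1::'k)"
    "of_nat (Suc i) * poly_integral (?q ^ i) = (1::'k)"
    using poly_integral_pderiv[of "?p ^ Suc i"] poly_integral_pderiv[of "?q ^ Suc i"]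
    by (simp_all add: poly_integral_smult poly_integral_minus del: of_nat_Suc power_Suc)
  then have "of_nat (Suc i) * (poly_integral (?p ^ i) - poly_integral (?q ^ i)) = (0::'k)"
    by (simp add: algebra_simps del: of_nat_Suc)
  then show ?thesis by (simp add: beta_def del: of_nat_Suc)
qed

text \<open>The integral \<open>\<integral> t\<^sub>1\<^sup>i t\<^sub>2\<^sup>j dt\<^sub>1 dt\<^sub>2\<close> over the triangle, after integrating over
  \<open>t\<^sub>1\<close> from 0 to \<open>1 - t\<^sub>2\<close>.\<close>

definition triangle_integral :: "form_basis \<Rightarrow> 'k::field_char_0" where
  "triangle_integral = (\<lambda>(m, J). if J = {1, 2}
     then beta (Poly_Mapping.lookup m 1 + 1) (Poly_Mapping.lookup m 2) / of_nat (Poly_Mapping.lookup m 1 + 1)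
     else 0)"

lemma triangle_integral_deRham_1:
  assumes m: "Poly_Mapping.keys m \<subseteq> {1, 2}"
  shows "scalar_pairing triangle_integral (deRham (Poly_Mapping.single (m, {Suc 0}) 1))
    = (if Poly_Mapping.lookup m 2 = 0 then 0
       else - (beta (Poly_Mapping.lookup m 1) (Poly_Mapping.lookup m 2) :: 'k::field_char_0))"
proof -
  have card: "card {(i, j). i = (2::nat) \<and> j = Suc 0 \<and> j < i} = 1"
  proof -
    have "{(i, j). i = (2::nat) \<and> j = Suc 0 \<and> j < i} = {(2, Suc 0)}" by auto
    then show ?thesis by simp
  qed
  have "scalar_pairing triangle_integral (deRham (Poly_Mapping.single (m, {Suc 0}) (1::'k)))
    = (\<Sum>i\<in>Poly_Mapping.keys m. if i = 2 then
        - of_nat (Poly_Mapping.lookup m 2) * triangle_integral (m - Poly_Mapping.single 2 1, {1, 2}) else 0)"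
    unfolding deRham_single scalar_pairing_simps scalar_pairing_wedge
    using m by (intro sum.cong refl) (auto simp: card insert_commute)
  also have "\<dots> = (if Poly_Mapping.lookup m 2 = 0 then 0
      else - of_nat (Poly_Mapping.lookup m 2) * triangle_integral (m - Poly_Mapping.single 2 1, {1, 2}))"
    by (auto simp: in_keys_iff)
  also have "\<dots> = (if Poly_Mapping.lookup m 2 = 0 then 0
       else - (beta (Poly_Mapping.lookup m 1) (Poly_Mapping.lookup m 2) :: 'k))"
  proof (cases "Poly_Mapping.lookup m 2")
    case (Suc j)
    have "of_nat (Suc j) * beta (Suc (Poly_Mapping.lookup m 1)) j
        = of_nat (Suc (Poly_Mapping.lookup m 1)) * (beta (Poly_Mapping.lookup m 1) (Suc j) :: 'k)"
      using beta_by_parts[of j "Poly_Mapping.lookup m 1"] by simp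
    with Suc show ?thesis
      by (simp add: triangle_integral_def lookup_minus lookup_single_not_eq field_simps del: of_nat_Suc)
  qed simp
  finally show ?thesis .
qed

lemma triangle_integral_deRham_2:
  assumes m: "Poly_Mapping.keys m \<subseteq> {1, 2}"
  shows "scalar_pairing triangle_integral (deRham (Poly_Mapping.single (m, {2}) 1))
    = (if Poly_Mapping.lookup m 1 = 0 then 0
       else (beta (Poly_Mapping.lookup m 1) (Poly_Mapping.lookup m 2) :: 'k::field_char_0))"
proof -
  have card: "card {(i, j). i = Suc 0 \<and> j = (2::nat) \<and> j < i} = 0"
  proof -
    have "{(i, j). i = Suc 0 \<and> j = (2::nat) \<and> j < i} = {}" by auto
    then show ?thesis by (simp only: card.empty)
  qed
  have "scalar_pairing triangle_integral (deRham (Poly_Mapping.single (m, {2}) (1::'k)))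
    = (\<Sum>i\<in>Poly_Mapping.keys m. if i = 1 then
        of_nat (Poly_Mapping.lookup m 1) * triangle_integral (m - Poly_Mapping.single 1 1, {1, 2}) else 0)"
    unfolding deRham_single scalar_pairing_simps scalar_pairing_wedge
    using m by (intro sum.cong refl) (auto simp: card insert_commute)
  also have "\<dots> = (if Poly_Mapping.lookup m 1 = 0 then 0
      else of_nat (Poly_Mapping.lookup m 1) * triangle_integral (m - Poly_Mapping.single 1 1, {1, 2}))"
    by (auto simp: in_keys_iff)
  also have "\<dots> = (if Poly_Mapping.lookup m 1 = 0 then 0
       else (beta (Poly_Mapping.lookup m 1) (Poly_Mapping.lookup m 2) :: 'k))"
    by (cases "Poly_Mapping.lookup m 1")
      (simp_all add: triangle_integral_def lookup_minus lookup_single_not_eq del: of_nat_Suc)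
  finally show ?thesis .
qed

lemma edge_integral_form_face_function:
  "scalar_pairing edge_integral (form_face n i (m, {})) = (0 :: 'k::field_char_0)"
proof -
  have "scalar_pairing edge_integral (form_face n i (m, {})) = poly_integral (0 :: 'k poly)"
    by (rule edge_integral_eq_poly_integral) (simp add: value_at_form_face del: form_face.simps)
  then show ?thesis by (simp add: poly_integral_def)
qed

lemma edge_integral_form_face:
  fixes P :: "nat \<Rightarrow> 'k::field_char_0 poly"
  assumes m: "Poly_Mapping.keys m \<subseteq> {1, 2}"
    and P: "\<And>s j. j \<in> {1, 2} \<Longrightarrow> face_point 2 i s j = poly (P j) (s 1)"
    and c: "\<And>s. scalar_pairing (value_at s {1}) (deRham (face_coord 2 i j)) = c"
  shows "scalar_pairing edge_integral (form_face 2 i (m, {j}))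
    = c * poly_integral (P 1 ^ Poly_Mapping.lookup m 1 * P 2 ^ Poly_Mapping.lookup m 2)"
proof -
  have "scalar_pairing edge_integral (form_face 2 i (m, {j}))
    = poly_integral (smult c (P 1 ^ Poly_Mapping.lookup m 1 * P 2 ^ Poly_Mapping.lookup m 2))"
  proof (rule edge_integral_eq_poly_integral)
    fix s :: "nat \<Rightarrow> 'k"
    have "monom_val (face_point 2 i s) m
        = (\<Prod>j\<in>{1, 2}. face_point 2 i s j ^ Poly_Mapping.lookup m j)"
      by (rule monom_val_superset) (use m in auto)
    then show "scalar_pairing (value_at s {1}) (form_face 2 i (m, {j}))
        = poly (smult c (P 1 ^ Poly_Mapping.lookup m 1 * P 2 ^ Poly_Mapping.lookup m 2)) (s 1)"
      using P[of 1 s] P[of 2 s] c[of s]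
      by (simp add: value_at_form_face del: form_face.simps)
  qed
  then show ?thesis by (simp add: poly_integral_smult)
qed

text \<open>Stokes' formula for monomials. For \<open>t\<^sub>1\<^sup>i t\<^sub>2\<^sup>j dt\<^sub>1\<close> the edge \<open>t\<^sub>0 = 0\<close> contributes
  \<open>- beta i j\<close>, the edge \<open>t\<^sub>1 = 0\<close> nothing, and the edge \<open>t\<^sub>2 = 0\<close> contributes only if \<open>j = 0\<close>, in which
  case it cancels the first, in agreement with \<open>d(t\<^sub>1\<^sup>i dt\<^sub>1) = 0\<close>. Otherwise the first term is the integral of
  the differential, by definition and \<open>beta_by_parts\<close>; similarly for \<open>dt\<^sub>2\<close>.\<close>

lemma stokes_basis:
  fixes b :: form_basis
  assumes b: "b \<in> forms_on 2" "card (snd b) \<le> 1"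
  shows "scalar_pairing edge_integral (form_face 2 0 b) - scalar_pairing edge_integral (form_face 2 1 b)
      + scalar_pairing edge_integral (form_face 2 2 b)
    = (scalar_pairing triangle_integral (deRham (Poly_Mapping.single b 1)) :: 'k::field_char_0)"
proof -
  obtain m J where bmJ: "b = (m, J)" by (cases b)
  have two: "{1..2} = {1, 2::nat}" by auto
  have m: "Poly_Mapping.keys m \<subseteq> {1, 2}" and J: "J \<subseteq> {1, 2}"
    using b(1) by (auto simp: forms_on_def bmJ two)
  define P :: "nat \<Rightarrow> nat \<Rightarrow> 'k poly" where
    "P i j = (if i = 0 then if j = 1 then [:1, -1:] else [:0, 1:]
      else if i = j then 0 else [:0, 1:])" for i j
  have P: "face_point 2 i s j = poly (P i j) (s 1)" if "j \<in> {1, 2}" "i \<in> {0, 1, 2}" for i j s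
    using that by (auto simp: P_def face_point_2)
  have face: "scalar_pairing edge_integral (form_face 2 i (m, {j}))
      = c * poly_integral (P i 1 ^ Poly_Mapping.lookup m 1 * P i 2 ^ Poly_Mapping.lookup m 2)"
    if "i \<in> {0, 1, 2}" "\<And>s. scalar_pairing (value_at s {1}) (deRham (face_coord 2 i j)) = c" for i j c
    by (rule edge_integral_form_face[OF m P]) (use that in auto)
  note d = face_differential_2[where 'k = 'k]
  consider "J = {}" | "J = {1}" | "J = {2}"
  proof -
    have "J = {} \<or> J = {1} \<or> J = {2} \<or> J = {1, 2}" using J by auto
    moreover have "J \<noteq> {1, 2}" using b(2) by (auto simp: bmJ)
    ultimately show ?thesis using that by blast
  qed
  then show ?thesis
  proof cases
    case 1
    have "scalar_pairing triangle_integral (deRham (Poly_Mapping.single b (1::'k))) = 0"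
      unfolding bmJ 1 deRham_single scalar_pairing_simps scalar_pairing_wedge
      by (intro sum.neutral ballI)
        (auto simp: triangle_integral_def doubleton_eq_iff)
    then show ?thesis
      by (simp add: bmJ 1 edge_integral_form_face_function del: form_face.simps)
  next
    case 2
    have "scalar_pairing edge_integral (form_face 2 0 b) = (- beta (Poly_Mapping.lookup m 1) (Poly_Mapping.lookup m 2) :: 'k)"
      "scalar_pairing edge_integral (form_face 2 1 b) = (0::'k)"
      "scalar_pairing edge_integral (form_face 2 2 b) =
        (if Poly_Mapping.lookup m 2 = 0 then beta (Poly_Mapping.lookup m 1) 0 else (0::'k))"
      using face[of 0 1 "-1"] face[of 1 1 0] face[of 2 1 1] d
      by (simp_all add: bmJ 2 P_def beta_def[of _ "Poly_Mapping.lookup m 2"] beta_zero_right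
          poly_integral_def[of 0] power_0_left del: form_face.simps)
    then show ?thesis
      using triangle_integral_deRham_1[OF m, where 'k = 'k] by (simp add: bmJ 2 del: form_face.simps)
  next
    case 3
    have "scalar_pairing edge_integral (form_face 2 0 b) = (beta (Poly_Mapping.lookup m 1) (Poly_Mapping.lookup m 2) :: 'k)"
      "scalar_pairing edge_integral (form_face 2 1 b) =
        (if Poly_Mapping.lookup m 1 = 0 then beta 0 (Poly_Mapping.lookup m 2) else (0::'k))"
      "scalar_pairing edge_integral (form_face 2 2 b) = (0::'k)"
      using face[of 0 2 1] face[of 1 2 1] face[of 2 2 0] d
      by (simp_all add: bmJ 3 P_def beta_def[of _ "Poly_Mapping.lookup m 2"]
          poly_integral_def[of 0] power_0_left del: form_face.simps)
    then show ?thesis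
      using triangle_integral_deRham_2[OF m, where 'k = 'k] by (simp add: bmJ 3 del: form_face.simps)
  qed
qed

section \<open>Linearity and degrees\<close>

lemma bilinear_map_simps:
  assumes "bilinear_map s1 s2 s3 f"
  shows "f (x + x') y = f x y + f x' y" "f x (y + y') = f x y + f x y'"
    "f (s1 c x) y = s3 c (f x y)" "f x (s2 c y) = s3 c (f x y)"
    "f 0 y = 0" "f x 0 = 0" "f (- x) y = - f x y" "f x (- y) = - f x y"
    "f (x - x') y = f x y - f x' y" "f x (y - y') = f x y - f x y'"
proof -
  interpret l: Vector_Spaces.linear s1 s3 "\<lambda>x. f x y" for y
    using assms by (simp add: bilinear_map_def)
  interpret r: Vector_Spaces.linear s2 s3 "f x" for x
    using assms by (simp add: bilinear_map_def)
  show "f (x + x') y = f x y + f x' y" "f x (y + y') = f x y + f x y'"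
    "f (s1 c x) y = s3 c (f x y)" "f x (s2 c y) = s3 c (f x y)"
    "f 0 y = 0" "f x 0 = 0" "f (- x) y = - f x y" "f x (- y) = - f x y"
    "f (x - x') y = f x y - f x' y" "f x (y - y') = f x y - f x y'"
    by (simp_all add: l.add r.add l.scale r.scale l.zero r.zero l.neg r.neg l.diff r.diff)
qed

lemma trilinear_map_simps:
  assumes "trilinear_map s1 s2 f"
  shows "f (x + x') y z = f x y z + f x' y z" "f x (y + y') z = f x y z + f x y' z"
    "f x y (z + z') = f x y z + f x y z'"
    "f (s1 c x) y z = s2 c (f x y z)" "f x (s1 c y) z = s2 c (f x y z)" "f x y (s1 c z) = s2 c (f x y z)"
    "f 0 y z = 0" "f x 0 z = 0" "f x y 0 = 0"
proof -
  interpret a: Vector_Spaces.linear s1 s2 "\<lambda>x. f x y z" for y z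
    using assms by (simp add: trilinear_map_def)
  interpret b: Vector_Spaces.linear s1 s2 "\<lambda>y. f x y z" for x z
    using assms by (simp add: trilinear_map_def)
  interpret c: Vector_Spaces.linear s1 s2 "f x y" for x y
    using assms by (simp add: trilinear_map_def)
  show "f (x + x') y z = f x y z + f x' y z" "f x (y + y') z = f x y z + f x y' z"
    "f x y (z + z') = f x y z + f x y z'"
    "f (s1 c x) y z = s2 c (f x y z)" "f x (s1 c y) z = s2 c (f x y z)" "f x y (s1 c z) = s2 c (f x y z)"
    "f 0 y z = 0" "f x 0 z = 0" "f x y 0 = 0"
    by (simp_all add: a.add b.add c.add a.scale b.scale c.scale a.zero b.zero c.zero)
qed

lemma linear_simps:
  assumes "Vector_Spaces.linear s1 s2 T"
  shows "T (x + y) = T x + T y" "T (s1 c x) = s2 c (T x)" "T 0 = 0" "T (- x) = - T x" "T (x - y) = T x - T y"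
proof -
  interpret Vector_Spaces.linear s1 s2 T by fact
  show "T (x + y) = T x + T y" "T (s1 c x) = s2 c (T x)" "T 0 = 0" "T (- x) = - T x" "T (x - y) = T x - T y"
    by (simp_all add: add scale zero neg diff)
qed

locale leibniz2 =
  fixes V :: "('k::field_char_0, 'a::ab_group_add, 'b::ab_group_add) leibniz2"
  assumes algebra: "leibniz2_algebra V"
begin

lemma vector_spaces: "vector_space (smul0 V)" "vector_space (smul1 V)"
  using algebra by (auto simp: leibniz2_algebra_def)

sublocale s0: vector_space "smul0 V" by (rule vector_spaces)
sublocale s1: vector_space "smul1 V" by (rule vector_spaces)

lemma l1_linear: "Vector_Spaces.linear (smul1 V) (smul0 V) (l1 V)"
  and l2xx_bilinear: "bilinear_map (smul0 V) (smul0 V) (smul0 V) (l2xx V)"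
  and l2xh_bilinear: "bilinear_map (smul0 V) (smul1 V) (smul1 V) (l2xh V)"
  and l2hx_bilinear: "bilinear_map (smul1 V) (smul0 V) (smul1 V) (l2hx V)"
  and l3_trilinear: "trilinear_map (smul0 V) (smul1 V) (l3 V)"
  using algebra by (auto simp: leibniz2_algebra_def)

lemmas multilinear = linear_simps[OF l1_linear] bilinear_map_simps[OF l2xx_bilinear]
  bilinear_map_simps[OF l2xh_bilinear] bilinear_map_simps[OF l2hx_bilinear]
  trilinear_map_simps[OF l3_trilinear]

lemma vector_space_smul: "vector_space (smul V)"
  by unfold_locales
    (simp_all add: smul_def prod_eq_iff s0.scale_right_distrib s1.scale_right_distrib
      s0.scale_left_distrib s1.scale_left_distrib)

sublocale s: vector_space "smul V" by (rule vector_space_smul)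

lemma vector_space_conv_smul: "vector_space (conv_smul V :: _ \<Rightarrow> ('w \<Rightarrow> 'a \<times> 'b) \<Rightarrow> _)"
  by unfold_locales
    (simp_all add: conv_smul_def fun_eq_iff s.scale_right_distrib s.scale_left_distrib)

lemma fst_smul [simp]: "fst (smul V c v) = smul0 V c (fst v)"
  and snd_smul [simp]: "snd (smul V c v) = smul1 V c (snd v)"
  by (simp_all add: smul_def)

lemma graded_part_add: "u \<in> graded_part k \<Longrightarrow> v \<in> graded_part k \<Longrightarrow> u + v \<in> (graded_part k :: ('a \<times> 'b) set)"
  by (auto simp: graded_part_def)

lemma graded_part_diff: "u \<in> graded_part k \<Longrightarrow> v \<in> graded_part k \<Longrightarrow> u - v \<in> (graded_part k :: ('a \<times> 'b) set)"
  by (auto simp: graded_part_def)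

lemma graded_part_smul: "v \<in> graded_part k \<Longrightarrow> smul V c v \<in> graded_part k"
  by (auto simp: graded_part_def)

lemma graded_part_linext:
  assumes "\<And>u. u \<in> Poly_Mapping.keys p \<Longrightarrow> F u \<in> graded_part k"
  shows "linext (smul V) F p \<in> graded_part k"
proof -
  have "(\<Sum>u\<in>S. smul V (Poly_Mapping.lookup p u) (F u)) \<in> graded_part k"
    if "S \<subseteq> Poly_Mapping.keys p" for S
    using finite_subset[OF that finite_keys] that
  proof (induction S rule: finite_induct)
    case (insert u S)
    then show ?case using assms by (auto intro!: graded_part_add graded_part_smul)
  qed (simp add: graded_part_def)
  then show ?thesis by (simp add: linext_def)
qed

lemma struct_op_graded1: "u \<in> graded_part i \<Longrightarrow> struct_op V [u] \<in> graded_part (i - 1)"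
  by (auto simp: graded_part_def multilinear)

lemma struct_op_graded2:
  "u \<in> graded_part i \<Longrightarrow> v \<in> graded_part j \<Longrightarrow> struct_op V [u, v] \<in> graded_part (i + j)"
  by (cases "i = 0"; cases "i = 1"; cases "j = 0"; cases "j = 1") (auto simp: graded_part_def multilinear)

lemma struct_op_graded3:
  "u \<in> graded_part i \<Longrightarrow> v \<in> graded_part j \<Longrightarrow> w \<in> graded_part k
    \<Longrightarrow> struct_op V [u, v, w] \<in> graded_part (i + j + k + 1)"
  by (cases "i = 0"; cases "j = 0"; cases "k = 0") (auto simp: graded_part_def multilinear)

end

lemma graded_part_eq_0: "v \<in> graded_part k \<Longrightarrow> k \<noteq> 0 \<Longrightarrow> k \<noteq> 1 \<Longrightarrow> v = 0"
  by (auto simp: graded_part_def prod_eq_iff)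

section \<open>Short words\<close>

lemma word_deg_simps [simp]:
  "word_deg [] = 0" "word_deg (l # w) = letter_deg l + word_deg w" "word_deg (u @ v) = word_deg u + word_deg v"
  by (simp_all add: word_deg_def)

lemma letter_deg_cases: "letter_deg l = 1 \<or> letter_deg l = 2"
  by (cases l) auto

lemma word_deg_ge_length: "int (length w) \<le> word_deg w"
proof (induction w)
  case (Cons l w)
  then show ?case using letter_deg_cases[of l] by auto
qed simp

lemma word_deg_le_0: "word_deg w \<le> 0 \<Longrightarrow> w = []"
  using word_deg_ge_length[of w] by (cases w) auto

text \<open>Every letter of \<open>sV\<close> has degree 1 or 2, so there are few words of small degree. As \<open>W\<close> lives in
  degrees 0 and 1, an element of \<open>L\<close> of degree \<open>-k\<close> is nonzero only on words of degree \<open>k\<close> and \<open>k + 1\<close>; the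
  words of degree 1, 2 and 3 suffice below.\<close>

lemma word_deg_1: "word_deg w = 1 \<longleftrightarrow> (\<exists>x. w = [Inl x])"
proof
  assume w: "word_deg w = 1"
  then obtain l v where "w = l # v" by (cases w) auto
  with w show "\<exists>x. w = [Inl x]"
    using word_deg_le_0[of v] word_deg_ge_length[of v] by (cases l) auto
qed auto

lemma word_deg_2: "word_deg w = 2 \<longleftrightarrow> (\<exists>h. w = [Inr h]) \<or> (\<exists>x y. w = [Inl x, Inl y])"
proof
  assume w: "word_deg w = 2"
  then obtain l v where lv: "w = l # v" by (cases w) auto
  show "(\<exists>h. w = [Inr h]) \<or> (\<exists>x y. w = [Inl x, Inl y])"
  proof (cases l)
    case (Inl x)
    with w lv have "word_deg v = 1" by simp
    then show ?thesis using Inl lv by (auto simp: word_deg_1)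
  next
    case (Inr h)
    with w lv word_deg_le_0[of v] show ?thesis by auto
  qed
qed auto

lemma word_deg_3: "word_deg w = 3 \<longleftrightarrow>
  (\<exists>x h. w = [Inl x, Inr h]) \<or> (\<exists>h x. w = [Inr h, Inl x]) \<or> (\<exists>x y z. w = [Inl x, Inl y, Inl z])"
proof
  assume w: "word_deg w = 3"
  then obtain l v where lv: "w = l # v" by (cases w) auto
  show "(\<exists>x h. w = [Inl x, Inr h]) \<or> (\<exists>h x. w = [Inr h, Inl x]) \<or> (\<exists>x y z. w = [Inl x, Inl y, Inl z])"
  proof (cases l)
    case (Inl x)
    with w lv have "word_deg v = 2" by simp
    then show ?thesis using Inl lv by (auto simp: word_deg_2)
  next
    case (Inr h)
    with w lv have "word_deg v = 1" by simp
    then show ?thesis using Inr lv by (auto simp: word_deg_1)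
  qed
qed auto

lemma permutes_lessThan_1: "{\<sigma>. \<sigma> permutes {..<Suc 0}} = {id}"
  by (auto simp: lessThan_Suc permutes_sing)

lemma permutes_lessThan_2: "{\<sigma>. \<sigma> permutes {..<2}} = {id, transpose 0 (1::nat)}"
proof -
  have "{..<2} = {0, 1::nat}" by auto
  then show ?thesis by (auto simp: permutes_doubleton_iff)
qed

lemma id_neq_transpose: "id \<noteq> transpose 0 (Suc 0)"
  by (metis id_apply nat.distinct(1) transpose_apply_first)

lemma koszul_id [simp]: "koszul p deg id = 1"
proof -
  have "{(i, j). i < j \<and> j < p \<and> id j < id i} = {}" by auto
  then show ?thesis by (simp only: koszul_def) simp
qed

lemma koszul_swap: "koszul 2 deg (transpose 0 (Suc 0)) = (-1) powi (deg 1 * deg 0)"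
proof -
  have "{(i, j). i < j \<and> j < 2 \<and> transpose 0 (Suc 0) j < transpose 0 (Suc 0) i} = {(0, 1::nat)}"
    by (auto simp: transpose_def split: if_splits)
  then show ?thesis by (simp only: koszul_def) simp
qed

lemma shuffles_Sh_1_0: "shuffles_Sh (Suc 0) 0 = {id}"
  using permutes_lessThan_1 by (auto simp: shuffles_Sh_def strict_mono_on_def)

lemma shuffles_Sh_2_0: "shuffles_Sh 2 0 = {id}"
proof -
  have "\<sigma> = id" if "\<sigma> \<in> shuffles_Sh 2 0" for \<sigma>
  proof -
    from that have "\<sigma> \<in> {id, transpose 0 1}" "\<sigma> 0 < \<sigma> 1"
      unfolding permutes_lessThan_2[symmetric] by (auto simp: shuffles_Sh_def strict_mono_on_def)
    then show ?thesis by auto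
  qed
  moreover have "id \<in> shuffles_Sh 2 0" by (simp add: shuffles_Sh_def strict_mono_on_def permutes_id)
  ultimately show ?thesis by blast
qed

lemma shuffles_Sh_1_1: "shuffles_Sh (Suc 0) (Suc 0) = {id, transpose 0 (Suc 0)}"
  using permutes_lessThan_2
  by (auto simp: shuffles_Sh_def strict_mono_on_def numeral_2_eq_2)

lemma comult_short [simp]: "comult [] = 0" "comult [a] = 0"
  by (simp_all add: comult_def)

lemma comult_2: "comult [a, b] = Poly_Mapping.single ([a], [b]) 1"
proof -
  have "{Suc 0..<2} = {1}" by auto
  then show ?thesis by (simp add: comult_def shuffles_Sh_1_0 numeral_2_eq_2)
qed

lemma comult_3: "comult [a, b, c] = Poly_Mapping.single ([a], [b, c]) 1
  + Poly_Mapping.single ([b], [a, c]) ((-1) powi (letter_deg b * letter_deg a))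
  + Poly_Mapping.single ([a, b], [c]) 1"
proof -
  have "{1..<3} = {1, 2::nat}" by auto
  then show ?thesis
    by (simp add: comult_def shuffles_Sh_1_1 shuffles_Sh_2_0[unfolded numeral_2_eq_2]
        id_neq_transpose koszul_swap[unfolded numeral_2_eq_2] numeral_3_eq_3 numeral_2_eq_2 upt_rec)
qed

text \<open>The factors of an unshuffle are together a rearrangement of the letters of the word.\<close>

lemma comult_word_deg:
  assumes "(u, v) \<in> Poly_Mapping.keys (comult w :: _ \<Rightarrow>\<^sub>0 'k::field)"
  shows "word_deg u + word_deg v = word_deg w"
proof -
  let ?p = "length w"
  have "(u, v) \<in> (\<Union>k\<in>{1..<?p}. \<Union>\<sigma>\<in>shuffles_Sh k (?p - k - 1).
      {(map (\<lambda>i. w ! \<sigma> i) [0..<k], map (\<lambda>i. w ! \<sigma> i) [k..<?p - 1] @ [last w])})"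
    using assms unfolding comult_def Let_def
    by (rule rev_subsetD) (intro order.trans[OF keys_sum] UN_mono order_refl; simp)
  then obtain k \<sigma> where k: "1 \<le> k" "k < ?p" and \<sigma>: "\<sigma> permutes {..<k + (?p - k - 1)}"
    and uv: "u = map (\<lambda>i. w ! \<sigma> i) [0..<k]" "v = map (\<lambda>i. w ! \<sigma> i) [k..<?p - 1] @ [last w]"
    by (auto simp: shuffles_Sh_def)
  from k have p: "k + (?p - k - 1) = ?p - 1" and ne: "w \<noteq> []" by auto
  have "word_deg u + word_deg v = word_deg (map (\<lambda>i. w ! \<sigma> i) ([0..<k] @ [k..<?p - 1])) + letter_deg (last w)"
    by (simp add: uv)
  also have "[0..<k] @ [k..<?p - 1] = [0..<?p - 1]"
    using k upt_add_eq_append[of 0 k "?p - 1 - k"] by simp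
  also have "word_deg (map (\<lambda>i. w ! \<sigma> i) [0..<?p - 1]) = (\<Sum>i<?p - 1. letter_deg (w ! \<sigma> i))"
    by (simp add: word_deg_def o_def interv_sum_list_conv_sum_set_nat atLeast0LessThan)
  also have "\<dots> = (\<Sum>i<?p - 1. letter_deg (w ! i))"
    using sum.permute[OF \<sigma>[unfolded p], of "\<lambda>i. letter_deg (w ! i)"] by (simp add: o_def)
  also have "\<dots> = word_deg (butlast w)"
    by (simp add: word_deg_def sum_list_sum_nth nth_butlast atLeast0LessThan)
  also have "\<dots> + letter_deg (last w) = word_deg (butlast w @ [last w])" by simp
  finally show ?thesis using ne by simp
qed

section \<open>The brackets of the convolution algebra\<close>

lemma linear_linext_family:
  assumes "vector_space s1" "vector_space s2"
    and "\<And>u F F'. T (F + F') u = T F u + T F' u" "\<And>u c F. T (s1 c F) u = s2 c (T F u)"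
  shows "Vector_Spaces.linear s1 s2 (\<lambda>F. linext s2 (T F) p)"
proof -
  interpret vector_space s2 by fact
  show ?thesis
    using assms by (simp add: Vector_Spaces.linear_iff linext_def sum.distrib scale_right_distrib
        scale_sum_right mult.commute)
qed

lemma sum_permutes_2:
  "(\<Sum>\<sigma> | \<sigma> permutes {..<2}. f \<sigma>) = f id + f (transpose 0 (Suc 0))"
  unfolding permutes_lessThan_2 by (simp add: id_neq_transpose)

lemma sum_permutes_3:
  "(\<Sum>\<sigma> | \<sigma> permutes {..<3}. f \<sigma>) =
    (f id + f (transpose 0 (Suc 0))) + (f (transpose 2 0) + f (transpose 2 0 \<circ> transpose 0 (Suc 0)))
    + (f (transpose 2 (Suc 0)) + f (transpose 2 (Suc 0) \<circ> transpose 0 (Suc 0)))"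
proof -
  have 3: "{..<3} = insert 2 {..<2::nat}" and 2: "{..<2} = {0, Suc 0}" by auto
  have "(\<Sum>\<sigma> | \<sigma> permutes {..<3}. f \<sigma>)
      = (\<Sum>b\<in>insert 2 {..<2}. \<Sum>q | q permutes {..<2}. f (transpose 2 b \<circ> q))"
    unfolding 3 by (rule sum_over_permutations_insert) auto
  also have "\<dots> = (f id + f (transpose 0 (Suc 0)))
      + ((f (transpose 2 0) + f (transpose 2 0 \<circ> transpose 0 (Suc 0)))
    + (f (transpose 2 (Suc 0)) + f (transpose 2 (Suc 0) \<circ> transpose 0 (Suc 0))))"
    unfolding sum_permutes_2 unfolding 2 by simp
  finally show ?thesis by (simp only: add.assoc)
qed

text \<open>The inversions of a permutation of three positions are among three pairs of positions.\<close>

lemma koszul_3: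
  "koszul 3 deg \<sigma> = (-1) powi ((if \<sigma> 1 < \<sigma> 0 then deg (\<sigma> 0) * deg (\<sigma> 1) else 0)
    + (if \<sigma> 2 < \<sigma> 0 then deg (\<sigma> 0) * deg (\<sigma> 2) else 0)
    + (if \<sigma> 2 < \<sigma> 1 then deg (\<sigma> 1) * deg (\<sigma> 2) else 0))"
proof -
  have set: "{(i, j). i < j \<and> j < 3 \<and> \<sigma> j < \<sigma> i} = {ij \<in> {(0, 1), (0, 2), (1, 2)}. \<sigma> (snd ij) < \<sigma> (fst ij)}"
    by auto
  show ?thesis
    unfolding koszul_def set by (subst sum.inter_filter) (simp_all add: add.assoc)
qed

lemma minus_one_powi_one_minus: "(-1::'k::field) powi (1 - n) = - ((-1) powi n)"
  using power_int_add[of "-1::'k" 1 "- n"] by (simp add: power_int_minus_one_minus)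

locale leibniz2_pair = V: leibniz2 V + W: leibniz2 W
  for V :: "('k::field_char_0, 'a::ab_group_add, 'b::ab_group_add) leibniz2"
    and W :: "('k, 'c::ab_group_add, 'd::ab_group_add) leibniz2" +
  fixes D :: "('a, 'b) word \<Rightarrow> ('a, 'b) word \<Rightarrow>\<^sub>0 'k"
  assumes coderivation: "zinbiel_coderivation V D"
begin

text \<open>The empty word is included; this is harmless as elements of \<open>L\<close> vanish on it.\<close>

definition homogeneous :: "int \<Rightarrow> (('a, 'b) word \<Rightarrow> 'c \<times> 'd) \<Rightarrow> bool" where
  "homogeneous k F \<longleftrightarrow> (\<forall>w. F w \<in> graded_part (word_deg w + k))"

lemma struct_op_multilinear:
  "struct_op W [u + u', v] = struct_op W [u, v] + struct_op W [u', v]"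
  "struct_op W [u, v + v'] = struct_op W [u, v] + struct_op W [u, v']"
  "struct_op W [smul W c u, v] = smul W c (struct_op W [u, v])"
  "struct_op W [u, smul W c v] = smul W c (struct_op W [u, v])"
  "struct_op W [x + x', y, z] = struct_op W [x, y, z] + struct_op W [x', y, z]"
  "struct_op W [x, y + y', z] = struct_op W [x, y, z] + struct_op W [x, y', z]"
  "struct_op W [x, y, z + z'] = struct_op W [x, y, z] + struct_op W [x, y, z']"
  "struct_op W [smul W c x, y, z] = smul W c (struct_op W [x, y, z])"
  "struct_op W [x, smul W c y, z] = smul W c (struct_op W [x, y, z])"
  "struct_op W [x, y, smul W c z] = smul W c (struct_op W [x, y, z])"
  by (simp_all add: prod_eq_iff W.multilinear W.s1.scale_right_distrib)

lemma conv_tensor_2: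
  "conv_tensor W [(i, F), (j, G)] [u, v] = smul W ((-1) powi (j * word_deg u)) (struct_op W [F u, G v])"
  by (simp add: conv_tensor_def lessThan_Suc)

lemma conv_tensor_3:
  "conv_tensor W [(i, F), (j, G), (k, H)] [u, v, w]
    = smul W ((-1) powi (j * word_deg u + k * (word_deg u + word_deg v))) (struct_op W [F u, G v, H w])"
  by (simp add: conv_tensor_def lessThan_Suc algebra_simps)

lemma conv_bracket_2:
  "conv_bracket W [(i, F), (j, G)] w = linext (smul W) (\<lambda>(u, v).
     smul W ((-1) powi (j * word_deg u)) (struct_op W [F u, G v])
     - smul W ((-1) powi (j * i + i * word_deg u)) (struct_op W [G u, F v])) (comult w)"
proof -
  have iter: "comult_iter (Suc 0) w
      = linext fscale (\<lambda>(u, v). Poly_Mapping.single [u, v] (1::'k)) (comult w)"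
    by (simp add: linext_single[OF vector_space_fscale] poly_mapping_eq_iff fun_eq_iff case_prod_unfold)
  show ?thesis
    unfolding conv_bracket_def Let_def
    by (simp add: iter linext_linext[OF W.vector_space_smul] linext_single[OF W.vector_space_smul] case_prod_unfold
        numeral_2_eq_2[symmetric] sum_permutes_2 koszul_swap sign_swap_id sign_id conv_tensor_2
        power_int_add upt_rec del: struct_op.simps)
qed

lemma conv_bracket_2_graded:
  assumes "homogeneous i F" "homogeneous j G"
  shows "conv_bracket W [(i, F), (j, G)] w \<in> graded_part (word_deg w + i + j)"
  unfolding conv_bracket_2
proof (rule W.graded_part_linext, clarsimp simp del: struct_op.simps)
  fix u v
  assume "(u, v) \<in> Poly_Mapping.keys (comult w :: _ \<Rightarrow>\<^sub>0 'k)"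
  then have w: "word_deg w = word_deg u + word_deg v" by (simp add: comult_word_deg)
  have "struct_op W [F u, G v] \<in> graded_part ((word_deg u + i) + (word_deg v + j))"
    "struct_op W [G u, F v] \<in> graded_part ((word_deg u + j) + (word_deg v + i))"
    using assms unfolding homogeneous_def by (blast intro: W.struct_op_graded2)+
  then have "struct_op W [F u, G v] \<in> graded_part (word_deg w + i + j)"
    "struct_op W [G u, F v] \<in> graded_part (word_deg w + i + j)"
    by (simp_all add: w add_ac del: struct_op.simps)
  then show "smul W ((-1) powi (j * word_deg u)) (struct_op W [F u, G v])
     - smul W ((-1) powi (j * i + i * word_deg u)) (struct_op W [G u, F v]) \<in> graded_part (word_deg w + i + j)"
    by (intro W.graded_part_diff W.graded_part_smul)
qed

lemma conv_bracket_2_linear: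
  shows "Vector_Spaces.linear (conv_smul W) (smul W) (\<lambda>F. conv_bracket W [(i, F), (j, G)] w)"
    and "Vector_Spaces.linear (conv_smul W) (smul W) (\<lambda>G. conv_bracket W [(i, F), (j, G)] w)"
  unfolding conv_bracket_2
  by (rule linear_linext_family[OF W.vector_space_conv_smul W.vector_space_smul];
      simp add: case_prod_unfold conv_smul_def struct_op_multilinear W.s.scale_right_distrib
        W.s.scale_right_diff_distrib mult.commute del: struct_op.simps)+

lemma smul_2: "smul W 2 v = v + v"
  using W.s.scale_left_distrib[of 1 1 v] by simp

text \<open>The signs in the bracket make it graded antisymmetric: it is symmetric on elements of degree -1, and
  antisymmetric if one of the arguments has degree 0.\<close>

lemma conv_bracket_2_symmetric:
  "conv_bracket W [(0, G), (-1, F)] w = - conv_bracket W [(-1, F), (0, G)] w"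
  "conv_bracket W [(-1, F), (-1, F)] w = smul W 2 (linext (smul W)
    (\<lambda>(u, v). smul W ((-1) powi word_deg u) (struct_op W [F u, F v])) (comult w))"
proof -
  have double: "smul W c (v + v) = smul W 2 (smul W c v)" for c v
    by (simp only: smul_2 W.s.scale_right_distrib)
  show "conv_bracket W [(0, G), (-1, F)] w = - conv_bracket W [(-1, F), (0, G)] w"
    unfolding conv_bracket_2 by (simp add: linext_def sum_negf[symmetric] case_prod_unfold
        W.s.scale_minus_right[symmetric] power_int_minus_one_minus del: struct_op.simps W.s.scale_minus_right)
  show "conv_bracket W [(-1, F), (-1, F)] w = smul W 2 (linext (smul W)
    (\<lambda>(u, v). smul W ((-1) powi word_deg u) (struct_op W [F u, F v])) (comult w))"
    unfolding conv_bracket_2 linext_def W.s.scale_sum_right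
    by (intro sum.cong refl)
      (simp add: case_prod_unfold power_int_minus_one_minus minus_one_powi_one_minus double
        del: struct_op.simps W.s.scale_scale)
qed

lemma conv_bracket_3_expand:
  "conv_bracket W [(i, F), (j, G), (k, H)] w = linext (smul W) (\<lambda>(u, v). linext (smul W) (\<lambda>(a, b).
     \<Sum>\<sigma> | \<sigma> permutes {..<3}.
        smul W (koszul 3 (\<lambda>m. fst ([(i, F), (j, G), (k, H)] ! m)) \<sigma> * of_int (sign \<sigma>))
          (conv_tensor W [[(i, F), (j, G), (k, H)] ! \<sigma> 0, [(i, F), (j, G), (k, H)] ! \<sigma> (Suc 0),
             [(i, F), (j, G), (k, H)] ! \<sigma> 2] [a, b, v])) (comult u)) (comult w)"
proof -
  have iter: "comult_iter 2 w = linext fscale (\<lambda>(u, v).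
      linext fscale (\<lambda>(a, b). Poly_Mapping.single [a, b, v] (1::'k)) (comult u)) (comult w)"
    by (simp add: numeral_2_eq_2 linext_single[OF vector_space_fscale] linext_linext[OF vector_space_fscale]
        poly_mapping_eq_iff fun_eq_iff case_prod_unfold)
  have upt: "[0..<3] = [0, Suc 0, 2]" by (simp add: upt_rec)
  have len: "length [(i, F), (j, G), (k, H)] = 3" "3 - 1 = (2::nat)" by simp_all
  show ?thesis
    unfolding conv_bracket_def Let_def len iter upt
    by (simp add: linext_linext[OF W.vector_space_smul] linext_single[OF W.vector_space_smul] case_prod_unfold)
qed

text \<open>\<open>m\<^sub>3\<close> only sees components of degree 0, and an element of \<open>L\<close> of degree at least 0 has none.\<close>

lemma conv_bracket_3_zero:
  assumes "(\<forall>w. fst (F w) = 0) \<or> (\<forall>w. fst (G w) = 0) \<or> (\<forall>w. fst (H w) = 0)"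
  shows "conv_bracket W [(i, F), (j, G), (k, H)] w = 0"
proof -
  have "(\<Sum>\<sigma> | \<sigma> permutes {..<3}. smul W (c \<sigma>)
      (conv_tensor W [[(i, F), (j, G), (k, H)] ! \<sigma> 0, [(i, F), (j, G), (k, H)] ! \<sigma> (Suc 0),
             [(i, F), (j, G), (k, H)] ! \<sigma> 2] [a, b, v])) = 0" for c a b v
    unfolding sum_permutes_3 using assms
    by (auto simp: transpose_def conv_tensor_3 W.multilinear prod_eq_iff)
  then show ?thesis
    by (simp only: conv_bracket_3_expand) (simp add: linext_def case_prod_unfold)
qed

text \<open>On elements of degree -1 the Koszul sign of a permutation equals its signature, so all six terms agree in sign.\<close>

lemma conv_bracket_3:
  "conv_bracket W [(-1, F), (-1, G), (-1, H)] w =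
    linext (smul W) (\<lambda>(u, v). linext (smul W) (\<lambda>(a, b). smul W ((-1) powi word_deg b)
      ((struct_op W [F a, G b, H v] + struct_op W [G a, F b, H v])
       + (struct_op W [H a, G b, F v] + struct_op W [G a, H b, F v])
       + (struct_op W [F a, H b, G v] + struct_op W [H a, F b, G v]))) (comult u)) (comult w)"
proof -
  let ?f = "[(-1, F), (-1, G), (-1, H)]"
  have sign: "koszul 3 (\<lambda>m. fst (?f ! m)) \<sigma> * of_int (sign \<sigma>) = (1::'k)"
    if "\<sigma> \<in> {id, transpose 0 (Suc 0), transpose 2 0, transpose 2 0 \<circ> transpose 0 (Suc 0),
      transpose 2 (Suc 0), transpose 2 (Suc 0) \<circ> transpose 0 (Suc 0)}" for \<sigma>
    using that unfolding koszul_3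
    by (auto simp: transpose_def sign_compose sign_swap_id sign_id permutation_swap_id
        simp flip: transpose_def)
  have "(\<Sum>\<sigma> | \<sigma> permutes {..<3}. smul W (koszul 3 (\<lambda>m. fst (?f ! m)) \<sigma> * of_int (sign \<sigma>))
          (conv_tensor W [?f ! \<sigma> 0, ?f ! \<sigma> (Suc 0), ?f ! \<sigma> 2] [a, b, v]))
    = smul W ((-1) powi word_deg b)
      ((struct_op W [F a, G b, H v] + struct_op W [G a, F b, H v])
       + (struct_op W [H a, G b, F v] + struct_op W [G a, H b, F v])
       + (struct_op W [F a, H b, G v] + struct_op W [H a, F b, G v]))" for a b v
  proof -
    have "(-1::'k) powi (- word_deg a + - (word_deg a + word_deg b)) = (-1) powi word_deg b"
      by (simp only: minus_add_distrib[symmetric] power_int_minus_one_minus power_int_add[OF disjI1, of "-1::'k"])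
        (simp add: power_int_add mult.assoc[symmetric])
    then show ?thesis
      unfolding sum_permutes_3
      by (simp add: sign transpose_def conv_tensor_3 W.s.scale_right_distrib del: struct_op.simps)
  qed
  then show ?thesis by (simp only: conv_bracket_3_expand)
qed


lemma conv_bracket_3_linear:
  fixes F G H :: "('a, 'b) word \<Rightarrow> 'c \<times> 'd"
  shows "Vector_Spaces.linear (conv_smul W) (smul W) (\<lambda>F. conv_bracket W [(-1, F), (-1, G), (-1, H)] w)"
    and "Vector_Spaces.linear (conv_smul W) (smul W) (\<lambda>G. conv_bracket W [(-1, F), (-1, G), (-1, H)] w)"
    and "Vector_Spaces.linear (conv_smul W) (smul W) (\<lambda>H. conv_bracket W [(-1, F), (-1, G), (-1, H)] w)"
proof -
  define T where "T F G H = (\<lambda>(u, v). linext (smul W) (\<lambda>(a, b). smul W ((-1) powi word_deg b)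
      ((struct_op W [F a, G b, H v] + struct_op W [G a, F b, H v])
       + (struct_op W [H a, G b, F v] + struct_op W [G a, H b, F v])
       + (struct_op W [F a, H b, G v] + struct_op W [H a, F b, G v]))) (comult u))"
    for F G H :: "('a, 'b) word \<Rightarrow> 'c \<times> 'd"
  have lin: "Vector_Spaces.linear (conv_smul W) (smul W) (\<lambda>F. T F G H u)"
    "Vector_Spaces.linear (conv_smul W) (smul W) (\<lambda>G. T F G H u)"
    "Vector_Spaces.linear (conv_smul W) (smul W) (\<lambda>H. T F G H u)" for F G H u
    unfolding T_def case_prod_unfold
    by (rule linear_linext_family[OF W.vector_space_conv_smul W.vector_space_smul];
        simp add: conv_smul_def struct_op_multilinear W.s.scale_right_distrib mult.commute
        del: struct_op.simps)+
  note l = lin[THEN linear_simps(1)] lin[THEN linear_simps(2)]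
  have eq: "conv_bracket W [(-1, F), (-1, G), (-1, H)] w = linext (smul W) (T F G H) (comult w)" for F G H
    by (simp only: conv_bracket_3 T_def)
  show "Vector_Spaces.linear (conv_smul W) (smul W) (\<lambda>F. conv_bracket W [(-1, F), (-1, G), (-1, H)] w)"
    "Vector_Spaces.linear (conv_smul W) (smul W) (\<lambda>G. conv_bracket W [(-1, F), (-1, G), (-1, H)] w)"
    "Vector_Spaces.linear (conv_smul W) (smul W) (\<lambda>H. conv_bracket W [(-1, F), (-1, G), (-1, H)] w)"
    unfolding eq
    by (rule linear_linext_family[OF W.vector_space_conv_smul W.vector_space_smul]; rule l)+
qed

lemma conv_bracket_3_graded:
  assumes "homogeneous (-1) F"
  shows "conv_bracket W [(-1, F), (-1, F), (-1, F)] w \<in> graded_part (word_deg w - 2)"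
  unfolding conv_bracket_3
proof (rule W.graded_part_linext, clarsimp simp del: struct_op.simps,
    rule W.graded_part_linext, clarsimp simp del: struct_op.simps)
  fix u v a b
  assume "(u, v) \<in> Poly_Mapping.keys (comult w :: _ \<Rightarrow>\<^sub>0 'k)" "(a, b) \<in> Poly_Mapping.keys (comult u :: _ \<Rightarrow>\<^sub>0 'k)"
  then have w: "word_deg w = word_deg a + word_deg b + word_deg v" by (simp add: comult_word_deg)
  have "struct_op W [F a, F b, F v] \<in> graded_part ((word_deg a + -1) + (word_deg b + -1) + (word_deg v + -1) + 1)"
    using assms unfolding homogeneous_def by (blast intro: W.struct_op_graded3)
  then have "struct_op W [F a, F b, F v] \<in> graded_part (word_deg w - 2)"
    by (simp add: w algebra_simps del: struct_op.simps)
  then show "smul W ((-1) powi word_deg b)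
      (struct_op W [F a, F b, F v] + struct_op W [F a, F b, F v]
       + (struct_op W [F a, F b, F v] + struct_op W [F a, F b, F v])
       + (struct_op W [F a, F b, F v] + struct_op W [F a, F b, F v])) \<in> graded_part (word_deg w - 2)"
    by (intro W.graded_part_add W.graded_part_smul)
qed

section \<open>The coderivation on words of small degree\<close>

text \<open>The coderivation enters only through its values on words of degree at most 3, where it is
  determined by \<open>l\<^sub>1\<close>, \<open>l\<^sub>2\<close>, \<open>l\<^sub>3\<close>.\<close>

lemma D_keys: "u \<in> Poly_Mapping.keys (D w) \<Longrightarrow> u \<noteq> [] \<and> word_deg u = word_deg w - 1"
  using coderivation by (auto simp: zinbiel_coderivation_def)

lemma D_degree_le_1:
  assumes "word_deg w \<le> 1" shows "D w = 0"
proof -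
  have "u \<notin> Poly_Mapping.keys (D w)" for u
    using D_keys[of u w] word_deg_le_0[of u] assms by auto
  then have "Poly_Mapping.keys (D w) = {}" by blast
  then show ?thesis by simp
qed

lemma D_corestr: "w \<noteq> [] \<Longrightarrow> linext (smul V) word_proj (D w) = corestr V w"
  using coderivation by (auto simp: zinbiel_coderivation_def)

lemma linear_fst_snd:
  "Vector_Spaces.linear (smul0 V) s T \<Longrightarrow> Vector_Spaces.linear (smul V) s (\<lambda>v. T (fst v))"
  "Vector_Spaces.linear (smul1 V) s S \<Longrightarrow> Vector_Spaces.linear (smul V) s (\<lambda>v. S (snd v))"
  using V.vector_space_smul by (simp_all add: Vector_Spaces.linear_iff)

text \<open>On a word of degree 2 the value of \<open>D\<close> has degree 1, hence is a combination of single letters \<open>sx\<close>,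
  and these are seen by the corestriction.\<close>

lemma D_degree_2:
  assumes "word_deg w = 2" "Vector_Spaces.linear (smul0 V) (smul W) T" "\<And>x. F [Inl x] = T x"
  shows "linext (smul W) F (D w) = T (fst (corestr V w))"
proof -
  have "linext (smul W) F (D w) = linext (smul W) (\<lambda>u. T (fst (word_proj u))) (D w)"
  proof (rule linext_cong)
    fix u assume "u \<in> Poly_Mapping.keys (D w)"
    then obtain x where "u = [Inl x]" using D_keys[of u w] assms(1) word_deg_1[of u] by auto
    then show "F u = T (fst (word_proj u))" using assms(3) by simp
  qed
  also have "\<dots> = T (fst (linext (smul V) word_proj (D w)))"
    by (rule linear_linext_comp[OF linear_fst_snd(1)[OF assms(2)]])
  also have "\<dots> = T (fst (corestr V w))"
    using assms(1) by (subst D_corestr) auto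
  finally show ?thesis .
qed

text \<open>A functional on \<open>Zin\<^sup>c(sV) \<otimes> Zin\<^sup>c(sV)\<close> that is supported on pairs of letters of degree 1. Composed with
  the comultiplication it recovers the value of a bilinear map on the two-letter words \<open>sx sy\<close>.\<close>

fun letter_pair :: "('a \<Rightarrow> 'a \<Rightarrow> 'c \<times> 'd) \<Rightarrow> ('a, 'b) word \<times> ('a, 'b) word \<Rightarrow> 'c \<times> 'd" where
  "letter_pair B ([Inl x], [Inl y]) = B x y"
| "letter_pair B _ = 0"

lemma letter_pair_eq_0:
  "length u \<noteq> 1 \<Longrightarrow> letter_pair B (u, v) = 0"
  "length v \<noteq> 1 \<Longrightarrow> letter_pair B (u, v) = 0"
  by (cases "(B, (u, v))" rule: letter_pair.cases; simp)+

lemma letter_pair_letterwise_linear: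
  assumes "bilinear_map (smul0 V) (smul0 V) (smul W) B"
  shows "letterwise_linear V (smul W) pair_slots (letter_pair B)"
proof -
  have 1: "letter_pair B (u @ Inl (smul0 V a x + y) # v, w)
      = smul W a (letter_pair B (u @ Inl x # v, w)) + letter_pair B (u @ Inl y # v, w)"
    "letter_pair B (w, u @ Inl (smul0 V a x + y) # v)
      = smul W a (letter_pair B (w, u @ Inl x # v)) + letter_pair B (w, u @ Inl y # v)" for a x y u v w
    by (cases "length (u @ v) = 0"; cases "length w = 1"; cases "hd w";
        auto simp: letter_pair_eq_0 bilinear_map_simps[OF assms] length_Suc_conv)+
  have 2: "letter_pair B (u @ Inr h # v, w) = 0" "letter_pair B (w, u @ Inr h # v) = 0" for h u v w
    by (cases "length (u @ v) = 0"; cases "length w = 1"; cases "hd w";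
        auto simp: letter_pair_eq_0 length_Suc_conv)+
  show ?thesis
    unfolding letterwise_linear_def pair_slots_def word_slots_def
    by (auto simp: 1 2)
qed

text \<open>Multilinear functionals are well defined on the tensor product.\<close>

lemma linext_tensor_null:
  assumes "letterwise_linear V (smul W) C G" "p \<in> tensor_null V C"
  shows "linext (smul W) G p = 0"
proof -
  interpret f: vector_space "fscale :: 'k \<Rightarrow> _ \<Rightarrow> ('e \<Rightarrow>\<^sub>0 'k)"
    by (rule vector_space_fscale)
  note lin = linext_diff[OF W.vector_space_smul] linext_fscale[OF W.vector_space_smul]
    linext_single[OF W.vector_space_smul] linext_add[OF W.vector_space_smul]
  have "p \<in> {p. linext (smul W) G p = 0}"
    using assms(2) unfolding tensor_null_def
  proof (rule rev_subsetD, intro f.span_minimal)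
    show "f.subspace {p. linext (smul W) G p = 0}"
      by (simp add: f.subspace_def lin)
  qed (use assms(1) in \<open>auto simp: lin letterwise_linear_def\<close>)
  then show ?thesis by simp
qed

text \<open>On a word of degree 3 the value of \<open>D\<close> is a combination of letters \<open>sh\<close> and of words \<open>sx sy\<close>. The former
  are seen by the corestriction. The latter are seen by the comultiplication, which sends \<open>sx sy\<close> to
  \<open>sx \<otimes> sy\<close>; as \<open>D\<close> is a coderivation, this part is expressed through \<open>D\<close> on the factors of the word.\<close>

lemma D_degree_3:
  assumes w: "word_deg w = 3"
    and S: "Vector_Spaces.linear (smul1 V) (smul W) S" and F_h: "\<And>h. F [Inr h] = S h"
    and B: "bilinear_map (smul0 V) (smul0 V) (smul W) B" and F_xy: "\<And>x y. F [Inl x, Inl y] = B x y"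
  shows "linext (smul W) F (D w) = S (snd (corestr V w))
    + linext (smul W) (\<lambda>(u, v). linext (smul W) (\<lambda>u'. letter_pair B (u', v)) (D u)
        + linext (smul W) (\<lambda>v'. smul W ((-1) powi word_deg u) (letter_pair B (u, v'))) (D v)) (comult w)"
proof -
  note lin = linext_linext[OF W.vector_space_smul] linext_diff[OF W.vector_space_smul]
    linext_single[OF W.vector_space_smul] linext_add[OF W.vector_space_smul]
  have S0: "S 0 = 0" by (rule linear_simps(3)[OF S])
  have split: "linext (smul W) F (D w) = linext (smul W) (\<lambda>u. S (snd (word_proj u))
      + linext (smul W) (letter_pair B) (comult u)) (D w)"
  proof (rule linext_cong)
    fix u assume "u \<in> Poly_Mapping.keys (D w)"
    then have "word_deg u = 2" using D_keys[of u w] w by simp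
    then consider h where "u = [Inr h]" | x y where "u = [Inl x, Inl y]"
      by (auto simp: word_deg_2)
    then show "F u = S (snd (word_proj u)) + linext (smul W) (letter_pair B) (comult u)"
      by cases (simp_all add: F_h F_xy comult_2 lin S0)
  qed
  have "linext (smul W) (letter_pair B) (linext fscale comult (D w)
        - linext fscale (\<lambda>(u, v).
            linext fscale (\<lambda>u'. Poly_Mapping.single (u', v) 1) (D u)
            + linext fscale (\<lambda>v'. Poly_Mapping.single (u, v') ((-1) powi word_deg u)) (D v))
          (comult w)) = 0"
  proof (rule linext_tensor_null[OF letter_pair_letterwise_linear[OF B]])
    have "w \<noteq> []" using w by auto
    then show "linext fscale comult (D w)
        - linext fscale (\<lambda>(u, v).
            linext fscale (\<lambda>u'. Poly_Mapping.single (u', v) 1) (D u)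
            + linext fscale (\<lambda>v'. Poly_Mapping.single (u, v') ((-1) powi word_deg u)) (D v))
          (comult w) \<in> tensor_null V pair_slots"
      using coderivation unfolding zinbiel_coderivation_def by blast
  qed
  then have "linext (smul W) (\<lambda>u. linext (smul W) (letter_pair B) (comult u)) (D w)
    = linext (smul W) (\<lambda>(u, v). linext (smul W) (\<lambda>u'. letter_pair B (u', v)) (D u)
        + linext (smul W) (\<lambda>v'. smul W ((-1) powi word_deg u) (letter_pair B (u, v'))) (D v)) (comult w)"
    by (simp add: lin case_prod_unfold)
  moreover have "linext (smul W) (\<lambda>u. S (snd (word_proj u))) (D w) = S (snd (corestr V w))"
    using linear_linext_comp[OF linear_fst_snd(2)[OF S], of word_proj "D w"] w
    by (subst (asm) D_corestr) auto
  ultimately show ?thesis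
    unfolding split by (simp add: linext_def W.s.scale_right_distrib sum.distrib)
qed

lemma conv_bracket1_graded:
  assumes "homogeneous k F"
  shows "conv_bracket1 W D (k, F) w \<in> graded_part (word_deg w + k - 1)"
proof -
  have "struct_op W [F w] \<in> graded_part (word_deg w + k - 1)"
    using assms by (intro W.struct_op_graded1) (simp add: homogeneous_def)
  moreover have "linext (smul W) F (D w) \<in> graded_part (word_deg w + k - 1)"
  proof (rule W.graded_part_linext)
    fix u assume "u \<in> Poly_Mapping.keys (D w)"
    then have "word_deg w + k - 1 = word_deg u + k" using D_keys[of u w] by simp
    then show "F u \<in> graded_part (word_deg w + k - 1)"
      using assms by (simp only: homogeneous_def)
  qed
  ultimately show ?thesis
    unfolding conv_bracket1_def fst_conv snd_conv by (intro W.graded_part_add W.graded_part_smul)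
qed

lemma conv_bracket1_linear:
  "Vector_Spaces.linear (conv_smul W) (conv_smul W) (\<lambda>F. conv_bracket1 W D (k, F))"
proof -
  have "Vector_Spaces.linear (conv_smul W) (smul W) (\<lambda>F. linext (smul W) F (D w))" for w
    by (rule linear_linext_family[OF W.vector_space_conv_smul W.vector_space_smul])
      (simp_all add: conv_smul_def)
  note l = linear_simps(1,2)[OF this]
  show ?thesis
    using W.vector_space_conv_smul
    by (simp add: Vector_Spaces.linear_iff fun_eq_iff conv_bracket1_def l W.s.scale_right_distrib)
      (simp add: conv_smul_def conv_bracket1_def W.multilinear W.s.scale_right_distrib mult.commute prod_eq_iff)
qed

end

section \<open>The Maurer-Cartan equation for functions and for 1-forms\<close>

text \<open>The element of \<open>L\<^sub>0\<close> corresponding to a degree 1 map \<open>V \<rightarrow> W\<close>.\<close>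

fun homotopy_form :: "('a \<Rightarrow> 'd) \<Rightarrow> ('a, 'b) word \<Rightarrow> 'c::zero \<times> 'd::zero" where
  "homotopy_form \<rho> [Inl x] = (0, \<rho> x)"
| "homotopy_form \<rho> _ = 0"

context leibniz2_pair
begin

text \<open>The velocity at \<open>f\<close> of the gauge action of \<open>\<rho>\<close>, obtained by linearising the equations of an
  \<open>\<infinity>\<close>-homotopy from \<open>f\<close>. It is a tangent vector rather than a morphism; the record merely holds its
  three components.\<close>

definition flow :: "('a, 'b, 'c, 'd) infmap \<Rightarrow> ('a \<Rightarrow> 'd) \<Rightarrow> ('a, 'b, 'c, 'd) infmap" where
  "flow f \<rho> = \<lparr>f1x = \<lambda>x. l1 W (\<rho> x), f1h = \<lambda>h. \<rho> (l1 V h),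
     f2 = \<lambda>x y. \<rho> (l2xx V x y) - l2xh W (f1x f x) (\<rho> y) - l2hx W (\<rho> x) (f1x f y)\<rparr>"

lemma homogeneous_conv_of_morphism: "homogeneous (-1) (conv_of_morphism f)"
  unfolding homogeneous_def
proof
  fix w show "conv_of_morphism f w \<in> graded_part (word_deg w + -1)"
    by (cases "(f, w)" rule: conv_of_morphism.cases) (auto simp: graded_part_def)
qed

lemma homogeneous_homotopy_form: "homogeneous 0 (homotopy_form \<rho>)"
  unfolding homogeneous_def
proof
  fix w show "homotopy_form \<rho> w \<in> graded_part (word_deg w + 0)"
    by (cases "(\<rho>, w)" rule: homotopy_form.cases) (auto simp: graded_part_def)
qed

lemma linear_into_W:
  "Vector_Spaces.linear s (smul0 W) T \<Longrightarrow> Vector_Spaces.linear s (smul W) (\<lambda>x. (T x, 0))"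
  "Vector_Spaces.linear s (smul1 W) S \<Longrightarrow> Vector_Spaces.linear s (smul W) (\<lambda>x. (0, S x))"
  using W.vector_space_smul by (auto simp: Vector_Spaces.linear_iff prod_eq_iff)

lemma bilinear_into_W:
  "bilinear_map s1 s2 (smul1 W) B \<Longrightarrow> bilinear_map s1 s2 (smul W) (\<lambda>x y. (0, B x y))"
  by (simp add: bilinear_map_def linear_into_W)

lemma smul_6: "smul W 6 v = v + v + (v + v) + (v + v)"
proof -
  have "smul W (2 * 3) v = smul W 2 (smul W (2 + 1) v)" by simp
  also have "\<dots> = v + v + (v + v) + (v + v)"
    by (simp only: smul_2 W.s.scale_left_distrib) (simp add: algebra_simps)
  finally show ?thesis by simp
qed

text \<open>Infinity morphisms are Maurer-Cartan elements of \<open>L\<close>. The left-hand side has degree -2, so it can be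
  nonzero only on words of degree 2 and 3, and its values on the five kinds of such words are the five
  equations of an infinity morphism.\<close>

lemma morphism_curvature_zero:
  assumes f: "infinity_morphism V W f"
  defines "\<alpha> \<equiv> conv_of_morphism f"
  shows "conv_bracket1 W D (-1, \<alpha>) w + smul W (-1/2) (conv_bracket W [(-1, \<alpha>), (-1, \<alpha>)] w)
    + smul W (-1/6) (conv_bracket W [(-1, \<alpha>), (-1, \<alpha>), (-1, \<alpha>)] w) = 0" (is "?C w = 0")
proof -
  note fm = f[unfolded infinity_morphism_def]
  have \<alpha>: "\<alpha> [Inl x] = (f1x f x, 0)" "\<alpha> [Inr h] = (0, f1h f h)" "\<alpha> [Inl x, Inl y] = (0, f2 f x y)"
    "\<alpha> [Inl x, Inr h] = 0" "\<alpha> [Inr h, Inl x] = 0" "\<alpha> [Inl x, Inl y, Inl z] = 0" for x y z h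
    by (simp_all add: \<alpha>_def)
  have T: "Vector_Spaces.linear (smul0 V) (smul W) (\<lambda>x. (f1x f x, 0))"
    and S: "Vector_Spaces.linear (smul1 V) (smul W) (\<lambda>h. (0, f1h f h))"
    and B: "bilinear_map (smul0 V) (smul0 V) (smul W) (\<lambda>x y. (0, f2 f x y))"
    using fm by (auto intro: linear_into_W bilinear_into_W)
  note D2 = D_degree_2[where F = \<alpha>, OF _ T \<alpha>(1)] and D3 = D_degree_3[where F = \<alpha>, OF _ S \<alpha>(2) B \<alpha>(3)]
  have B2: "Vector_Spaces.linear (smul0 V) (smul W) (\<lambda>y. - (0, f2 f x y))"
    "Vector_Spaces.linear (smul0 V) (smul W) (\<lambda>x. (0, f2 f x y))" for x y
  proof -
    have "bilinear_map (smul0 V) (smul0 V) (smul1 W) (f2 f)" using fm by blast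
    note bs = bilinear_map_simps[OF this]
    show "Vector_Spaces.linear (smul0 V) (smul W) (\<lambda>y. - (0, f2 f x y))"
      "Vector_Spaces.linear (smul0 V) (smul W) (\<lambda>x. (0, f2 f x y))" for x y
      using W.vector_space_smul V.vector_spaces(1)
      by (simp_all add: Vector_Spaces.linear_iff bs prod_eq_iff W.s1.scale_right_distrib mult.commute)
  qed
  have D3': "linext (smul W) (\<lambda>v'. - letter_pair (\<lambda>x y. (0, f2 f x y)) ([Inl x], v')) (D v)
      = - (0, f2 f x (fst (corestr V v)))"
    "linext (smul W) (\<lambda>u'. letter_pair (\<lambda>x y. (0, f2 f x y)) (u', [Inl y])) (D v)
      = (0, f2 f (fst (corestr V v)) y)"
    if "word_deg v = 2" for x y v
    by (rule D_degree_2[OF that B2(1)] D_degree_2[OF that B2(2)]; simp)+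
  note lin = linext_single[OF W.vector_space_smul] linext_add[OF W.vector_space_smul]
    conv_bracket1_def conv_bracket_2_symmetric(2) conv_bracket_3 comult_2 comult_3 D_degree_le_1 \<alpha>
  have graded: "?C w \<in> graded_part (word_deg w - 2)"
    using conv_bracket1_graded[of "-1" \<alpha> w] conv_bracket_2_graded[of "-1" \<alpha> "-1" \<alpha> w]
      conv_bracket_3_graded[of \<alpha> w] homogeneous_conv_of_morphism[of f, folded \<alpha>_def]
    by (intro W.graded_part_add W.graded_part_smul) simp_all
  consider "word_deg w - 2 \<noteq> 0" "word_deg w - 2 \<noteq> 1" | "word_deg w = 2" | "word_deg w = 3"
    by linarith
  then show ?thesis
  proof cases
    case 1
    then show ?thesis using graded by (intro graded_part_eq_0)
  next
    case 2
    then consider h where "w = [Inr h]" | x y where "w = [Inl x, Inl y]" by (auto simp: word_deg_2)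
    then show ?thesis
    proof cases
      case (1 h)
      then show ?thesis using fm by (simp add: lin D2 prod_eq_iff W.multilinear)
    next
      case (2 x y)
      have "f1x f (l2xx V x y) = l2xx W (f1x f x) (f1x f y) + l1 W (f2 f x y)" using fm by simp
      then show ?thesis by (simp add: 2 lin D2 prod_eq_iff W.multilinear)
    qed
  next
    case 3
    then consider x h where "w = [Inl x, Inr h]" | h x where "w = [Inr h, Inl x]"
      | x y z where "w = [Inl x, Inl y, Inl z]" by (auto simp: word_deg_3)
    then show ?thesis
    proof cases
      case (1 x h)
      then show ?thesis using fm by (simp add: lin D3 D3' prod_eq_iff W.multilinear)
    next
      case (2 h x)
      have "f1h f (- l2hx V h x) = - f1h f (l2hx V h x)" using fm linear_simps(4) by blast
      with 2 show ?thesis using fm by (simp add: lin D3 D3' prod_eq_iff W.multilinear)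
    next
      case (3 x y z)
      have "l3 W (f1x f x) (f1x f y) (f1x f z) - l2hx W (f2 f x y) (f1x f z)
        + l2xh W (f1x f x) (f2 f y z) - l2xh W (f1x f y) (f2 f x z)
        = f1h f (l3 V x y z) + f2 f (l2xx V x y) z - f2 f x (l2xx V y z)
          + f2 f y (l2xx V x z)"
        using fm by blast
      moreover have "smul1 W (1/6) v + (smul1 W (1/6) v + (smul1 W (1/6) v
          + (smul1 W (1/6) v + (smul1 W (1/6) v + smul1 W (1/6) v)))) = v" for v
        using arg_cong[OF smul_6[of "(0, smul1 W (1/6) v)"], of snd] by (simp add: add.assoc)
      ultimately show ?thesis
        by (simp add: 3 lin D3 D3' prod_eq_iff W.multilinear algebra_simps)
    qed
  qed
qed

text \<open>The coefficient of \<open>dt\<close> in the Maurer-Cartan equation for \<open>a(t) \<otimes> 1 + r dt\<close> says that \<open>a\<close> moves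
  with velocity \<open>flow a \<rho>\<close>. It has degree -1, and the three kinds of words of degree 1 and 2 give the three
  components of \<open>flow\<close>.\<close>

lemma homotopy_flow:
  assumes f: "Vector_Spaces.linear (smul0 V) (smul0 W) (f1x f)"
    and \<rho>: "Vector_Spaces.linear (smul0 V) (smul1 W) \<rho>"
  defines "\<alpha> \<equiv> conv_of_morphism f" and "r \<equiv> homotopy_form \<rho>"
  shows "conv_bracket1 W D (0, r) w - conv_of_morphism (flow f \<rho>) w
    + smul W (-1/2) (conv_bracket W [(-1, \<alpha>), (0, r)] w - conv_bracket W [(0, r), (-1, \<alpha>)] w) = 0"
    (is "?C w = 0")
proof -
  have \<alpha>: "\<alpha> [Inl x] = (f1x f x, 0)" "\<alpha> [Inr h] = (0, f1h f h)" "\<alpha> [Inl x, Inl y] = (0, f2 f x y)" for x y h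
    by (simp_all add: \<alpha>_def)
  have r: "r [Inl x] = (0, \<rho> x)" "r [Inr h] = 0" "r [Inl x, Inl y] = 0" for x y h
    by (simp_all add: r_def)
  note D2 = D_degree_2[where F = r, OF _ linear_into_W(2)[OF \<rho>] r(1)]
  note lin = linext_single[OF W.vector_space_smul] linext_add[OF W.vector_space_smul]
    conv_bracket1_def conv_bracket_2 comult_2 D_degree_le_1 \<alpha> r
  have "conv_of_morphism (flow f \<rho>) w \<in> graded_part (word_deg w - 1)"
    using homogeneous_conv_of_morphism by (simp add: homogeneous_def)
  then have graded: "?C w \<in> graded_part (word_deg w - 1)"
    using conv_bracket1_graded[of 0 r w] conv_bracket_2_graded[of "-1" \<alpha> 0 r w]
      conv_bracket_2_graded[of 0 r "-1" \<alpha> w] homogeneous_conv_of_morphism[of f, folded \<alpha>_def]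
      homogeneous_homotopy_form[of \<rho>, folded r_def]
    by (intro W.graded_part_add W.graded_part_smul W.graded_part_diff) simp_all
  have half: "smul W (-1/2) (v - - v) = - v" for v
  proof -
    have "v - - v = smul W 2 v" by (simp add: smul_2)
    then show ?thesis by simp
  qed
  consider "word_deg w - 1 \<noteq> 0" "word_deg w - 1 \<noteq> 1" | "word_deg w = 1" | "word_deg w = 2"
    by linarith
  then show ?thesis
  proof cases
    case 1
    then show ?thesis using graded by (intro graded_part_eq_0)
  next
    case 2
    then obtain x where "w = [Inl x]" by (auto simp: word_deg_1)
    then show ?thesis by (simp add: lin flow_def prod_eq_iff W.multilinear)
  next
    case 3
    then consider h where "w = [Inr h]" | x y where "w = [Inl x, Inl y]" by (auto simp: word_deg_2)
    then show ?thesis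
      unfolding conv_bracket_2_symmetric half
      by cases (simp_all add: lin D2 flow_def prod_eq_iff W.multilinear)
  qed
qed

end

section \<open>Transport of an infinity morphism along a homotopy\<close>

context leibniz2
begin

lemma algebra_laws:
  "l1 V (l2xh V x h) = l2xx V x (l1 V h)"
  "l1 V (l2hx V h x) = l2xx V (l1 V h) x"
  "l2xh V (l1 V h) k = l2hx V h (l1 V k)"
  "l1 V (l3 V x y z) = l2xx V x (l2xx V y z) - l2xx V y (l2xx V x z) - l2xx V (l2xx V x y) z"
  "l3 V x y (l1 V h) = l2xh V x (l2xh V y h) - l2xh V y (l2xh V x h) - l2xh V (l2xx V x y) h"
  "l3 V x (l1 V h) y = l2xh V x (l2hx V h y) - l2hx V h (l2xx V x y) - l2hx V (l2xh V x h) y"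
  "l3 V (l1 V h) x y = l2hx V h (l2xx V x y) - l2xh V x (l2hx V h y) - l2hx V (l2hx V h x) y"
  using algebra by (simp_all add: leibniz2_algebra_def)

text \<open>Rewriting \<open>l\<^sub>1 l\<^sub>2(x, h)\<close> to \<open>l\<^sub>2(x, l\<^sub>1 h)\<close> hides instances of \<open>l\<^sub>2(l\<^sub>1 h, k) = l\<^sub>2(h, l\<^sub>1 k)\<close>; these are the
  resulting consequences.\<close>

lemma algebra_laws_derived:
  "l2xh V (l2xx V x (l1 V h)) k = l2hx V (l2xh V x h) (l1 V k)"
  "l2xh V (l2xx V (l1 V h) x) k = l2hx V (l2hx V h x) (l1 V k)"
  by (simp_all flip: algebra_laws(1,2) add: algebra_laws(3))

end

context leibniz2_pair
begin

text \<open>The unique target of an \<open>\<infinity>\<close>-homotopy \<open>\<rho>\<close> with source \<open>f\<close>.\<close>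

definition transport :: "('a, 'b, 'c, 'd) infmap \<Rightarrow> ('a \<Rightarrow> 'd) \<Rightarrow> ('a, 'b, 'c, 'd) infmap" where
  "transport f \<rho> = \<lparr>f1x = \<lambda>x. f1x f x + l1 W (\<rho> x), f1h = \<lambda>h. f1h f h + \<rho> (l1 V h),
     f2 = \<lambda>x y. f2 f x y + \<rho> (l2xx V x y) - l2xh W (f1x f x) (\<rho> y)
       - l2hx W (\<rho> x) (f1x f y + l1 W (\<rho> y))\<rparr>"

lemma transport_bilinear:
  assumes "bilinear_map (smul0 V) (smul0 V) (smul1 W) (f2 f)"
    and "Vector_Spaces.linear (smul0 V) (smul0 W) (f1x f)" "Vector_Spaces.linear (smul0 V) (smul1 W) \<rho>"
  shows "bilinear_map (smul0 V) (smul0 V) (smul1 W) (f2 (transport f \<rho>))"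
  using V.vector_spaces W.vector_spaces
  by (simp add: bilinear_map_def Vector_Spaces.linear_iff transport_def bilinear_map_simps[OF assms(1)]
      linear_simps[OF assms(2)] linear_simps[OF assms(3)] V.multilinear W.multilinear
      W.s1.scale_right_distrib W.s1.scale_right_diff_distrib algebra_simps)

text \<open>A direct verification. The first four equations express compatibility with \<open>l\<^sub>1\<close>; for the last one
  \<open>l\<^sub>3\<close> is expanded at \<open>f\<^sub>1 + l\<^sub>1 \<rho>\<close>, and the axioms of \<open>W\<close> remove each term containing some \<open>l\<^sub>1 \<rho>\<close>
  from \<open>l\<^sub>3\<close>.\<close>

lemma transport_infinity_morphism:
  assumes f: "infinity_morphism V W f" and \<rho>: "Vector_Spaces.linear (smul0 V) (smul1 W) \<rho>"
  shows "infinity_morphism V W (transport f \<rho>)"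
proof -
  note fm = f[unfolded infinity_morphism_def]
  have lin: "Vector_Spaces.linear (smul0 V) (smul0 W) (f1x f)"
    "Vector_Spaces.linear (smul1 V) (smul1 W) (f1h f)" "bilinear_map (smul0 V) (smul0 V) (smul1 W) (f2 f)"
    using fm by blast+
  have lin': "Vector_Spaces.linear (smul0 V) (smul0 W) (f1x (transport f \<rho>))"
    "Vector_Spaces.linear (smul1 V) (smul1 W) (f1h (transport f \<rho>))"
    using V.vector_spaces W.vector_spaces
    by (simp_all add: Vector_Spaces.linear_iff transport_def linear_simps[OF lin(1)] linear_simps[OF lin(2)]
        linear_simps[OF \<rho>] V.multilinear W.multilinear
        W.s1.scale_right_distrib W.s0.scale_right_distrib algebra_simps)
  have a: "f1x f (l1 V h) = l1 W (f1h f h)" for h using fm by simp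
  have b: "f1x f (l2xx V x y) = l2xx W (f1x f x) (f1x f y) + l1 W (f2 f x y)" for x y
    using fm by simp
  have c: "f1h f (l2xh V x h) = l2xh W (f1x f x) (f1h f h) + f2 f x (l1 V h)"
    "f1h f (l2hx V h x) = l2hx W (f1h f h) (f1x f x) + f2 f (l1 V h) x" for x h
    using fm by simp_all
  have d: "f1h f (l3 V x y z) =
      l3 W (f1x f x) (f1x f y) (f1x f z) - l2hx W (f2 f x y) (f1x f z)
        + l2xh W (f1x f x) (f2 f y z) - l2xh W (f1x f y) (f2 f x z)
       - f2 f (l2xx V x y) z + f2 f x (l2xx V y z) - f2 f y (l2xx V x z)" for x y z
  proof -
    have "l3 W (f1x f x) (f1x f y) (f1x f z) - l2hx W (f2 f x y) (f1x f z)
        + l2xh W (f1x f x) (f2 f y z) - l2xh W (f1x f y) (f2 f x z)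
        = f1h f (l3 V x y z) + f2 f (l2xx V x y) z - f2 f x (l2xx V y z)
          + f2 f y (l2xx V x z)" using fm by blast
    then show ?thesis by (simp add: algebra_simps)
  qed
  note rules = a b c V.algebra_laws W.algebra_laws W.algebra_laws_derived
    linear_simps[OF lin(1)] linear_simps[OF lin(2)] linear_simps[OF \<rho>]
    bilinear_map_simps[OF lin(3)] W.multilinear V.multilinear
  show ?thesis
    unfolding infinity_morphism_def
  proof (intro conjI allI)
    show "l1 W (f1h (transport f \<rho>) h) = f1x (transport f \<rho>) (l1 V h)" for h
      by (simp add: transport_def rules)
    show "l2xx W (f1x (transport f \<rho>) x) (f1x (transport f \<rho>) y) + l1 W (f2 (transport f \<rho>) x y)
        = f1x (transport f \<rho>) (l2xx V x y)" for x y
      by (simp add: transport_def rules algebra_simps)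
    show "l2xh W (f1x (transport f \<rho>) x) (f1h (transport f \<rho>) h)
        = f1h (transport f \<rho>) (l2xh V x h) - f2 (transport f \<rho>) x (l1 V h)" for x h
      by (simp add: transport_def rules algebra_simps)
    show "l2hx W (f1h (transport f \<rho>) h) (f1x (transport f \<rho>) x)
        = f1h (transport f \<rho>) (l2hx V h x) - f2 (transport f \<rho>) (l1 V h) x" for x h
      by (simp add: transport_def rules algebra_simps)
    show "l3 W (f1x (transport f \<rho>) x) (f1x (transport f \<rho>) y) (f1x (transport f \<rho>) z)
        - l2hx W (f2 (transport f \<rho>) x y) (f1x (transport f \<rho>) z)
        + l2xh W (f1x (transport f \<rho>) x) (f2 (transport f \<rho>) y z)
        - l2xh W (f1x (transport f \<rho>) y) (f2 (transport f \<rho>) x z)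
        = f1h (transport f \<rho>) (l3 V x y z) + f2 (transport f \<rho>) (l2xx V x y) z
          - f2 (transport f \<rho>) x (l2xx V y z) + f2 (transport f \<rho>) y (l2xx V x z)" for x y z
      by (simp add: transport_def d rules algebra_simps)
  qed (use lin lin' transport_bilinear[OF lin(3) lin(1) \<rho>] in auto)
qed

lemma homotopy_imp_transport:
  assumes "\<theta> \<in> homotopies V W f g"
  shows "g = transport f \<theta>"
proof -
  have x: "f1x g x = f1x f x + l1 W (\<theta> x)" and h: "f1h g h = f1h f h + \<theta> (l1 V h)"
    and "f2 g x y - f2 f x y = \<theta> (l2xx V x y) - l2xh W (f1x f x) (\<theta> y) - l2hx W (\<theta> x) (f1x g y)"
    for x y h
    using assms by (auto simp: homotopies_def algebra_simps)
  note xy = this(3)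
  have "f2 g x y = f2 f x y + \<theta> (l2xx V x y) - l2xh W (f1x f x) (\<theta> y)
       - l2hx W (\<theta> x) (f1x f y + l1 W (\<theta> y))" for x y
    using xy[of x y] by (simp add: x algebra_simps)
  with x h show ?thesis
    by (cases g) (auto simp: transport_def fun_eq_iff)
qed

lemma transport_homotopy:
  assumes "Vector_Spaces.linear (smul0 V) (smul1 W) \<theta>"
  shows "\<theta> \<in> homotopies V W f (transport f \<theta>)"
  using assms by (simp add: homotopies_def transport_def algebra_simps)

text \<open>Homotopies compose by addition: the quadratic terms of the two sides agree because
  \<open>l\<^sub>2(l\<^sub>1 h, k) = l\<^sub>2(h, l\<^sub>1 k)\<close>.\<close>

lemma transport_transport:
  assumes "Vector_Spaces.linear (smul0 V) (smul1 W) \<theta>" "Vector_Spaces.linear (smul0 V) (smul1 W) \<tau>"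
  shows "transport (transport f \<theta>) \<tau> = transport f (\<lambda>x. \<theta> x + \<tau> x)"
  by (simp add: transport_def fun_eq_iff W.multilinear W.algebra_laws algebra_simps)

end

section \<open>Brackets of forms, evaluated at points\<close>

lemma sum_listset_Cons:
  "(\<Sum>bs\<in>listset (A # As). f bs) = (\<Sum>a\<in>A. \<Sum>bs\<in>listset As. f (a # bs))"
proof -
  have "listset (A # As) = (\<lambda>(a, bs). a # bs) ` (A \<times> listset As)"
    by (auto simp: set_Cons_def)
  moreover have "inj_on (\<lambda>(a, bs). a # bs) (A \<times> listset As)" by (auto simp: inj_on_def)
  ultimately show ?thesis
    by (simp add: sum.reindex sum.cartesian_product case_prod_unfold)
qed

lemma sum_pairing_2:
  assumes "vector_space t"
    and "\<And>G. Vector_Spaces.linear s t (\<lambda>F. B F G)" "\<And>F. Vector_Spaces.linear s t (B F)"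
  shows "(\<Sum>b\<in>Poly_Mapping.keys p. \<Sum>b'\<in>Poly_Mapping.keys q.
      t (\<phi> b * \<psi> b') (B (Poly_Mapping.lookup p b) (Poly_Mapping.lookup q b')))
    = B (pairing s \<phi> p) (pairing s \<psi> q)"
proof -
  interpret vector_space t by fact
  have "(\<Sum>b\<in>Poly_Mapping.keys p. \<Sum>b'\<in>Poly_Mapping.keys q.
      t (\<phi> b * \<psi> b') (B (Poly_Mapping.lookup p b) (Poly_Mapping.lookup q b')))
    = (\<Sum>b\<in>Poly_Mapping.keys p. t (\<phi> b) (B (Poly_Mapping.lookup p b) (pairing s \<psi> q)))"
    by (simp add: pairing_linear[OF assms(3), symmetric] scale_sum_right)
  then show ?thesis by (simp add: pairing_linear[OF assms(2)])
qed

lemma value_at_wedge_2: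
  "scalar_pairing \<phi> (wedge_list [Poly_Mapping.single b 1, Poly_Mapping.single b' (1::'k::field)])
    = scalar_pairing \<phi> (wedge_basis b b')"
proof -
  have "wedge (Poly_Mapping.single b' 1) form_one = Poly_Mapping.single b' (1::'k)"
    by (cases b') (simp add: form_one_def wedge_single)
  then show ?thesis by (simp add: wedge_single)
qed

lemma sum_fun_apply: "(\<Sum>b\<in>B. F b) w = (\<Sum>b\<in>B. F b w)"
  by (induction B rule: infinite_finite_induct) simp_all

context leibniz2_pair
begin

lemmas vs = W.vector_space_conv_smul

lemma lookup_otimes [simp]:
  "Poly_Mapping.lookup (otimes W F \<omega>) b = conv_smul W (Poly_Mapping.lookup \<omega> b) F"
  by (simp add: otimes_def map.rep_eq when_def conv_smul_def fun_eq_iff)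

lemma pairing_otimes:
  fixes F :: "('e, 'f) word \<Rightarrow> 'c \<times> 'd"
  shows "pairing (conv_smul W) \<phi> (otimes W F \<omega>) = conv_smul W (scalar_pairing \<phi> \<omega>) F"
proof -
  interpret c: vector_space "conv_smul W :: _ \<Rightarrow> (('e, 'f) word \<Rightarrow> 'c \<times> 'd) \<Rightarrow> _" by (rule vs)
  have "Poly_Mapping.keys (otimes W F \<omega>) \<subseteq> Poly_Mapping.keys \<omega>"
    by (auto simp: in_keys_iff)
  then show ?thesis
    by (simp add: pairing_superset[OF vs, of "Poly_Mapping.keys \<omega>"] linext_def c.scale_sum_left mult.commute)
qed

lemma conv_smul_apply: "conv_smul W c F w = smul W c (F w)"
  by (simp add: conv_smul_def)

lemma pairing_face:
  "pairing (conv_smul W) \<phi> (face W n i \<alpha>) = pairing (conv_smul W) (\<lambda>b. scalar_pairing \<phi> (form_face n i b)) \<alpha>"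
  by (simp add: face_def pairing_sum[OF vs] pairing_otimes) (simp add: pairing_def)

lemma pairing_tensor_bracket1:
  "pairing (conv_smul W) \<phi> (tensor_bracket1 W D (-1, \<alpha>)) =
    (\<Sum>b\<in>Poly_Mapping.keys \<alpha>. conv_smul W (\<phi> b)
       (conv_bracket1 W D (int (card (snd b)) - 1, Poly_Mapping.lookup \<alpha> b)))
    + pairing (conv_smul W)
       (\<lambda>b. scalar_pairing \<phi> (deRham (Poly_Mapping.single b 1)) * (-1) powi (int (card (snd b)) - 1)) \<alpha>"
proof -
  interpret c: vector_space "conv_smul W :: _ \<Rightarrow> (('a, 'b) word \<Rightarrow> 'c \<times> 'd) \<Rightarrow> _" by (rule vs)
  show ?thesis
    by (simp add: tensor_bracket1_def pairing_sum[OF vs] pairing_add[OF vs] pairing_otimes coeff_at_def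
        sum.distrib add.commute) (simp add: pairing_def)
qed

lemma pairing_tensor_bracket_2:
  "pairing (conv_smul W) \<phi> (tensor_bracket W [(-1, \<alpha>), (-1, \<alpha>)]) w =
    (\<Sum>b\<in>Poly_Mapping.keys \<alpha>. \<Sum>b'\<in>Poly_Mapping.keys \<alpha>.
      smul W (scalar_pairing \<phi> (wedge_basis b b'))
       (smul W ((-1) powi (- (int (card (snd b)) * (int (card (snd b')) - 1))))
         (conv_bracket W [(int (card (snd b)) - 1, Poly_Mapping.lookup \<alpha> b),
           (int (card (snd b')) - 1, Poly_Mapping.lookup \<alpha> b')] w)))"
proof -
  have sum2: "(\<Sum>j<2. \<Sum>i<j. g i * k j) = g 0 * (k (Suc 0) :: int)" for g k
    by (simp add: numeral_2_eq_2 lessThan_Suc)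
  show ?thesis
    unfolding tensor_bracket_def pairing_sum[OF vs]
    by (simp add: sum_listset_Cons pairing_otimes value_at_wedge_2 coeff_at_def sum2 sum_fun_apply conv_smul_apply
        del: wedge_list_simps listset.simps(2))
qed


lemma pairing_tensor_bracket_3:
  "pairing (conv_smul W) \<phi> (tensor_bracket W [(-1, \<alpha>), (-1, \<alpha>), (-1, \<alpha>)]) w =
    (\<Sum>b\<in>Poly_Mapping.keys \<alpha>. \<Sum>b'\<in>Poly_Mapping.keys \<alpha>. \<Sum>b''\<in>Poly_Mapping.keys \<alpha>.
      smul W (scalar_pairing \<phi> (wedge (Poly_Mapping.single b 1)
          (wedge (Poly_Mapping.single b' 1) (wedge (Poly_Mapping.single b'' 1) form_one))))
       (smul W ((-1) powi (- (int (card (snd b)) * (int (card (snd b'')) - 1))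
           - int (card (snd b')) * (int (card (snd b'')) - 1)
           - int (card (snd b)) * (int (card (snd b')) - 1)))
         (conv_bracket W [(int (card (snd b)) - 1, Poly_Mapping.lookup \<alpha> b),
           (int (card (snd b')) - 1, Poly_Mapping.lookup \<alpha> b'),
           (int (card (snd b'')) - 1, Poly_Mapping.lookup \<alpha> b'')] w)))"
proof -
  have sum3: "(\<Sum>j<3. \<Sum>i<j. g i * k j) = g 0 * k (Suc 0) + (g 0 + g (Suc 0)) * (k 2 :: int)" for g k
    by (simp add: numeral_3_eq_3 lessThan_Suc numeral_2_eq_2 algebra_simps)
  show ?thesis
    unfolding tensor_bracket_def pairing_sum[OF vs]
    by (simp add: sum_listset_Cons pairing_otimes coeff_at_def sum3 sum_fun_apply conv_smul_apply
        del: listset.simps(2))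
qed

lemma value_at_nonzero: "value_at s I b \<noteq> 0 \<Longrightarrow> snd b = I"
  by (cases b) (simp add: value_at_apply split: if_splits)

lemma value_tensor_bracket_2_function:
  fixes \<alpha> :: "('a, 'b, 'c, 'd) conv_forms" and s :: "nat \<Rightarrow> 'k"
  defines "a \<equiv> pairing (conv_smul W) (value_at s {}) \<alpha>"
  shows "pairing (conv_smul W) (value_at s {}) (tensor_bracket W [(-1, \<alpha>), (-1, \<alpha>)]) w
    = conv_bracket W [(-1, a), (-1, a)] w"
proof -
  have summand: "smul W (value_at s {} b * value_at s {} b')
       (smul W ((-1) powi (- (int (card (snd b)) * (int (card (snd b')) - 1))))
         (conv_bracket W [(int (card (snd b)) - 1, F), (int (card (snd b')) - 1, G)] w))
    = smul W (value_at s {} b * value_at s {} b') (conv_bracket W [(-1, F), (-1, G)] w)" for b b' F G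
    by (cases "value_at s {} b = 0"; cases "value_at s {} b' = 0")
      (simp_all add: value_at_nonzero[of s "{}" b] value_at_nonzero[of s "{}" b'])
  show ?thesis
    unfolding pairing_tensor_bracket_2 value_at_wedge_basis_function summand a_def
    by (rule sum_pairing_2[OF W.vector_space_smul conv_bracket_2_linear])
qed

lemma value_tensor_bracket_2_one_form:
  fixes \<alpha> :: "('a, 'b, 'c, 'd) conv_forms" and s :: "nat \<Rightarrow> 'k" and i :: nat
  defines "a \<equiv> pairing (conv_smul W) (value_at s {}) \<alpha>" and "r \<equiv> pairing (conv_smul W) (value_at s {i}) \<alpha>"
  shows "pairing (conv_smul W) (value_at s {i}) (tensor_bracket W [(-1, \<alpha>), (-1, \<alpha>)]) w
    = conv_bracket W [(-1, a), (0, r)] w - conv_bracket W [(0, r), (-1, a)] w"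
proof -
  have 1: "smul W (value_at s {} b * value_at s {i} b')
       (smul W ((-1) powi (- (int (card (snd b)) * (int (card (snd b')) - 1))))
         (conv_bracket W [(int (card (snd b)) - 1, F), (int (card (snd b')) - 1, G)] w))
    = smul W (value_at s {} b * value_at s {i} b') (conv_bracket W [(-1, F), (0, G)] w)"
   and 2: "smul W (value_at s {i} b * value_at s {} b')
       (smul W ((-1) powi (- (int (card (snd b)) * (int (card (snd b')) - 1))))
         (conv_bracket W [(int (card (snd b)) - 1, F), (int (card (snd b')) - 1, G)] w))
    = - smul W (value_at s {i} b * value_at s {} b') (conv_bracket W [(0, F), (-1, G)] w)" for b b' F G
    by (cases "value_at s {} b = 0"; cases "value_at s {i} b' = 0";
        simp add: value_at_nonzero[of s "{}" b] value_at_nonzero[of s "{i}" b'])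
      (cases "value_at s {i} b = 0"; cases "value_at s {} b' = 0";
        simp add: value_at_nonzero[of s "{i}" b] value_at_nonzero[of s "{}" b'])
  note lin = sum_pairing_2[OF W.vector_space_smul conv_bracket_2_linear]
  show ?thesis
    unfolding pairing_tensor_bracket_2 value_at_wedge_basis_one_form W.s.scale_left_distrib 1 2
      sum.distrib sum_negf lin a_def r_def by simp
qed

text \<open>The simplices constructed below have this shape: constant coefficients in form degree 1, taking values
  in \<open>W\<^sub>1\<close>, and nothing in higher form degree. Their 1-form part is closed, so the Maurer-Cartan
  equation only has components in form degrees 0 and 1.\<close>

definition constant_one_forms :: "('a, 'b, 'c, 'd) conv_forms \<Rightarrow> bool" where
  "constant_one_forms \<alpha> \<longleftrightarrow> (\<forall>b\<in>Poly_Mapping.keys \<alpha>. snd b = {} \<or>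
     (\<exists>i. b = (0, {i}) \<and> (\<forall>w. fst (Poly_Mapping.lookup \<alpha> b w) = 0)))"

text \<open>A product reaches form degree 2 only if both factors are 1-forms. Their coefficients then have
  values in \<open>W\<^sub>1\<close>, and \<open>m\<^sub>2\<close> vanishes on \<open>W\<^sub>1 \<times> W\<^sub>1\<close>.\<close>

lemma value_tensor_bracket_2_other:
  assumes \<alpha>: "constant_one_forms \<alpha>" and I: "I \<noteq> {}" "\<And>i. I \<noteq> {i}"
  shows "pairing (conv_smul W) (value_at s I) (tensor_bracket W [(-1, \<alpha>), (-1, \<alpha>)]) w = 0"
  unfolding pairing_tensor_bracket_2
proof (intro sum.neutral ballI)
  fix b b' assume b: "b \<in> Poly_Mapping.keys \<alpha>" and b': "b' \<in> Poly_Mapping.keys \<alpha>"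
  show "smul W (scalar_pairing (value_at s I) (wedge_basis b b'))
       (smul W ((-1) powi (- (int (card (snd b)) * (int (card (snd b')) - 1))))
         (conv_bracket W [(int (card (snd b)) - 1, Poly_Mapping.lookup \<alpha> b),
           (int (card (snd b')) - 1, Poly_Mapping.lookup \<alpha> b')] w)) = 0"
  proof (cases "snd b = {} \<or> snd b' = {}")
    case True
    have not_I: "snd c \<noteq> I" if "c \<in> Poly_Mapping.keys \<alpha>" for c
    proof
      assume "snd c = I"
      moreover have "snd c = {} \<or> (\<exists>i. snd c = {i})"
        using \<alpha> that by (auto simp: constant_one_forms_def)
      ultimately obtain i where "I = {} \<or> I = {i}" by auto
      then show False using I(1) I(2)[of i] by simp
    qed
    from True have "snd b \<union> snd b' = snd b' \<or> snd b \<union> snd b' = snd b" by auto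
    then have "snd b \<union> snd b' \<noteq> I" using not_I[OF b] not_I[OF b'] by auto
    then have "scalar_pairing (value_at s I) (wedge_basis b b') = 0"
      by (cases b; cases b') (simp add: value_at_apply)
    then show ?thesis by simp
  next
    case False
    then have "fst (Poly_Mapping.lookup \<alpha> b w) = 0" "fst (Poly_Mapping.lookup \<alpha> b' w) = 0" for w
      using \<alpha> b b' by (auto simp: constant_one_forms_def)
    then have "conv_bracket W [(i, Poly_Mapping.lookup \<alpha> b), (j, Poly_Mapping.lookup \<alpha> b')] w = 0" for i j
      by (simp add: conv_bracket_2 linext_def W.multilinear case_prod_unfold) (simp flip: zero_prod_def)
    then show ?thesis by simp
  qed
qed

lemma value_tensor_bracket_3:
  fixes \<alpha> :: "('a, 'b, 'c, 'd) conv_forms" and s :: "nat \<Rightarrow> 'k"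
  defines "a \<equiv> pairing (conv_smul W) (value_at s {}) \<alpha>"
  assumes \<alpha>: "constant_one_forms \<alpha>"
  shows "pairing (conv_smul W) (value_at s I) (tensor_bracket W [(-1, \<alpha>), (-1, \<alpha>), (-1, \<alpha>)]) w
    = (if I = {} then conv_bracket W [(-1, a), (-1, a), (-1, a)] w else 0)"
proof -
  let ?B = "\<lambda>F G H. conv_bracket W [(-1, F), (-1, G), (-1, H)] w"
  let ?l = "Poly_Mapping.lookup \<alpha>" and ?K = "Poly_Mapping.keys \<alpha>"
  have summand: "smul W (scalar_pairing (value_at s I) (wedge (Poly_Mapping.single b 1)
          (wedge (Poly_Mapping.single b' 1) (wedge (Poly_Mapping.single b'' 1) form_one))))
       (smul W ((-1) powi (- (int (card (snd b)) * (int (card (snd b'')) - 1))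
           - int (card (snd b')) * (int (card (snd b'')) - 1)
           - int (card (snd b)) * (int (card (snd b')) - 1)))
         (conv_bracket W [(int (card (snd b)) - 1, ?l b), (int (card (snd b')) - 1, ?l b'),
           (int (card (snd b'')) - 1, ?l b'')] w))
    = (if I = {} then smul W (value_at s {} b * (value_at s {} b' * value_at s {} b'')) (?B (?l b) (?l b') (?l b'')) else 0)"
    (is "?L = ?R")
    if K: "b \<in> ?K" "b' \<in> ?K" "b'' \<in> ?K" for b b' b''
  proof (cases "snd b = {} \<and> snd b' = {} \<and> snd b'' = {}")
    case True
    then have "is_function (Poly_Mapping.single b (1::'k))" "is_function (Poly_Mapping.single b' (1::'k))"
      "is_function (Poly_Mapping.single b'' (1::'k))"
      by (cases b; cases b'; cases b''; simp add: is_function_def)+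
    with True show ?thesis by (simp add: value_at_wedge_left)
  next
    case False
    then have "value_at s {} b = 0 \<or> value_at s {} b' = 0 \<or> value_at s {} b'' = 0"
      using value_at_nonzero by blast
    then have "?R = 0" by auto
    have degree_0: "\<forall>w. fst (?l c w) = 0" if "c \<in> ?K" "snd c \<noteq> {}" for c
      using \<alpha> that by (auto simp: constant_one_forms_def)
    from False have "(\<forall>w. fst (?l b w) = 0) \<or> (\<forall>w. fst (?l b' w) = 0) \<or> (\<forall>w. fst (?l b'' w) = 0)"
      using degree_0[OF K(1)] degree_0[OF K(2)] degree_0[OF K(3)] by argo
    then have "?L = 0" by (simp add: conv_bracket_3_zero)
    with \<open>?R = 0\<close> show ?thesis by simp
  qed
  have eq: "pairing (conv_smul W) (value_at s I) (tensor_bracket W [(-1, \<alpha>), (-1, \<alpha>), (-1, \<alpha>)]) w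
    = (\<Sum>b\<in>?K. \<Sum>b'\<in>?K. \<Sum>b''\<in>?K. if I = {} then
        smul W (value_at s {} b * (value_at s {} b' * value_at s {} b'')) (?B (?l b) (?l b') (?l b'')) else 0)"
    unfolding pairing_tensor_bracket_3 by (intro sum.cong refl) (rule summand)
  show ?thesis
  proof (cases "I = {}")
    case True
    have "(\<Sum>b\<in>?K. \<Sum>b'\<in>?K. \<Sum>b''\<in>?K.
        smul W (value_at s {} b * (value_at s {} b' * value_at s {} b'')) (?B (?l b) (?l b') (?l b'')))
      = (\<Sum>b\<in>?K. smul W (value_at s {} b) (\<Sum>b'\<in>?K. \<Sum>b''\<in>?K.
        smul W (value_at s {} b' * value_at s {} b'') (?B (?l b) (?l b') (?l b''))))"
      by (simp add: W.s.scale_sum_right)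
    also have "\<dots> = (\<Sum>b\<in>?K. smul W (value_at s {} b) (?B (?l b) a a))"
      unfolding a_def
      by (intro sum.cong refl arg_cong[where f = "smul W _"])
        (rule sum_pairing_2[OF W.vector_space_smul conv_bracket_3_linear(2,3)])
    also have "\<dots> = ?B a a a"
      unfolding a_def by (rule pairing_linear[OF conv_bracket_3_linear(1)])
    finally show ?thesis unfolding eq using True by simp
  qed (simp add: eq)
qed

text \<open>The left-hand side of the Maurer-Cartan equation.\<close>

definition curvature :: "('a, 'b, 'c, 'd) conv_forms \<Rightarrow> ('a, 'b, 'c, 'd) conv_forms" where
  "curvature \<alpha> = (\<Sum>p\<in>{1..3}. Poly_Mapping.map (conv_smul W ((-1) ^ (p * (p - 1) div 2) / fact p))
        (total_bracket W D (replicate p (-1, \<alpha>))))"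

lemma pairing_curvature:
  "pairing (conv_smul W) \<phi> (curvature \<alpha>) w =
    pairing (conv_smul W) \<phi> (tensor_bracket1 W D (-1, \<alpha>)) w
    + smul W (-1/2) (pairing (conv_smul W) \<phi> (tensor_bracket W [(-1, \<alpha>), (-1, \<alpha>)]) w)
    + smul W (-1/6) (pairing (conv_smul W) \<phi> (tensor_bracket W [(-1, \<alpha>), (-1, \<alpha>), (-1, \<alpha>)]) w)"
proof -
  have set: "{1..3} = {1, 2, 3::nat}" by auto
  have "replicate 2 x = [x, x]" "replicate 3 x = [x, x, x]" for x :: "int \<times> ('a, 'b, 'c, 'd) conv_forms"
    by (simp_all add: numeral_2_eq_2 numeral_3_eq_3)
  moreover have "fact 3 = (6::'k)" by (simp add: numeral_3_eq_3)
  ultimately show ?thesis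
    unfolding curvature_def set
    by (simp add: pairing_add[OF vs] pairing_map[OF vs] total_bracket_def conv_smul_apply add.assoc)
qed

lemma value_tensor_bracket1:
  fixes \<alpha> :: "('a, 'b, 'c, 'd) conv_forms" and s :: "nat \<Rightarrow> 'k"
  assumes \<alpha>: "constant_one_forms \<alpha>"
  defines "\<And>I. \<alpha>_at I \<equiv> pairing (conv_smul W) (value_at s I) \<alpha>"
  shows "pairing (conv_smul W) (value_at s I) (tensor_bracket1 W D (-1, \<alpha>)) w
    = conv_bracket1 W D (int (card I) - 1, \<alpha>_at I) w
      - pairing (conv_smul W) (\<lambda>b. scalar_pairing (value_at s I) (deRham (Poly_Mapping.single b 1))) \<alpha> w"
proof -
  interpret c: vector_space "conv_smul W :: _ \<Rightarrow> (('a, 'b) word \<Rightarrow> 'c \<times> 'd) \<Rightarrow> _" by (rule vs)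
  have "(\<Sum>b\<in>Poly_Mapping.keys \<alpha>. conv_smul W (value_at s I b)
       (conv_bracket1 W D (int (card (snd b)) - 1, Poly_Mapping.lookup \<alpha> b)))
    = (\<Sum>b\<in>Poly_Mapping.keys \<alpha>. conv_smul W (value_at s I b)
       (conv_bracket1 W D (int (card I) - 1, Poly_Mapping.lookup \<alpha> b)))"
  proof (intro sum.cong refl)
    fix b
    show "conv_smul W (value_at s I b) (conv_bracket1 W D (int (card (snd b)) - 1, Poly_Mapping.lookup \<alpha> b))
      = conv_smul W (value_at s I b) (conv_bracket1 W D (int (card I) - 1, Poly_Mapping.lookup \<alpha> b))"
      by (cases "value_at s I b = 0") (simp_all add: value_at_nonzero)
  qed
  also have "\<dots> = conv_bracket1 W D (int (card I) - 1, \<alpha>_at I)"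
    unfolding \<alpha>_at_def by (rule pairing_linear[OF conv_bracket1_linear])
  moreover have "pairing (conv_smul W)
       (\<lambda>b. scalar_pairing (value_at s I) (deRham (Poly_Mapping.single b 1)) * (-1) powi (int (card (snd b)) - 1)) \<alpha>
     = pairing (conv_smul W) (\<lambda>b. - scalar_pairing (value_at s I) (deRham (Poly_Mapping.single b 1))) \<alpha>"
    using \<alpha> by (intro pairing_cong) (auto simp: constant_one_forms_def deRham_constant)
  moreover have "pairing (conv_smul W) (\<lambda>b. - \<phi> b) \<alpha> = - pairing (conv_smul W) \<phi> \<alpha>" for \<phi>
    by (simp add: pairing_def sum_negf)
  ultimately show ?thesis by (simp add: pairing_tensor_bracket1)
qed

lemma value_at_other_zero:
  assumes "constant_one_forms \<alpha>" "I \<noteq> {}" "\<And>i. I \<noteq> {i}"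
  shows "pairing (conv_smul W) (value_at s I) \<alpha> = 0"
    and "pairing (conv_smul W) (\<lambda>b. scalar_pairing (value_at s I) (deRham (Poly_Mapping.single b 1))) \<alpha> = 0"
proof -
  interpret c: vector_space "conv_smul W :: _ \<Rightarrow> (('a, 'b) word \<Rightarrow> 'c \<times> 'd) \<Rightarrow> _" by (rule vs)
  have "value_at s I b = 0" "scalar_pairing (value_at s I) (deRham (Poly_Mapping.single b 1)) = 0"
    if "b \<in> Poly_Mapping.keys \<alpha>" for b
  proof -
    have "snd b = {} \<or> (\<exists>i. b = (0, {i}))"
      using assms(1) that by (auto simp: constant_one_forms_def)
    then have "(\<exists>m. b = (m, {})) \<or> (\<exists>i. b = (0, {i}))" by (cases b) simp
    then obtain m i where "b = (m, {}) \<or> b = (0, {i})" by blast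
    moreover have ne: "({} = I) = False" "({j} = I) = False" "(I = {j}) = False" for j
      using assms(2,3) by blast+
    have "value_at s I (m, {}) = 0" "value_at s I (0, {i}) = 0"
      by (simp_all only: value_at_apply ne if_False)
    moreover have "scalar_pairing (value_at s I) (deRham (Poly_Mapping.single (m, {}) 1)) = 0"
      by (simp only: value_at_deRham_single ne if_False sum.neutral_const)
    ultimately show "value_at s I b = 0"
      "scalar_pairing (value_at s I) (deRham (Poly_Mapping.single b 1)) = 0"
      by (auto simp only: deRham_constant linext_zero)
  qed
  then show "pairing (conv_smul W) (value_at s I) \<alpha> = 0"
    "pairing (conv_smul W) (\<lambda>b. scalar_pairing (value_at s I) (deRham (Poly_Mapping.single b 1))) \<alpha> = 0"
    by (simp_all add: pairing_def)
qed

text \<open>The Maurer-Cartan equation tested at each point: the functions must give a family \<open>f s\<close> of morphisms, and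
  this family must flow along the 1-form.\<close>

lemma curvature_zero:
  assumes \<alpha>: "constant_one_forms \<alpha>"
    and a: "\<And>s. pairing (conv_smul W) (value_at s {}) \<alpha> = conv_of_morphism (f s)"
    and f: "\<And>s. infinity_morphism V W (f s)"
    and r: "\<And>s i. pairing (conv_smul W) (value_at s {i}) \<alpha> = homotopy_form (\<rho> i)"
    and \<rho>: "\<And>i. Vector_Spaces.linear (smul0 V) (smul1 W) (\<rho> i)"
    and da: "\<And>s i. pairing (conv_smul W)
      (\<lambda>b. scalar_pairing (value_at s {i}) (deRham (Poly_Mapping.single b 1))) \<alpha>
      = conv_of_morphism (flow (f s) (\<rho> i))"
  shows "curvature \<alpha> = 0"
proof (rule eqI_values[OF vs])
  fix s :: "nat \<Rightarrow> 'k" and I :: "nat set"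
  have "pairing (conv_smul W) (value_at s I) (curvature \<alpha>) w = 0" for w
  proof -
    consider "I = {}" | i where "I = {i}" | "I \<noteq> {}" "\<And>i. I \<noteq> {i}" by blast
    then show ?thesis
    proof cases
      case 1
      have "pairing (conv_smul W) (\<lambda>b. scalar_pairing (value_at s {}) (deRham (Poly_Mapping.single b 1))) \<alpha> = 0"
      proof -
        interpret c: vector_space "conv_smul W :: _ \<Rightarrow> (('a, 'b) word \<Rightarrow> 'c \<times> 'd) \<Rightarrow> _" by (rule vs)
        have "scalar_pairing (value_at s {}) (deRham (Poly_Mapping.single b 1)) = 0"
          if "b \<in> Poly_Mapping.keys \<alpha>" for b
          using that \<alpha> by (cases b) (auto simp: constant_one_forms_def value_at_deRham_single deRham_constant)
        then show ?thesis by (simp add: pairing_def)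
      qed
      then show ?thesis
        using morphism_curvature_zero[OF f[of s], of w]
        unfolding pairing_curvature 1 value_tensor_bracket1[OF \<alpha>] value_tensor_bracket_2_function
          value_tensor_bracket_3[OF \<alpha>] a by simp
    next
      case (2 i)
      have "Vector_Spaces.linear (smul0 V) (smul0 W) (f1x (f s))"
        using f[of s] by (simp add: infinity_morphism_def)
      from homotopy_flow[OF this \<rho>[of i], of w] show ?thesis
        unfolding pairing_curvature 2 value_tensor_bracket1[OF \<alpha>] value_tensor_bracket_2_one_form
          value_tensor_bracket_3[OF \<alpha>] a r da by simp
    next
      case 3
      have "conv_bracket1 W D (k, 0) w = 0" for k
        using linear_simps(3)[OF conv_bracket1_linear] by simp
      with 3 show ?thesis
        unfolding pairing_curvature value_tensor_bracket1[OF \<alpha>] value_tensor_bracket_2_other[OF \<alpha> 3]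
          value_tensor_bracket_3[OF \<alpha>] value_at_other_zero[OF \<alpha> 3] by simp
    qed
  qed
  then show "pairing (conv_smul W) (value_at s I) (curvature \<alpha>) = pairing (conv_smul W) (value_at s I) 0"
    by (simp add: fun_eq_iff)
qed

section \<open>The simplex spanned by two homotopies\<close>

lemma conv_smul_simps [simp]: "conv_smul W 0 F = 0" "conv_smul W 1 F = F" "conv_smul W c 0 = 0"
  by (simp_all add: conv_smul_def fun_eq_iff)

text \<open>The second order term of \<open>transport\<close>, which is quadratic in the homotopy.\<close>

definition quadratic_flow :: "('a \<Rightarrow> 'd) \<Rightarrow> ('a \<Rightarrow> 'd) \<Rightarrow> ('a, 'b) word \<Rightarrow> 'c \<times> 'd" where
  "quadratic_flow \<rho> \<sigma> = conv_of_morphism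
     \<lparr>f1x = \<lambda>_. 0, f1h = \<lambda>_. 0, f2 = \<lambda>x y. - l2hx W (\<rho> x) (l1 W (\<sigma> y))\<rparr>"

abbreviation basis_form :: "(nat \<Rightarrow>\<^sub>0 nat) \<Rightarrow> nat set \<Rightarrow> form_basis \<Rightarrow>\<^sub>0 'k" where
  "basis_form m I \<equiv> Poly_Mapping.single (m, I) 1"

text \<open>The family \<open>transport f (t\<^sub>1 \<rho> + t\<^sub>2 \<sigma>)\<close> expanded in monomials, together with the 1-form
  \<open>\<rho> dt\<^sub>1 + \<sigma> dt\<^sub>2\<close>. As a 2-simplex it has the vertices \<open>f\<close>, \<open>transport f \<rho>\<close> and
  \<open>transport f \<sigma>\<close>. With \<open>\<sigma> = 0\<close> the variable \<open>t\<^sub>2\<close> disappears and a 1-simplex remains.\<close>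

definition simplex ::
  "('a, 'b, 'c, 'd) infmap \<Rightarrow> ('a \<Rightarrow> 'd) \<Rightarrow> ('a \<Rightarrow> 'd) \<Rightarrow> ('a, 'b, 'c, 'd) conv_forms" where
  "simplex f \<rho> \<sigma> =
     otimes W (conv_of_morphism f) (basis_form 0 {})
     + otimes W (conv_of_morphism (flow f \<rho>)) (basis_form (Poly_Mapping.single 1 1) {})
     + otimes W (conv_of_morphism (flow f \<sigma>)) (basis_form (Poly_Mapping.single 2 1) {})
     + otimes W (quadratic_flow \<rho> \<rho>) (basis_form (Poly_Mapping.single 1 2) {})
     + otimes W (quadratic_flow \<rho> \<sigma> + quadratic_flow \<sigma> \<rho>)
         (basis_form (Poly_Mapping.single 1 1 + Poly_Mapping.single 2 1) {})
     + otimes W (quadratic_flow \<sigma> \<sigma>) (basis_form (Poly_Mapping.single 2 2) {})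
     + otimes W (homotopy_form \<rho>) (basis_form 0 {1})
     + otimes W (homotopy_form \<sigma>) (basis_form 0 {2})"

lemma pairing_simplex:
  "pairing (conv_smul W) \<phi> (simplex f \<rho> \<sigma>) =
     conv_smul W (\<phi> (0, {})) (conv_of_morphism f)
     + conv_smul W (\<phi> (Poly_Mapping.single 1 1, {})) (conv_of_morphism (flow f \<rho>))
     + conv_smul W (\<phi> (Poly_Mapping.single 2 1, {})) (conv_of_morphism (flow f \<sigma>))
     + conv_smul W (\<phi> (Poly_Mapping.single 1 2, {})) (quadratic_flow \<rho> \<rho>)
     + conv_smul W (\<phi> (Poly_Mapping.single 1 1 + Poly_Mapping.single 2 1, {}))
         (quadratic_flow \<rho> \<sigma> + quadratic_flow \<sigma> \<rho>)
     + conv_smul W (\<phi> (Poly_Mapping.single 2 2, {})) (quadratic_flow \<sigma> \<sigma>)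
     + conv_smul W (\<phi> (0, {1})) (homotopy_form \<rho>)
     + conv_smul W (\<phi> (0, {2})) (homotopy_form \<sigma>)"
  by (simp add: simplex_def pairing_add[OF vs] pairing_otimes)

abbreviation combination :: "'k \<Rightarrow> ('a \<Rightarrow> 'd) \<Rightarrow> 'k \<Rightarrow> ('a \<Rightarrow> 'd) \<Rightarrow> 'a \<Rightarrow> 'd" where
  "combination c \<rho> d \<sigma> \<equiv> \<lambda>x. smul1 W c (\<rho> x) + smul1 W d (\<sigma> x)"

text \<open>All functionals needed below either evaluate functions at some point \<open>p\<close> or vanish on
  functions; the condition \<open>c\<close> distinguishes the two cases.\<close>

lemma simplex_pairing:
  assumes "\<And>m. \<phi> (m, {}) = (if c then monom_val p m else 0)"
  shows "pairing (conv_smul W) \<phi> (simplex f \<rho> \<sigma>) =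
    (if c then conv_of_morphism (transport f (combination (p 1) \<rho> (p 2) \<sigma>)) else 0)
    + conv_smul W (\<phi> (0, {1})) (homotopy_form \<rho>) + conv_smul W (\<phi> (0, {2})) (homotopy_form \<sigma>)"
proof (cases c)
  case True
  have "(conv_of_morphism f + conv_smul W (p 1) (conv_of_morphism (flow f \<rho>))
     + conv_smul W (p 2) (conv_of_morphism (flow f \<sigma>))
     + conv_smul W (p 1 ^ 2) (quadratic_flow \<rho> \<rho>)
     + conv_smul W (p 1 * p 2) (quadratic_flow \<rho> \<sigma> + quadratic_flow \<sigma> \<rho>)
     + conv_smul W (p 2 ^ 2) (quadratic_flow \<sigma> \<sigma>)) w
    = conv_of_morphism (transport f (combination (p 1) \<rho> (p 2) \<sigma>)) w" for w
    by (cases "(f, w)" rule: conv_of_morphism.cases)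
      (simp_all add: conv_smul_apply flow_def quadratic_flow_def transport_def prod_eq_iff W.multilinear
        W.s0.scale_right_distrib W.s1.scale_right_distrib W.s1.scale_right_diff_distrib
        power2_eq_square algebra_simps)
  then have "conv_of_morphism f + conv_smul W (p 1) (conv_of_morphism (flow f \<rho>))
     + conv_smul W (p 2) (conv_of_morphism (flow f \<sigma>))
     + conv_smul W (p 1 ^ 2) (quadratic_flow \<rho> \<rho>)
     + conv_smul W (p 1 * p 2) (quadratic_flow \<rho> \<sigma> + quadratic_flow \<sigma> \<rho>)
     + conv_smul W (p 2 ^ 2) (quadratic_flow \<sigma> \<sigma>)
    = conv_of_morphism (transport f (combination (p 1) \<rho> (p 2) \<sigma>))" by blast
  then show ?thesis
    using True by (simp add: pairing_simplex assms monom_val_add)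
qed (simp add: pairing_simplex assms)

lemma linear_combination:
  assumes "Vector_Spaces.linear (smul0 V) (smul1 W) \<rho>" "Vector_Spaces.linear (smul0 V) (smul1 W) \<sigma>"
  shows "Vector_Spaces.linear (smul0 V) (smul1 W) (combination c \<rho> d \<sigma>)"
  using V.vector_spaces W.vector_spaces
  by (simp add: Vector_Spaces.linear_iff linear_simps[OF assms(1)] linear_simps[OF assms(2)]
      W.s1.scale_right_distrib mult.commute)

lemma homotopy_form_zero: "homotopy_form (\<lambda>_. 0) = (0 :: ('a, 'b) word \<Rightarrow> 'c \<times> 'd)"
proof
  fix w show "homotopy_form (\<lambda>_. 0) w = (0 :: ('a, 'b) word \<Rightarrow> 'c \<times> 'd) w"
    by (cases "(\<lambda>_::'a. 0 :: 'd, w)" rule: homotopy_form.cases) (simp_all add: prod_eq_iff)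
qed

text \<open>The partial derivatives of the family are its flow: differentiating the quadratic term gives
  \<open>- l\<^sub>2(\<rho> x, l\<^sub>1 \<sigma> y) - l\<^sub>2(\<sigma> x, l\<^sub>1 \<rho> y)\<close>, and one of the two summands becomes a value of
  \<open>l\<^sub>2\<close> on \<open>W\<^sub>0 \<times> W\<^sub>1\<close> by \<open>l\<^sub>2(l\<^sub>1 h, k) = l\<^sub>2(h, l\<^sub>1 k)\<close>.\<close>

lemma simplex_derivative:
  "pairing (conv_smul W)
      (\<lambda>b. scalar_pairing (value_at s {i}) (deRham (Poly_Mapping.single b 1))) (simplex f \<rho> \<sigma>)
    = conv_of_morphism (flow (transport f (combination (s 1) \<rho> (s 2) \<sigma>)) (if i = 1 then \<rho> else if i = 2 then \<sigma> else (\<lambda>_. 0)))" (is "?P = ?Q")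
proof
  fix w
  have keys: "Poly_Mapping.keys (Poly_Mapping.single (Suc 0) (Suc 0) + Poly_Mapping.single 2 (Suc 0)) = {Suc 0, 2}"
    by (auto simp: in_keys_iff lookup_add lookup_single when_def split: if_splits)
  have diff: "Poly_Mapping.single (Suc 0) (Suc 0) + Poly_Mapping.single 2 (Suc 0) - Poly_Mapping.single 2 (Suc 0)
      = Poly_Mapping.single (Suc 0) (Suc 0)"
    "Poly_Mapping.single (Suc 0) (Suc 0) + Poly_Mapping.single 2 (Suc 0) - Poly_Mapping.single (Suc 0) (Suc 0)
      = Poly_Mapping.single 2 (Suc 0)"
    by simp_all
  have double: "smul1 W (2 * c) v = smul1 W c v + smul1 W c v" for c v
    by (simp only: mult_2 W.s1.scale_left_distrib)
  show "?P w = ?Q w"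
    by (cases "(f, w)" rule: conv_of_morphism.cases)
      (simp_all add: pairing_simplex value_at_deRham_single deRham_constant keys diff lookup_add lookup_single
        single_diff[symmetric] double
        conv_smul_apply flow_def quadratic_flow_def transport_def prod_eq_iff W.multilinear W.algebra_laws
        W.s0.scale_right_distrib W.s1.scale_right_distrib W.s1.scale_right_diff_distrib algebra_simps)
qed

lemma keys_otimes_single: "Poly_Mapping.keys (otimes W F (Poly_Mapping.single b c)) \<subseteq> {b}"
  by (auto simp: in_keys_iff lookup_single when_def split: if_splits)

lemma keys_simplex:
  "Poly_Mapping.keys (simplex f \<rho> \<sigma>) \<subseteq>
    {(0, {}), (Poly_Mapping.single 1 1, {}), (Poly_Mapping.single 2 1, {}), (Poly_Mapping.single 1 2, {}),
     (Poly_Mapping.single 1 1 + Poly_Mapping.single 2 1, {}), (Poly_Mapping.single 2 2, {}), (0, {1}), (0, {2})}"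
  unfolding simplex_def
  by (intro order.trans[OF keys_add] Un_least order.trans[OF keys_otimes_single]) auto

lemma constant_one_forms_simplex: "constant_one_forms (simplex f \<rho> \<sigma>)"
proof -
  have "fst (homotopy_form \<rho> w :: 'c \<times> 'd) = 0" for \<rho> and w :: "('a, 'b) word"
    by (cases "(\<rho>, w)" rule: homotopy_form.cases) simp_all
  then have "fst (Poly_Mapping.lookup (simplex f \<rho> \<sigma>) (0, {i}) w) = 0" for i w
    by (simp add: simplex_def lookup_add lookup_single when_def conv_smul_apply)
  then show ?thesis
    using keys_simplex[of f \<rho> \<sigma>] unfolding constant_one_forms_def by auto
qed

lemma curvature_simplex:
  assumes f: "infinity_morphism V W f" and \<rho>: "Vector_Spaces.linear (smul0 V) (smul1 W) \<rho>"
    and \<sigma>: "Vector_Spaces.linear (smul0 V) (smul1 W) \<sigma>"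
  shows "curvature (simplex f \<rho> \<sigma>) = 0"
proof (rule curvature_zero[OF constant_one_forms_simplex])
  define \<rho>s where "\<rho>s i = (if i = 1 then \<rho> else if i = 2 then \<sigma> else (\<lambda>_. 0))" for i :: nat
  show "pairing (conv_smul W) (value_at s {}) (simplex f \<rho> \<sigma>)
      = conv_of_morphism (transport f (combination (s 1) \<rho> (s 2) \<sigma>))" for s
    by (subst simplex_pairing[of _ True s]) (simp_all add: value_at_apply)
  show "infinity_morphism V W (transport f (combination (s 1) \<rho> (s 2) \<sigma>))" for s
    by (intro transport_infinity_morphism f linear_combination \<rho> \<sigma>)
  show "pairing (conv_smul W) (value_at s {i}) (simplex f \<rho> \<sigma>) = homotopy_form (\<rho>s i)" for s i
    by (subst simplex_pairing[of _ False s]) (simp_all add: value_at_apply \<rho>s_def homotopy_form_zero)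
  show "Vector_Spaces.linear (smul0 V) (smul1 W) (\<rho>s i)" for i
    using \<rho> \<sigma> by (simp add: \<rho>s_def Vector_Spaces.linear_iff)
  show "pairing (conv_smul W)
      (\<lambda>b. scalar_pairing (value_at s {i}) (deRham (Poly_Mapping.single b 1))) (simplex f \<rho> \<sigma>)
    = conv_of_morphism (flow (transport f (combination (s 1) \<rho> (s 2) \<sigma>)) (\<rho>s i))" for s i
    unfolding \<rho>s_def by (rule simplex_derivative)
qed


lemma letterwise_linearI:
  assumes "\<And>u v c x y. F (u @ Inl (smul0 V c x + y) # v) = smul W c (F (u @ Inl x # v)) + F (u @ Inl y # v)"
    and "\<And>u v c h k. F (u @ Inr (smul1 V c h + k) # v) = smul W c (F (u @ Inr h # v)) + F (u @ Inr k # v)"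
  shows "letterwise_linear V (smul W) word_slots F"
  using assms by (auto simp: letterwise_linear_def word_slots_def)

lemma conv_of_morphism_long: "2 < length w \<Longrightarrow> conv_of_morphism f w = 0"
  by (cases "(f, w)" rule: conv_of_morphism.cases) auto

lemma conv_of_morphism_in_conv:
  assumes lin: "Vector_Spaces.linear (smul0 V) (smul0 W) (f1x f)" "Vector_Spaces.linear (smul1 V) (smul1 W) (f1h f)"
    and bil: "bilinear_map (smul0 V) (smul0 V) (smul1 W) (f2 f)"
  shows "conv_of_morphism f \<in> conv V W (-1)"
proof -
  note rules = linear_simps[OF lin(1)] linear_simps[OF lin(2)] bilinear_map_simps[OF bil] prod_eq_iff
  have "letterwise_linear V (smul W) word_slots (conv_of_morphism f)"
  proof (rule letterwise_linearI)
    fix u v :: "('a, 'b) word"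
    consider "u = []" "v = []" | z where "u = [Inl z]" "v = []" | h where "u = [Inr h]" "v = []"
      | z where "u = []" "v = [Inl z]" | h where "u = []" "v = [Inr h]" | "2 \<le> length u + length v"
      by (cases u; cases v; cases "hd u"; cases "hd v") (auto simp: Suc_le_eq)
    note cases = this
    show "conv_of_morphism f (u @ Inl (smul0 V c x + y) # v)
      = smul W c (conv_of_morphism f (u @ Inl x # v)) + conv_of_morphism f (u @ Inl y # v)" for c x y
      by (cases rule: cases) (auto simp: rules conv_of_morphism_long)
    show "conv_of_morphism f (u @ Inr (smul1 V c h + k) # v)
      = smul W c (conv_of_morphism f (u @ Inr h # v)) + conv_of_morphism f (u @ Inr k # v)" for c h k
      by (cases rule: cases) (auto simp: rules conv_of_morphism_long)
  qed
  then show ?thesis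
    using homogeneous_conv_of_morphism[of f] by (simp add: conv_def homogeneous_def)
qed

lemma homotopy_form_in_conv:
  assumes lin: "Vector_Spaces.linear (smul0 V) (smul1 W) \<rho>"
  shows "homotopy_form \<rho> \<in> conv V W 0"
proof -
  have long: "u \<noteq> [] \<or> v \<noteq> [] \<Longrightarrow> homotopy_form \<rho> (u @ l # v) = (0 :: 'c \<times> 'd)" for u v :: "('a, 'b) word" and l
    by (cases "(\<rho>, u @ l # v)" rule: homotopy_form.cases) (auto simp: append_eq_Cons_conv)
  have "letterwise_linear V (smul W) word_slots (homotopy_form \<rho>)"
  proof (rule letterwise_linearI)
    fix u v :: "('a, 'b) word"
    show "homotopy_form \<rho> (u @ Inl (smul0 V c x + y) # v)
      = smul W c (homotopy_form \<rho> (u @ Inl x # v)) + homotopy_form \<rho> (u @ Inl y # v)" for c x y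
      by (cases "u = [] \<and> v = []") (auto simp: long linear_simps[OF lin] prod_eq_iff)
    show "homotopy_form \<rho> (u @ Inr (smul1 V c h + k) # v)
      = smul W c (homotopy_form \<rho> (u @ Inr h # v)) + homotopy_form \<rho> (u @ Inr k # v)" for c h k
      by (cases "u = [] \<and> v = []") (auto simp: long prod_eq_iff)
  qed
  then show ?thesis
    using homogeneous_homotopy_form[of \<rho>] by (simp add: conv_def homogeneous_def)
qed

definition coefficients_in :: "nat \<Rightarrow> ('a, 'b, 'c, 'd) conv_forms \<Rightarrow> bool" where
  "coefficients_in n \<alpha> \<longleftrightarrow> Poly_Mapping.keys \<alpha> \<subseteq> forms_on n \<and>
     (\<forall>b\<in>Poly_Mapping.keys \<alpha>. Poly_Mapping.lookup \<alpha> b \<in> conv V W (int (card (snd b)) - 1))"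

lemma MC_eq: "MC V W D n = {\<alpha>. coefficients_in n \<alpha> \<and> curvature \<alpha> = 0}"
  by (auto simp: MC_def coefficients_in_def curvature_def)

lemma conv_zero: "0 \<in> conv V W k"
  by (simp add: conv_def letterwise_linear_def graded_part_def)

lemma conv_add: "F \<in> conv V W k \<Longrightarrow> G \<in> conv V W k \<Longrightarrow> F + G \<in> conv V W k"
  by (auto simp: conv_def letterwise_linear_def W.s.scale_right_distrib algebra_simps intro: W.graded_part_add)

lemma coefficients_in_add:
  assumes "coefficients_in n \<alpha>" "coefficients_in n \<beta>" shows "coefficients_in n (\<alpha> + \<beta>)"
proof -
  have "Poly_Mapping.lookup \<gamma> b \<in> conv V W (int (card (snd b)) - 1)" if "\<gamma> = \<alpha> \<or> \<gamma> = \<beta>" for \<gamma> b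
    using that assms conv_zero by (cases "b \<in> Poly_Mapping.keys \<gamma>") (auto simp: coefficients_in_def in_keys_iff)
  then show ?thesis
    using assms keys_add[of \<alpha> \<beta>] unfolding coefficients_in_def
    by (auto simp: lookup_add intro!: conv_add)
qed

lemma coefficients_in_otimes:
  assumes "F = 0 \<or> (m, I) \<in> forms_on n \<and> F \<in> conv V W (int (card I) - 1)"
  shows "coefficients_in n (otimes W F (Poly_Mapping.single (m, I) 1))"
  using assms by (auto simp: coefficients_in_def in_keys_iff lookup_single when_def split: if_splits)

lemma flow_in_conv:
  assumes f: "infinity_morphism V W f" and \<rho>: "Vector_Spaces.linear (smul0 V) (smul1 W) \<rho>"
    and \<sigma>: "Vector_Spaces.linear (smul0 V) (smul1 W) \<sigma>"
  shows "conv_of_morphism f \<in> conv V W (-1)" "conv_of_morphism (flow f \<rho>) \<in> conv V W (-1)"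
    "quadratic_flow \<rho> \<sigma> \<in> conv V W (-1)"
proof -
  have lin: "Vector_Spaces.linear (smul0 V) (smul0 W) (f1x f)" using f by (simp add: infinity_morphism_def)
  note rules = Vector_Spaces.linear_iff bilinear_map_def flow_def V.vector_spaces W.vector_spaces
      linear_simps[OF lin] linear_simps[OF \<rho>] linear_simps[OF \<sigma>] V.multilinear W.multilinear
      W.s1.scale_right_distrib W.s1.scale_right_diff_distrib
  show "conv_of_morphism f \<in> conv V W (-1)"
    using f by (intro conv_of_morphism_in_conv) (auto simp: infinity_morphism_def)
  show "conv_of_morphism (flow f \<rho>) \<in> conv V W (-1)"
    by (rule conv_of_morphism_in_conv) (simp_all add: rules algebra_simps)
  show "quadratic_flow \<rho> \<sigma> \<in> conv V W (-1)"
    unfolding quadratic_flow_def by (rule conv_of_morphism_in_conv) (simp_all add: rules algebra_simps)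
qed

lemma flow_zero: "conv_of_morphism (flow f (\<lambda>_. 0)) = 0"
  "quadratic_flow (\<lambda>_. 0) \<rho> = 0" "quadratic_flow \<rho> (\<lambda>_. 0) = 0"
proof -
  have "conv_of_morphism (flow f (\<lambda>_. 0)) w = 0" "quadratic_flow (\<lambda>_. 0) \<rho> w = 0"
    "quadratic_flow \<rho> (\<lambda>_. 0) w = 0" for w
    by (cases "(f, w)" rule: conv_of_morphism.cases;
        simp add: flow_def quadratic_flow_def W.multilinear prod_eq_iff)+
  then show "conv_of_morphism (flow f (\<lambda>_. 0)) = 0"
    "quadratic_flow (\<lambda>_. 0) \<rho> = 0" "quadratic_flow \<rho> (\<lambda>_. 0) = 0"
    by (simp_all add: fun_eq_iff)
qed

lemma simplex_in_MC:
  assumes f: "infinity_morphism V W f" and \<rho>: "Vector_Spaces.linear (smul0 V) (smul1 W) \<rho>"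
    and \<sigma>: "Vector_Spaces.linear (smul0 V) (smul1 W) \<sigma>"
  shows "simplex f \<rho> \<sigma> \<in> MC V W D 2"
    and "simplex f \<rho> (\<lambda>_. 0) \<in> MC V W D 1"
proof -
  have zero: "Vector_Spaces.linear (smul0 V) (smul1 W) (\<lambda>_. 0)"
    using V.vector_spaces W.vector_spaces by (simp add: Vector_Spaces.linear_iff)
  note conv = flow_in_conv[OF f \<rho> \<sigma>] flow_in_conv[OF f \<rho> \<rho>] flow_in_conv[OF f \<sigma> \<rho>] flow_in_conv[OF f \<sigma> \<sigma>]
    homotopy_form_in_conv[OF \<rho>] homotopy_form_in_conv[OF \<sigma>]
  have "(m, I) \<in> forms_on n \<longleftrightarrow> Poly_Mapping.keys m \<subseteq> {1..n} \<and> I \<subseteq> {1..n}" for m I n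
    by (simp add: forms_on_def)
  moreover have "Poly_Mapping.keys (Poly_Mapping.single 1 1 + Poly_Mapping.single 2 (1::nat)) \<subseteq> {1, 2::nat}"
    using keys_add[of "Poly_Mapping.single (1::nat) 1" "Poly_Mapping.single 2 (1::nat)"] by simp blast
  moreover have "{1..2} = {1, 2::nat}" by auto
  ultimately have "coefficients_in 2 (simplex f \<rho> \<sigma>)" "coefficients_in 1 (simplex f \<rho> (\<lambda>_. 0))"
    unfolding simplex_def
    by (intro coefficients_in_add coefficients_in_otimes;
        simp add: conv conv_add flow_zero homotopy_form_zero)+
  then show "simplex f \<rho> \<sigma> \<in> MC V W D 2" "simplex f \<rho> (\<lambda>_. 0) \<in> MC V W D 1"
    using curvature_simplex[OF f \<rho> \<sigma>] curvature_simplex[OF f \<rho> zero] by (simp_all add: MC_eq)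
qed

section \<open>Edges, integrals and the vertical composite\<close>

lemma eval1_eq_value:
  assumes "Poly_Mapping.keys \<alpha> \<subseteq> forms_on 1"
  shows "eval1 W c \<alpha> = pairing (conv_smul W) (value_at (\<lambda>_. c) {}) \<alpha>"
proof -
  let ?K = "{k. (t_pow k, {}) \<in> Poly_Mapping.keys \<alpha>}"
  have "{m. (m, {}) \<in> Poly_Mapping.keys \<alpha>} = t_pow ` ?K"
  proof -
    have "m = t_pow (Poly_Mapping.lookup m 1)" if "(m, {}) \<in> Poly_Mapping.keys \<alpha>" for m
    proof (rule poly_mapping_eqI)
      fix j
      have "Poly_Mapping.keys m \<subseteq> {1}" using that assms by (auto simp: forms_on_def)
      then show "Poly_Mapping.lookup m j = Poly_Mapping.lookup (t_pow (Poly_Mapping.lookup m 1)) j"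
        by (cases "j = 1") (auto simp: t_pow_def lookup_single in_keys_iff)
    qed
    then show ?thesis by force
  qed
  moreover have "inj_on t_pow ?K" by (simp add: inj_on_def)
  moreover have "monom_val (\<lambda>_. c) (t_pow k) = c ^ k" for k by (simp add: t_pow_def)
  ultimately show ?thesis
    by (simp add: pairing_value_at[OF vs] eval1_def sum.reindex)
qed

lemma simplex_in_inf_homotopies:
  assumes f: "infinity_morphism V W f" and \<rho>: "Vector_Spaces.linear (smul0 V) (smul1 W) \<rho>"
  shows "simplex f \<rho> (\<lambda>_. 0) \<in> inf_homotopies V W D f (transport f \<rho>)"
proof -
  have MC: "simplex f \<rho> (\<lambda>_. 0) \<in> MC V W D 1" using simplex_in_MC(2)[OF f \<rho> \<rho>] .
  then have keys: "Poly_Mapping.keys (simplex f \<rho> (\<lambda>_. 0)) \<subseteq> forms_on 1" by (simp add: MC_def)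
  have "eval1 W c (simplex f \<rho> (\<lambda>_. 0)) = conv_of_morphism (transport f (\<lambda>x. smul1 W c (\<rho> x)))" for c
    unfolding eval1_eq_value[OF keys]
    by (subst simplex_pairing[of _ True "\<lambda>_. c"]) (simp_all add: value_at_apply)
  moreover have "transport f (\<lambda>_. 0) = f"
    by (cases f) (simp add: transport_def W.multilinear)
  ultimately show ?thesis using MC by (simp add: inf_homotopies_def)
qed

text \<open>The base point \<open>i\<close> of the primitive cancels in the difference of its values at 1 and 0.\<close>

lemma S1_eq_pairing:
  fixes \<alpha> :: "('a, 'b, 'c, 'd) conv_forms"
  shows "S1 W i \<alpha> x = snd (pairing (conv_smul W) edge_integral \<alpha> [Inl x])"
proof -
  let ?K = "{k. (t_pow k, {1}) \<in> Poly_Mapping.keys \<alpha>}"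
  interpret c: vector_space "conv_smul W :: _ \<Rightarrow> (('a, 'b) word \<Rightarrow> 'c \<times> 'd) \<Rightarrow> _" by (rule vs)
  have inj: "inj_on (\<lambda>k. (t_pow k, {1::nat})) ?K" by (simp add: inj_on_def)
  have "pairing (conv_smul W) edge_integral \<alpha>
      = (\<Sum>b\<in>(\<lambda>k. (t_pow k, {1})) ` ?K. conv_smul W (edge_integral b) (Poly_Mapping.lookup \<alpha> b))"
    unfolding pairing_def
    by (rule sum.mono_neutral_right) (auto simp: edge_integral_def)
  also have "\<dots> = (\<Sum>k\<in>?K. conv_smul W (1 / of_nat (k + 1)) (Poly_Mapping.lookup \<alpha> (t_pow k, {1})))"
    unfolding sum.reindex[OF inj] by (simp add: edge_integral_def)
  also have "\<dots> = integral_form W (of_nat i) \<alpha> 1 - integral_form W (of_nat i) \<alpha> 0"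
    unfolding integral_form_def sum_subtractf[symmetric]
    by (simp add: diff_divide_distrib c.scale_left_diff_distrib)
  finally show ?thesis by (simp add: S1_def)
qed

lemma S1_simplex: "S1 W i (simplex f \<rho> (\<lambda>_. 0)) = \<rho>"
proof
  fix x
  have "0 \<in> range t_pow" by (rule range_eqI[of _ _ 0]) (simp add: t_pow_def)
  then show "S1 W i (simplex f \<rho> (\<lambda>_. 0)) x = \<rho> x"
    unfolding S1_eq_pairing
    by (subst simplex_pairing[of _ False]) (simp_all add: edge_integral_def conv_smul_apply)
qed

lemma values_simplex:
  "pairing (conv_smul W) (value_at s I) (simplex f \<rho> \<sigma>) =
    (if I = {} then conv_of_morphism (transport f (combination (s 1) \<rho> (s 2) \<sigma>)) else 0)
    + conv_smul W (if I = {1} then 1 else 0) (homotopy_form \<rho>)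
    + conv_smul W (if I = {2} then 1 else 0) (homotopy_form \<sigma>)"
  by (subst simplex_pairing[of _ "I = {}" s]) (auto simp: value_at_apply)

lemma values_face_simplex:
  "pairing (conv_smul W) (value_at s I) (face W 2 i (simplex f \<rho> \<sigma>)) =
    (if I = {} then conv_of_morphism
       (transport f (combination (face_point 2 i s 1) \<rho> (face_point 2 i s 2) \<sigma>)) else 0)
    + conv_smul W (scalar_pairing (value_at s I) (deRham (face_coord 2 i 1))) (homotopy_form \<rho>)
    + conv_smul W (scalar_pairing (value_at s I) (deRham (face_coord 2 i 2))) (homotopy_form \<sigma>)"
  unfolding pairing_face
  by (subst simplex_pairing[of _ "I = {}" "face_point 2 i s"])
    (simp_all add: value_at_form_face del: form_face.simps)

lemma face_2_simplex: "face W 2 2 (simplex f \<rho> \<sigma>) = simplex f \<rho> (\<lambda>_. 0)"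
  by (rule eqI_values[OF vs])
    (auto simp: values_simplex values_face_simplex face_differential_2 face_point_2 homotopy_form_zero)

lemma homotopy_form_add:
  "homotopy_form (\<lambda>x. \<rho> x + \<sigma> x) = homotopy_form \<rho> + (homotopy_form \<sigma> :: ('a, 'b) word \<Rightarrow> 'c \<times> 'd)"
proof
  fix w show "homotopy_form (\<lambda>x. \<rho> x + \<sigma> x) w = (homotopy_form \<rho> + (homotopy_form \<sigma> :: ('a, 'b) word \<Rightarrow> 'c \<times> 'd)) w"
    by (cases "(\<rho>, w)" rule: homotopy_form.cases) (simp_all add: prod_eq_iff)
qed

text \<open>On the edge opposite to the vertex \<open>f\<close> one has \<open>t\<^sub>1 = 1 - t\<close> and \<open>t\<^sub>2 = t\<close>, so the homotopy
  parameter is \<open>(1 - t) \<theta> + t (\<theta> + \<tau>) = \<theta> + t \<tau>\<close>.\<close>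

lemma face_0_simplex:
  assumes \<theta>: "Vector_Spaces.linear (smul0 V) (smul1 W) \<theta>" and \<tau>: "Vector_Spaces.linear (smul0 V) (smul1 W) \<tau>"
  shows "face W 2 0 (simplex f \<theta> (\<lambda>x. \<theta> x + \<tau> x)) = simplex (transport f \<theta>) \<tau> (\<lambda>_. 0)"
proof (rule eqI_values[OF vs])
  fix s :: "nat \<Rightarrow> 'k" and I :: "nat set"
  interpret c: vector_space "conv_smul W :: _ \<Rightarrow> (('a, 'b) word \<Rightarrow> 'c \<times> 'd) \<Rightarrow> _" by (rule vs)
  have "Vector_Spaces.linear (smul0 V) (smul1 W) (\<lambda>x. smul1 W (s (Suc 0)) (\<tau> x))"
    using linear_combination[OF \<tau> \<tau>, of "s (Suc 0)" 0] by simp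
  note transport = transport_transport[OF \<theta> this, of f]
  have parameter: "combination (1 - s (Suc 0)) \<theta> (s (Suc 0)) (\<lambda>x. \<theta> x + \<tau> x)
      = (\<lambda>x. \<theta> x + smul1 W (s (Suc 0)) (\<tau> x))"
    by (simp add: fun_eq_iff W.s1.scale_left_diff_distrib W.s1.scale_right_distrib)
  show "pairing (conv_smul W) (value_at s I) (face W 2 0 (simplex f \<theta> (\<lambda>x. \<theta> x + \<tau> x)))
    = pairing (conv_smul W) (value_at s I) (simplex (transport f \<theta>) \<tau> (\<lambda>_. 0))"
    by (auto simp: values_simplex values_face_simplex face_differential_2 face_point_2 homotopy_form_zero
        homotopy_form_add parameter transport)
qed

text \<open>This is where additivity comes from. Consider the coefficient of \<open>dt\<^sub>1 dt\<^sub>2\<close> in the Maurer-Cartan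
  equation at a one-letter word \<open>sx\<close>. The brackets with at least two arguments vanish there, since such a word
  cannot be split, and so does \<open>D\<close>, for degree reasons. What remains is the differential of the 1-form
  part \<open>r\<close>, so \<open>r\<close> is closed at \<open>sx\<close>, and its integral over the triangle's boundary is zero.\<close>

lemma S1_face_boundary:
  assumes \<alpha>: "\<alpha> \<in> MC V W D 2"
  shows "S1 W j (face W 2 1 \<alpha>) x = S1 W k (face W 2 0 \<alpha>) x + S1 W l (face W 2 2 \<alpha>) x"
proof -
  let ?K = "Poly_Mapping.keys \<alpha>"
  let ?l = "\<lambda>b. snd (Poly_Mapping.lookup \<alpha> b [Inl x])"
  let ?E = "\<lambda>i b. scalar_pairing edge_integral (form_face 2 i b) :: 'k"
  let ?T = "\<lambda>b. scalar_pairing triangle_integral (deRham (Poly_Mapping.single b 1)) :: 'k"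
  have coeff: "b \<in> forms_on 2" "card (snd b) = 1 \<or> ?l b = 0" if "b \<in> ?K" for b
  proof -
    have "Poly_Mapping.lookup \<alpha> b \<in> conv V W (int (card (snd b)) - 1)" "b \<in> forms_on 2"
      using \<alpha> that by (auto simp: MC_def)
    then have "Poly_Mapping.lookup \<alpha> b [Inl x] \<in> graded_part (word_deg [Inl x :: 'a + 'b] + (int (card (snd b)) - 1))"
      unfolding conv_def by blast
    then show "b \<in> forms_on 2" "card (snd b) = 1 \<or> ?l b = 0"
      using \<open>b \<in> forms_on 2\<close> by (auto simp: graded_part_def)
  qed
  have D: "D [Inl x] = 0" by (rule D_degree_le_1) simp
  have br2: "conv_bracket W [(i, F), (j, G)] [Inl x] = 0"
    and br3: "conv_bracket W [(i, F), (j, G), (k, H)] [Inl x] = 0" for i j k F G H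
    by (simp_all add: conv_bracket_2 conv_bracket_3_expand)
  have "curvature \<alpha> = 0" using \<alpha> by (simp add: MC_eq)
  then have "0 = snd (pairing (conv_smul W) triangle_integral (curvature \<alpha>) [Inl x])" by simp
  also have "\<dots> = (\<Sum>b\<in>?K. smul1 W (?T b * (-1) powi (int (card (snd b)) - 1)) (?l b))"
    unfolding pairing_curvature pairing_tensor_bracket1 pairing_tensor_bracket_2 pairing_tensor_bracket_3 br2 br3
    by (simp add: pairing_def sum_fun_apply conv_smul_apply conv_bracket1_def D snd_sum)
  also have "\<dots> = (\<Sum>b\<in>?K. smul1 W (?E 0 b - ?E 1 b + ?E 2 b) (?l b))"
  proof (intro sum.cong refl)
    fix b assume b: "b \<in> ?K"
    show "smul1 W (?T b * (-1) powi (int (card (snd b)) - 1)) (?l b) = smul1 W (?E 0 b - ?E 1 b + ?E 2 b) (?l b)"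
    proof (cases "card (snd b) = 1")
      case True
      then show ?thesis using stokes_basis[OF coeff(1)[OF b], where 'k = 'k] by simp
    next
      case False
      then have "?l b = 0" using coeff(2)[OF b] by blast
      then show ?thesis by simp
    qed
  qed
  also have "\<dots> = S1 W k (face W 2 0 \<alpha>) x - S1 W j (face W 2 1 \<alpha>) x + S1 W l (face W 2 2 \<alpha>) x"
    unfolding S1_eq_pairing pairing_face
    by (simp add: pairing_def sum_fun_apply conv_smul_apply snd_sum W.s1.scale_left_distrib
        W.s1.scale_left_diff_distrib sum.distrib sum_subtractf)
  finally show ?thesis by (simp add: algebra_simps)
qed

end

theorem theorem4:
  fixes V :: "('k::field_char_0, 'a::ab_group_add, 'b::ab_group_add) leibniz2"
    and W :: "('k, 'c::ab_group_add, 'd::ab_group_add) leibniz2"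
    and D :: "('a, 'b) word \<Rightarrow> ('a, 'b) word \<Rightarrow>\<^sub>0 'k"
    and f g h :: "('a, 'b, 'c, 'd) infmap"
    and \<theta> \<tau> :: "'a \<Rightarrow> 'd"
  assumes "leibniz2_algebra V" and "leibniz2_algebra W"
    and "zinbiel_coderivation V D"
    and "infinity_morphism V W f" and "infinity_morphism V W g" and "infinity_morphism V W h"
    and "\<theta> \<in> homotopies V W f g" and "\<tau> \<in> homotopies V W g h"
  shows "vertical_composites V W D f g h \<theta> \<tau> = {\<lambda>x. \<tau> x + \<theta> x} \<and>
    (\<lambda>x. \<tau> x + \<theta> x) \<in> homotopies V W f h"
proof -
  interpret leibniz2_pair V W D
    using assms(1-3) by unfold_locales
  have \<theta>: "Vector_Spaces.linear (smul0 V) (smul1 W) \<theta>" and \<tau>: "Vector_Spaces.linear (smul0 V) (smul1 W) \<tau>"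
    using assms(7,8) by (simp_all add: homotopies_def)
  have sum: "Vector_Spaces.linear (smul0 V) (smul1 W) (\<lambda>x. \<theta> x + \<tau> x)"
    using linear_combination[OF \<theta> \<tau>, of 1 1] by simp
  have g: "g = transport f \<theta>" and h: "h = transport g \<tau>"
    using assms(7,8) by (simp_all add: homotopy_imp_transport)
  have "h = transport f (\<lambda>x. \<theta> x + \<tau> x)"
    by (simp add: h g transport_transport[OF \<theta> \<tau>])
  then have "(\<lambda>x. \<tau> x + \<theta> x) \<in> homotopies V W f h"
    using transport_homotopy[OF sum, of f] by (simp add: add.commute)
  moreover have composite: "S1 W 0 (face W 2 1 \<alpha>) = (\<lambda>x. \<tau> x + \<theta> x)"
    if "\<alpha> \<in> MC V W D 2" "S1 W 1 (face W 2 2 \<alpha>) = \<theta>" "S1 W 0 (face W 2 0 \<alpha>) = \<tau>" for \<alpha>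
    using S1_face_boundary[OF that(1), of 0 _ 0 1] that(2,3) by (simp add: fun_eq_iff)
  moreover have "(\<lambda>x. \<tau> x + \<theta> x) \<in> vertical_composites V W D f g h \<theta> \<tau>"
  proof -
    let ?\<alpha> = "simplex f \<theta> (\<lambda>x. \<theta> x + \<tau> x)"
    have MC: "?\<alpha> \<in> MC V W D 2" by (rule simplex_in_MC(1)[OF assms(4) \<theta> sum])
    have faces: "face W 2 2 ?\<alpha> = simplex f \<theta> (\<lambda>_. 0)" "face W 2 0 ?\<alpha> = simplex g \<tau> (\<lambda>_. 0)"
      by (simp_all add: face_2_simplex face_0_simplex[OF \<theta> \<tau>] g)
    have edges: "face W 2 2 ?\<alpha> \<in> inf_homotopies V W D f g" "face W 2 0 ?\<alpha> \<in> inf_homotopies V W D g h"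
      unfolding faces
      using simplex_in_inf_homotopies[OF assms(4) \<theta>] simplex_in_inf_homotopies[OF assms(5) \<tau>]
      by (simp_all only: g[symmetric] h[symmetric])
    have S1: "S1 W 1 (face W 2 2 ?\<alpha>) = \<theta>" "S1 W 0 (face W 2 0 ?\<alpha>) = \<tau>"
      by (simp_all add: faces S1_simplex)
    have "S1 W 0 (face W 2 1 ?\<alpha>) \<in> vertical_composites V W D f g h \<theta> \<tau>"
      unfolding vertical_composites_def using MC edges S1 by blast
    then show ?thesis by (simp only: composite[OF MC S1])
  qed
  ultimately show ?thesis unfolding vertical_composites_def by blast
qed

end
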